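(* Let $n\ge 1$ and let $\mathbf{z}=\mathbf{z}(x_1,\ldots,x_n)$ be the universal algebraic function on $\mathbf{C}^n$, i.e. the function satisfying $\mathbf{z}^n+x_1\mathbf{z}^{n-1}+\ldots+x_n=0$. Then $\mathbf{z}$ cannot be rationally induced from an algebraic function on a variety of dimension $<\lfloor n/2\rfloor$.
   Context: Varieties are over $\mathbf{C}$; Zariski open subsets are nonempty. A branched covering over an irreducible variety $X$ is a finite surjective morphism $\tilde X\to X$ of varieties ($\tilde X$ not necessarily irreducible, each irreducible component of $\tilde X$ dominating $X$). An algebraic function $z$ on an irreducible variety $X$ is a branched covering $p:\tilde X\to X$ together with a regular function $z:\tilde X\to\mathbf{C}$. Its values at $x\in X$ are the numbers $z(\tilde x)$, $p(\tilde x)=x$; algebraic functions are regarded as equivalent if they have the same set $\{(x,t): t \text{ is a value of } z \text{ at } x\}\subset X\times\mathbf{C}$. The universal algebraic function has domain $\{(x_1,\ldots,x_n,t)\in\mathbf{C}^n\times\mathbf{C}: t^n+x_1t^{n-1}+\ldots+x_n=0\}$ and value $t$. An algebraic function $\mathbf{z}$ defined over a Zariski open subset of an irreducible variety $X$ is rationally induced from an algebraic function $\mathbf{w}$ defined over a Zariski open subset of an irreducible variety $Y$ if there exist a Zariski open $U\subset X$, a rational morphism $r$ from $X$ to $Y$ and a rational function $R$ on $X\times\mathbf{C}$ such that $\mathbf{z}(x)$, $r(x)$, $\mathbf{w}(r(x))$ and $R(x,\mathbf{w}(r(x)))$ are defined for all $x\in U$, and $\mathbf{z}(x)$ is a branch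 of $R(x,\mathbf{w}(r(x)))$ for $x\in U$. Here $R(x,\mathbf{w}(r(x)))$ is the algebraic function on $U$ whose values at $x$ are $R(x,t)$ with $t$ running over the values of $\mathbf{w}$ at $r(x)$, and "is a branch of" means that every value of $\mathbf{z}$ at $x\in U$ is among its values at $x$. *)

theory Defs
  imports "HOL-Analysis.Analysis" "HOL-Computational_Algebra.Polynomial"
begin

text \<open>
  Varieties over the complex numbers are rendered as spaces with functions (Serre's point of view):
  a Zariski topology together with a sheaf of complex-valued functions.  HOL functions are total,
  so membership in \<open>regular X U\<close> only concerns the values on \<open>U\<close> (axiom \<open>regular_cong\<close>), and
  \<open>regular X U\<close> is meaningful only for open \<open>U\<close>.
\<close>

record 'a fun_space =
  zariski :: "'a topology"
  regular :: "'a set \<Rightarrow> ('a \<Rightarrow> complex) set"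

abbreviation points :: "'a fun_space \<Rightarrow> 'a set"
  where "points X \<equiv> topspace (zariski X)"

locale space_with_functions =
  fixes X :: "'a fun_space"
  assumes regular_cong:
      "\<lbrakk>openin (zariski X) U; f \<in> regular X U; \<And>x. x \<in> U \<Longrightarrow> f x = g x\<rbrakk> \<Longrightarrow> g \<in> regular X U"
    and regular_const: "openin (zariski X) U \<Longrightarrow> (\<lambda>_. c) \<in> regular X U"
    and regular_add:
      "\<lbrakk>openin (zariski X) U; f \<in> regular X U; g \<in> regular X U\<rbrakk> \<Longrightarrow> (\<lambda>x. f x + g x) \<in> regular X U"
    and regular_mult:
      "\<lbrakk>openin (zariski X) U; f \<in> regular X U; g \<in> regular X U\<rbrakk> \<Longrightarrow> (\<lambda>x. f x * g x) \<in> regular X U"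
    and regular_sheaf:
      "(\<And>U. U \<in> \<U> \<Longrightarrow> openin (zariski X) U) \<Longrightarrow>
        f \<in> regular X (\<Union>\<U>) \<longleftrightarrow> (\<forall>U\<in>\<U>. f \<in> regular X U)"
    and open_nonvanishing:
      "\<lbrakk>openin (zariski X) U; f \<in> regular X U\<rbrakk> \<Longrightarrow> openin (zariski X) {x \<in> U. f x \<noteq> 0}"
    and regular_inverse:
      "\<lbrakk>openin (zariski X) U; f \<in> regular X U\<rbrakk> \<Longrightarrow>
        (\<lambda>x. inverse (f x)) \<in> regular X {x \<in> U. f x \<noteq> 0}"

definition morphism :: "'a fun_space \<Rightarrow> 'b fun_space \<Rightarrow> ('a \<Rightarrow> 'b) \<Rightarrow> bool"
  where "morphism X Y f \<longleftrightarrow>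
    continuous_map (zariski X) (zariski Y) f \<and>
    (\<forall>V. openin (zariski Y) V \<longrightarrow>
      (\<forall>g\<in>regular Y V. g \<circ> f \<in> regular X {x \<in> points X. f x \<in> V}))"

definition isomorphic :: "'a fun_space \<Rightarrow> 'b fun_space \<Rightarrow> bool"
  where "isomorphic X Y \<longleftrightarrow>
    (\<exists>f g. morphism X Y f \<and> morphism Y X g \<and>
      (\<forall>x\<in>points X. g (f x) = x) \<and> (\<forall>y\<in>points Y. f (g y) = y))"

text \<open>For open \<open>S\<close> this is the open subspace; for closed \<open>S\<close> it is the reduced closed subspace.\<close>

definition subspace_of :: "'a fun_space \<Rightarrow> 'a set \<Rightarrow> 'a fun_space"
  where "subspace_of X S =
    \<lparr>zariski = subtopology (zariski X) S,
     regular = (\<lambda>U. {f. \<forall>x\<in>U. \<exists>W g. openin (zariski X) W \<and> x \<in> W \<and> g \<in> regular X W \<and>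
                         (\<forall>y\<in>W \<inter> U. f y = g y)})\<rparr>"

text \<open>
  The space on \<open>S\<close> determined by an algebra \<open>A\<close> of functions on \<open>S\<close>: the nonvanishing loci of members
  of \<open>A\<close> form a base of the topology, and regular functions are locally quotients of members of \<open>A\<close>.
\<close>

definition space_of_algebra :: "'a set \<Rightarrow> ('a \<Rightarrow> complex) set \<Rightarrow> 'a fun_space"
  where "space_of_algebra S A =
    (let T = topology_generated_by ((\<lambda>a. {x \<in> S. a x \<noteq> 0}) ` A) in
      \<lparr>zariski = T,
       regular = (\<lambda>U. {f. \<forall>x\<in>U. \<exists>W a b. openin T W \<and> x \<in> W \<and> W \<subseteq> U \<and> a \<in> A \<and> b \<in> A \<and>
                           (\<forall>y\<in>W. b y \<noteq> 0 \<and> f y = a y / b y)})\<rparr>)"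

inductive_set polynomial_functions :: "'i set \<Rightarrow> (('i \<Rightarrow> complex) \<Rightarrow> complex) set"
  for I :: "'i set"
  where
    const: "(\<lambda>_. c) \<in> polynomial_functions I"
  | coord: "i \<in> I \<Longrightarrow> (\<lambda>x. x i) \<in> polynomial_functions I"
  | add: "\<lbrakk>f \<in> polynomial_functions I; g \<in> polynomial_functions I\<rbrakk> \<Longrightarrow>
      (\<lambda>x. f x + g x) \<in> polynomial_functions I"
  | mult: "\<lbrakk>f \<in> polynomial_functions I; g \<in> polynomial_functions I\<rbrakk> \<Longrightarrow>
      (\<lambda>x. f x * g x) \<in> polynomial_functions I"

text \<open>
  Points of \<open>n\<close>-space are the functions on \<open>{1..n}\<close>, extended by \<open>undefined\<close>, so that \<open>n\<close> may vary
  and coordinates are numbered from 1.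
\<close>

definition affine_space :: "nat \<Rightarrow> (nat \<Rightarrow> complex) fun_space"
  where "affine_space n = space_of_algebra ({1..n} \<rightarrow>\<^sub>E UNIV) (polynomial_functions {1..n})"

definition affine_line :: "complex fun_space"
  where "affine_line = space_of_algebra UNIV (range poly)"

definition affine_variety :: "'a fun_space \<Rightarrow> bool"
  where "affine_variety X \<longleftrightarrow>
    (\<exists>n Z. closedin (zariski (affine_space n)) Z \<and> isomorphic X (subspace_of (affine_space n) Z))"

text \<open>
  The product of varieties.  Its topology is finer than the product topology: basic open sets are the
  nonvanishing loci of finite sums \<open>\<Sum>i. f i x * g i y\<close> on products \<open>U \<times> V\<close> of open sets.
\<close>

definition tensor_functions ::
    "'a fun_space \<Rightarrow> 'b fun_space \<Rightarrow> 'a set \<Rightarrow> 'b set \<Rightarrow> ('a \<times> 'b \<Rightarrow> complex) set"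
  where "tensor_functions X Y U V =
    {h. \<exists>(k::nat) f g. (\<forall>i<k. f i \<in> regular X U \<and> g i \<in> regular Y V) \<and>
          h = (\<lambda>(x, y). \<Sum>i<k. f i x * g i y)}"

definition product_zariski :: "'a fun_space \<Rightarrow> 'b fun_space \<Rightarrow> ('a \<times> 'b) topology"
  where "product_zariski X Y = topology_generated_by
    {{q \<in> U \<times> V. h q \<noteq> 0} | U V h.
      openin (zariski X) U \<and> openin (zariski Y) V \<and> h \<in> tensor_functions X Y U V}"

definition product_space :: "'a fun_space \<Rightarrow> 'b fun_space \<Rightarrow> ('a \<times> 'b) fun_space"
  where "product_space X Y =
    \<lparr>zariski = product_zariski X Y,
     regular = (\<lambda>W. {h. \<forall>q\<in>W. \<exists>U V N a b.
        openin (zariski X) U \<and> openin (zariski Y) V \<and>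
        openin (product_zariski X Y) N \<and> q \<in> N \<and> N \<subseteq> W \<inter> (U \<times> V) \<and>
        a \<in> tensor_functions X Y U V \<and> b \<in> tensor_functions X Y U V \<and>
        (\<forall>s\<in>N. b s \<noteq> 0 \<and> h s = a s / b s)})\<rparr>"

text \<open>Varieties are separated and of finite type, but possibly reducible.\<close>

locale variety = space_with_functions +
  assumes finite_affine_cover:
      "\<exists>\<U>. finite \<U> \<and> \<Union>\<U> = points X \<and>
        (\<forall>U\<in>\<U>. openin (zariski X) U \<and> affine_variety (subspace_of X U))"
    and separated: "closedin (zariski (product_space X X)) {(x, x) | x. x \<in> points X}"

definition irreducible_set :: "'a topology \<Rightarrow> 'a set \<Rightarrow> bool"
  where "irreducible_set T S \<longleftrightarrow>
    S \<noteq> {} \<and> S \<subseteq> topspace T \<and>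
    (\<forall>A B. closedin T A \<and> closedin T B \<and> S \<subseteq> A \<union> B \<longrightarrow> S \<subseteq> A \<or> S \<subseteq> B)"

definition irreducible_component :: "'a topology \<Rightarrow> 'a set \<Rightarrow> bool"
  where "irreducible_component T C \<longleftrightarrow>
    irreducible_set T C \<and> (\<forall>S. irreducible_set T S \<and> C \<subseteq> S \<longrightarrow> S = C)"

locale irreducible_variety = variety +
  assumes irreducible: "irreducible_set (zariski X) (points X)"

text \<open>Krull dimension: the supremum of the lengths of strict chains of irreducible closed subsets.\<close>

definition variety_dim :: "'a fun_space \<Rightarrow> enat"
  where "variety_dim X = Sup {enat k | k. \<exists>Z :: nat \<Rightarrow> 'a set.
    (\<forall>i\<le>k. closedin (zariski X) (Z i) \<and> irreducible_set (zariski X) (Z i)) \<and>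
    (\<forall>i<k. Z i \<subset> Z (Suc i))}"

definition finite_morphism :: "'a fun_space \<Rightarrow> 'b fun_space \<Rightarrow> ('a \<Rightarrow> 'b) \<Rightarrow> bool"
  where "finite_morphism X Y p \<longleftrightarrow>
    morphism X Y p \<and>
    (\<forall>y\<in>points Y. \<exists>V. openin (zariski Y) V \<and> y \<in> V \<and> affine_variety (subspace_of Y V) \<and>
      (let P = {x \<in> points X. p x \<in> V} in
        affine_variety (subspace_of X P) \<and>
        (\<exists>G. finite G \<and> G \<subseteq> regular X P \<and>
          (\<forall>h\<in>regular X P. \<exists>c. (\<forall>g\<in>G. c g \<in> regular Y V) \<and>
            (\<forall>x\<in>P. h x = (\<Sum>g\<in>G. c g (p x) * g x))))))"

definition branched_covering :: "'b fun_space \<Rightarrow> 'a fun_space \<Rightarrow> ('b \<Rightarrow> 'a) \<Rightarrow> bool"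
  where "branched_covering X' X p \<longleftrightarrow>
    variety X' \<and> finite_morphism X' X p \<and> p ` points X' = points X \<and>
    (\<forall>C. irreducible_component (zariski X') C \<longrightarrow> zariski X closure_of (p ` C) = points X)"

record ('a, 'b) algfun =
  covering_space :: "'b fun_space"
  covering_map :: "'b \<Rightarrow> 'a"
  covering_value :: "'b \<Rightarrow> complex"

definition algebraic_function :: "'a fun_space \<Rightarrow> ('a, 'b) algfun \<Rightarrow> bool"
  where "algebraic_function X z \<longleftrightarrow>
    branched_covering (covering_space z) X (covering_map z) \<and>
    covering_value z \<in> regular (covering_space z) (points (covering_space z))"

definition algebraic_function_over :: "'a fun_space \<Rightarrow> 'a set \<Rightarrow> ('a, 'b) algfun \<Rightarrow> bool"
  where "algebraic_function_over X S z \<longleftrightarrow>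
    openin (zariski X) S \<and> S \<noteq> {} \<and> algebraic_function (subspace_of X S) z"

text \<open>
  Equivalent algebraic functions are those with the same \<open>values_at\<close> at every point; \<open>rationally_induced\<close>
  depends on them only through their values, so it is well defined on equivalence classes.
\<close>

definition values_at :: "('a, 'b) algfun \<Rightarrow> 'a \<Rightarrow> complex set"
  where "values_at z x = covering_value z ` {y \<in> points (covering_space z). covering_map z y = x}"

definition universal_algfun :: "nat \<Rightarrow> (nat \<Rightarrow> complex, (nat \<Rightarrow> complex) \<times> complex) algfun"
  where "universal_algfun n =
    \<lparr>covering_space = subspace_of (product_space (affine_space n) affine_line)
       {(x, t). x \<in> points (affine_space n) \<and> t ^ n + (\<Sum>i=1..n. x i * t ^ (n - i)) = 0},
     covering_map = fst,
     covering_value = snd\<rparr>"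

text \<open>
  Rational maps and rational functions on irreducible varieties are given by representatives
  \<open>(D, r)\<close> and \<open>(E, R)\<close>.  Being defined at a point means that some representative has this point in
  its domain; quantifying existentially over representatives thus includes the maximal ones.
\<close>

definition rational_map :: "'a fun_space \<Rightarrow> 'b fun_space \<Rightarrow> 'a set \<Rightarrow> ('a \<Rightarrow> 'b) \<Rightarrow> bool"
  where "rational_map X Y D r \<longleftrightarrow>
    openin (zariski X) D \<and> D \<noteq> {} \<and> morphism (subspace_of X D) Y r"

definition rational_function :: "'a fun_space \<Rightarrow> 'a set \<Rightarrow> ('a \<Rightarrow> complex) \<Rightarrow> bool"
  where "rational_function X E R \<longleftrightarrow> openin (zariski X) E \<and> E \<noteq> {} \<and> R \<in> regular X E"

text \<open>Here \<open>z\<close> is defined over the open subset \<open>S\<close> of \<open>X\<close>, and \<open>w\<close> over the open subset \<open>T\<close> of \<open>Y\<close>.\<close>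

definition rationally_induced ::
    "'a fun_space \<Rightarrow> 'a set \<Rightarrow> ('a, 'c) algfun \<Rightarrow> 'b fun_space \<Rightarrow> 'b set \<Rightarrow> ('b, 'd) algfun \<Rightarrow> bool"
  where "rationally_induced X S z Y T w \<longleftrightarrow>
    (\<exists>U D r E R.
      openin (zariski X) U \<and> U \<noteq> {} \<and>
      rational_map X Y D r \<and> rational_function (product_space X affine_line) E R \<and>
      U \<subseteq> S \<and> U \<subseteq> D \<and> r ` U \<subseteq> T \<and>
      (\<forall>x\<in>U. \<forall>t\<in>values_at w (r x). (x, t) \<in> E) \<and>
      (\<forall>x\<in>U. values_at z x \<subseteq> {R (x, t) | t. t \<in> values_at w (r x)}))"

end

theory Submission
  imports Defs "Jordan_Normal_Form.Char_Poly" "HOL-Computational_Algebra.Primes"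
begin

text \<open>
  Set \<open>k = n div 2\<close> and restrict the universal function to the polynomials
  \<open>\<Prod>i\<le>k. ((t - c i)\<^sup>2 - (v i)\<^sup>2)\<close> (times one more linear factor if \<open>n\<close> is odd).  Their coefficients are
  unchanged by the sign changes \<open>v i \<mapsto> \<plusminus> v i\<close>, while the roots \<open>c i + v i\<close> are moved.
  Order monomials in \<open>v\<close> by their growth; leading exponents form a valuation with values in \<open>k\<close>-tuples
  of integers.  Algebraically independent functions on \<open>Y\<close> give a chain of primes, hence a chain of irreducible
  closed subsets, and functions with independent exponents are algebraically independent.
  So if \<open>dim Y < k\<close>, some integer vector \<open>l \<noteq> 0\<close>, which may be taken to have an odd entry,
  is orthogonal to the exponents of all functions pulled back from \<open>Y\<close>, hence to those of all rational
  functions of \<open>v\<close> algebraic over them.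

  Let \<open>Q\<close> be the greatest common divisor of the equation of \<open>w\<close> and \<open>a - (c i + v i) b\<close>, where
  \<open>R = a / b\<close> and \<open>l i\<close> is odd.  Its coefficients \<open>f\<close> are algebraic over the functions from \<open>Y\<close>, as are
  the differences \<open>f - \<sigma> f\<close> for the sign change \<open>\<sigma>\<close> given by the parity of \<open>l\<close>.  The latter are multiplied
  by \<open>-1\<close> under \<open>\<sigma>\<close>, so that the exponent would pair oddly with \<open>l\<close> unless they vanish.
  Hence \<open>\<sigma> Q = Q\<close>, and \<open>a / b\<close> takes both values \<open>c i \<plusminus> v i\<close> at a root of \<open>Q\<close>, a contradiction.
\<close>

text \<open>The values of \<open>w\<close> that produce a given root of the universal equation
  cannot be chosen as functions of \<open>v\<close>. A greatest common divisor collects all of them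
  at once, and its normalised coefficients are honest rational functions of \<open>v\<close>. Of
  these coefficients only the differences with their flips have a forced parity, hence the passage
  to differences. Their algebraicity comes from the roots: a monic divisor of the equation is a
  product over some of its roots, and polynomials in the roots are integral over the coefficients.
  Half of \<open>n\<close> appears because a sign change needs two roots, \<open>c i + v i\<close>
  and \<open>c i - v i\<close>, to exchange. The valuation is realised by growth rates along one
  real curve and along its images under all sign changes, so that an exponent is seen together with
  its sign under each flip. Dimension enters through a lower bound only: without an orthogonal
  vector, \<open>k\<close> successive transcendental elements give a chain of \<open>k + 1\<close>
  primes. Both this chain and the Nullstellensatz rest on the uncountability of the complex
  numbers.\<close>

hide_const (open) module.smult

section \<open>Algebras of functions and integral dependence\<close>

text \<open>Members are functions on the whole type, so one development serves polynomial functions,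
  regular functions on an open set, fractions near a point and fractions of functions pulled back
  from \<open>Y\<close>.\<close>

locale function_algebra =
  fixes A :: "('x \<Rightarrow> complex) set"
  assumes const: "(\<lambda>_. c) \<in> A"
    and add: "f \<in> A \<Longrightarrow> g \<in> A \<Longrightarrow> (\<lambda>x. f x + g x) \<in> A"
    and mult: "f \<in> A \<Longrightarrow> g \<in> A \<Longrightarrow> (\<lambda>x. f x * g x) \<in> A"
begin

lemma uminus: "f \<in> A \<Longrightarrow> (\<lambda>x. - f x) \<in> A"
  using mult[OF const[of "-1"]] by force

lemma diff: "f \<in> A \<Longrightarrow> g \<in> A \<Longrightarrow> (\<lambda>x. f x - g x) \<in> A"
  using add[OF _ uminus] by force

lemma sum: "(\<And>i. i \<in> I \<Longrightarrow> f i \<in> A) \<Longrightarrow> (\<lambda>x. \<Sum>i\<in>I. f i x) \<in> A"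
  by (induction I rule: infinite_finite_induct) (auto intro: const add)

lemma prod: "(\<And>i. i \<in> I \<Longrightarrow> f i \<in> A) \<Longrightarrow> (\<lambda>x. \<Prod>i\<in>I. f i x) \<in> A"
  by (induction I rule: infinite_finite_induct) (auto intro: const mult)

lemma power: "f \<in> A \<Longrightarrow> (\<lambda>x. f x ^ m) \<in> A"
  by (induction m) (auto intro: const mult)

text \<open>A polynomial in one more variable over \<open>A\<close>, seen as a family of complex
  polynomials. The degrees may be unbounded here; \<open>polynomial_family\<close> below adds the
  bound.\<close>

definition poly_family :: "('x \<Rightarrow> complex poly) \<Rightarrow> bool"
  where "poly_family F \<longleftrightarrow> (\<forall>l. (\<lambda>x. coeff (F x) l) \<in> A)"

lemma poly_family_coeff: "poly_family F \<Longrightarrow> (\<lambda>x. coeff (F x) l) \<in> A"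
  by (simp add: poly_family_def)

lemma poly_family_const: "poly_family (\<lambda>_. p)"
  by (auto simp: poly_family_def intro: const)

lemma poly_family_add: "poly_family F \<Longrightarrow> poly_family G \<Longrightarrow> poly_family (\<lambda>x. F x + G x)"
  by (auto simp: poly_family_def intro: add)

lemma poly_family_mult: "poly_family F \<Longrightarrow> poly_family G \<Longrightarrow> poly_family (\<lambda>x. F x * G x)"
  by (auto simp: poly_family_def coeff_mult intro!: sum mult)

lemma poly_family_sum: "(\<And>i. i \<in> I \<Longrightarrow> poly_family (F i)) \<Longrightarrow> poly_family (\<lambda>x. \<Sum>i\<in>I. F i x)"
  by (auto simp: poly_family_def coeff_sum intro: sum)

lemma poly_family_prod: "(\<And>i. i \<in> I \<Longrightarrow> poly_family (F i)) \<Longrightarrow> poly_family (\<lambda>x. \<Prod>i\<in>I. F i x)"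
  by (induction I rule: infinite_finite_induct) (auto intro: poly_family_const poly_family_mult)

lemma poly_family_const_coeff: "f \<in> A \<Longrightarrow> poly_family (\<lambda>x. [:f x:])"
  unfolding poly_family_def
proof
  fix l assume "f \<in> A" then show "(\<lambda>x. coeff [:f x:] l) \<in> A"
    by (cases l) (auto intro: const)
qed

lemma poly_family_linear: "f \<in> A \<Longrightarrow> poly_family (\<lambda>x. [:- f x, 1:])"
proof -
  assume "f \<in> A"
  then have "poly_family (\<lambda>x. [:- f x:] + [:0, 1:])"
    by (intro poly_family_add poly_family_const_coeff poly_family_const uminus)
  then show ?thesis by simp
qed

end

text \<open>Determinant trick: by \<open>eq\<close> the matrix of the \<open>c i j\<close> at
  \<open>\<pi> y\<close> has the vector of the \<open>w i y\<close> as eigenvector with eigenvalue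
  \<open>\<phi> y\<close>, and \<open>nz\<close> makes this vector nonzero. Hence
  \<open>\<phi> y\<close> is a root of the characteristic polynomial, whose coefficients stay in
  \<open>A\<close>.\<close>

lemma (in function_algebra) integral_equation:
  fixes \<phi> :: "'y \<Rightarrow> complex" and \<pi> :: "'y \<Rightarrow> 'x"
  assumes J: "finite J"
    and c: "\<And>i j. i \<in> J \<Longrightarrow> j \<in> J \<Longrightarrow> c i j \<in> A"
    and eq: "\<And>y i. y \<in> Y \<Longrightarrow> i \<in> J \<Longrightarrow> \<phi> y * w i y = (\<Sum>j\<in>J. c i j (\<pi> y) * w j y)"
    and nz: "\<And>y. y \<in> Y \<Longrightarrow> \<exists>i\<in>J. w i y \<noteq> 0"
  obtains H where "poly_family H" "\<And>x. degree (H x) = card J" "\<And>x. lead_coeff (H x) = 1"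
    "\<And>y. y \<in> Y \<Longrightarrow> poly (H (\<pi> y)) (\<phi> y) = 0"
proof -
  define N where "N = card J"
  obtain h where h: "bij_betw h {..<N} J"
    using J ex_bij_betw_nat_finite[OF J] by (auto simp: N_def atLeast0LessThan)
  define M where "M x = mat N N (\<lambda>(i, j). c (h i) (h j) x)" for x
  have M: "M x \<in> carrier_mat N N" for x by (simp add: M_def)
  have hJ: "i < N \<Longrightarrow> h i \<in> J" for i using h by (auto simp: bij_betw_def)
  show thesis
  proof
    show "degree (char_poly (M x)) = card J" "lead_coeff (char_poly (M x)) = 1" for x
      using degree_monic_char_poly[OF M] by (auto simp: N_def)
    have ent: "poly_family (\<lambda>x. char_poly_matrix (M x) $$ (i, j))" if "i < N" "j < N" for i j
    proof -
      have "char_poly_matrix (M x) $$ (i, j) = (if i = j then [:0, 1:] else 0) + [:- c (h i) (h j) x:]" for x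
        using that by (simp add: char_poly_matrix_def M_def)
      moreover have "poly_family (\<lambda>x. (if i = j then [:0, 1:] else 0) + [:- c (h i) (h j) x:])"
        using that by (intro poly_family_add poly_family_const poly_family_const_coeff uminus c hJ)
      ultimately show ?thesis by simp
    qed
    show "poly_family (\<lambda>x. char_poly (M x))"
      unfolding char_poly_def det_def'[OF char_poly_matrix_closed[OF M]]
      by (intro poly_family_sum poly_family_mult poly_family_const poly_family_prod ent)
         (auto dest: permutes_in_image)
    fix y assume y: "y \<in> Y"
    define u where "u = vec N (\<lambda>i. w (h i) y)"
    obtain i where i: "i < N" "w (h i) y \<noteq> 0"
      using nz[OF y] h by (metis bij_betw_iff_bijections lessThan_iff)
    have "u \<noteq> 0\<^sub>v N"
    proof
      assume "u = 0\<^sub>v N"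
      then have "u $ i = 0" using i by simp
      then show False using i by (simp add: u_def)
    qed
    moreover have "M (\<pi> y) *\<^sub>v u = \<phi> y \<cdot>\<^sub>v u"
    proof (rule eq_vecI)
      fix i assume "i < dim_vec (\<phi> y \<cdot>\<^sub>v u)"
      then have i: "i < N" by (simp add: u_def)
      have "(M (\<pi> y) *\<^sub>v u) $ i = (\<Sum>j\<in>{0..<N}. c (h i) (h j) (\<pi> y) * w (h j) y)"
        using i by (simp add: M_def u_def scalar_prod_def)
      also have "\<dots> = (\<Sum>j\<in>J. c (h i) j (\<pi> y) * w j y)"
        by (rule sum.reindex_bij_betw) (use h in \<open>simp add: atLeast0LessThan\<close>)
      also have "\<dots> = (\<phi> y \<cdot>\<^sub>v u) $ i" using eq[OF y hJ[OF i]] i by (simp add: u_def)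
      finally show "(M (\<pi> y) *\<^sub>v u) $ i = (\<phi> y \<cdot>\<^sub>v u) $ i" .
    qed (simp add: M_def u_def)
    ultimately have "eigenvalue (M (\<pi> y)) (\<phi> y)"
      by (auto simp: eigenvalue_def eigenvector_def u_def M_def intro!: exI[of _ u])
    then show "poly (char_poly (M (\<pi> y))) (\<phi> y) = 0"
      using eigenvalue_root_char_poly[OF M] by simp
  qed
qed

section \<open>Polynomial functions and integrality of functions of the roots\<close>

interpretation pf: function_algebra "polynomial_functions I" for I
  by unfold_locales (auto intro: polynomial_functions.intros)

lemma monic_root_power:
  fixes p :: "complex poly"
  assumes "lead_coeff p = 1" "poly p s = 0"
  shows "s ^ degree p = - (\<Sum>l<degree p. coeff p l * s ^ l)"
proof -
  have "0 = (\<Sum>l\<le>degree p. coeff p l * s ^ l)" using assms by (simp add: poly_altdef)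
  also have "\<dots> = (\<Sum>l<degree p. coeff p l * s ^ l) + s ^ degree p"
    using assms(1) by (simp flip: lessThan_Suc_atMost)
  finally show ?thesis by (simp add: eq_neg_iff_add_eq_0 add.commute)
qed

lemma degree_prod_linear: "degree (\<Prod>i\<in>I. [:- s i, 1:] :: complex poly) = card I"
  by (subst degree_prod_sum_eq) auto

lemma lead_coeff_prod_linear: "lead_coeff (\<Prod>i\<in>I. [:- s i, 1:] :: complex poly) = 1"
  by (simp add: lead_coeff_prod)

text \<open>Multiplication by a root preserves the \<open>A\<close>-module generated by the
  monomials in the roots with all exponents below \<open>m\<close>, because the equation rewrites
  the \<open>m\<close>-th power. The determinant trick then gives an equation for \<Phi>. It does
  not depend on the numbering of the roots, as \<open>s\<close> may be any enumeration of
  them.\<close>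

lemma (in function_algebra) root_polynomial_integral:
  fixes P :: "'x \<Rightarrow> complex poly" and m :: nat
  assumes P: "poly_family P" and \<Phi>: "\<Phi> \<in> polynomial_functions {..<m}"
  obtains H D where "poly_family H" "\<And>x. degree (H x) = D" "\<And>x. lead_coeff (H x) = 1"
    "\<And>x s. P x = (\<Prod>i<m. [:- s i, 1:]) \<Longrightarrow> poly (H x) (\<Phi> s) = 0"
proof -
  define J where "J = ({..<m} \<rightarrow>\<^sub>E {..<m})"
  have J: "finite J" unfolding J_def by (intro finite_PiE) auto
  define w where "w e = (\<lambda>(x :: 'x, s :: nat \<Rightarrow> complex). \<Prod>i<m. s i ^ e i)" for e
  define Y where "Y = {(x, s). P x = (\<Prod>i<m. [:- s i, 1:])}"
  \<comment> \<open>Functions are compared only on \<open>Y\<close>, the pairs of a point and an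
    enumeration of the roots there.\<close>
  define Mod where "Mod = {F. \<exists>c. (\<forall>e\<in>J. c e \<in> A) \<and> (\<forall>y\<in>Y. F y = (\<Sum>e\<in>J. c e (fst y) * w e y))}"
  have Mod_add: "(\<lambda>y. F y + G y) \<in> Mod" if F: "F \<in> Mod" and G: "G \<in> Mod" for F G
  proof -
    obtain c where c: "\<forall>e\<in>J. c e \<in> A" "\<forall>y\<in>Y. F y = (\<Sum>e\<in>J. c e (fst y) * w e y)"
      using F unfolding Mod_def by blast
    obtain d where d: "\<forall>e\<in>J. d e \<in> A" "\<forall>y\<in>Y. G y = (\<Sum>e\<in>J. d e (fst y) * w e y)"
      using G unfolding Mod_def by blast
    show ?thesis unfolding Mod_def using c d
      by (intro CollectI exI[of _ "\<lambda>e x. c e x + d e x"]) (auto simp: sum.distrib algebra_simps intro: add)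
  qed
  have Mod_scale: "(\<lambda>y. a (fst y) * F y) \<in> Mod" if a: "a \<in> A" and F: "F \<in> Mod" for a F
  proof -
    obtain c where "\<forall>e\<in>J. c e \<in> A" "\<forall>y\<in>Y. F y = (\<Sum>e\<in>J. c e (fst y) * w e y)"
      using F unfolding Mod_def by blast
    then show ?thesis unfolding Mod_def using a
      by (intro CollectI exI[of _ "\<lambda>e x. a x * c e x"]) (auto simp: sum_distrib_left algebra_simps intro: mult)
  qed
  have Mod_zero: "(\<lambda>_. 0) \<in> Mod"
    unfolding Mod_def by (auto intro!: exI[of _ "\<lambda>_ _. 0"] const)
  have Mod_sum: "(\<lambda>y. \<Sum>i\<in>I. F i y) \<in> Mod" if "\<And>i. i \<in> I \<Longrightarrow> F i \<in> Mod" for I :: "'i set" and F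
    using that by (induction I rule: infinite_finite_induct) (auto intro: Mod_zero Mod_add)
  have Mod_cong: "G \<in> Mod" if "F \<in> Mod" "\<And>y. y \<in> Y \<Longrightarrow> G y = F y" for F G
    using that unfolding Mod_def by auto
  have Mod_w: "w e \<in> Mod" if "e \<in> J" for e
    unfolding Mod_def using that J
    by (auto intro!: exI[of _ "\<lambda>e' _. if e' = e then 1 else 0"] const simp: if_distrib[of "\<lambda>x. x * _"] cong: if_cong)
  have w_upd: "w (e(i := l)) (x, s) = s i ^ l * (\<Prod>j\<in>{..<m}-{i}. s j ^ e j)" if "i < m" for e i l x s
  proof -
    have "w (e(i := l)) (x, s) = s i ^ l * (\<Prod>j\<in>{..<m}-{i}. s j ^ (e(i := l)) j)"
      unfolding w_def using that by (simp add: prod.remove[of "{..<m}" i])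
    also have "(\<Prod>j\<in>{..<m}-{i}. s j ^ (e(i := l)) j) = (\<Prod>j\<in>{..<m}-{i}. s j ^ e j)"
      by (rule prod.cong) auto
    finally show ?thesis .
  qed
  have upd_J: "e(i := l) \<in> J" if "e \<in> J" "i < m" "l < m" for e i l
    using that by (auto simp: J_def PiE_iff extensional_def)
  have shift_w: "(\<lambda>y. snd y i * w e y) \<in> Mod" if i: "i < m" and e: "e \<in> J" for i e
  proof (cases "Suc (e i) < m")
    case True
    have "snd y i * w e y = w (e(i := Suc (e i))) y" for y
      using w_upd[OF i, of e "e i" "fst y" "snd y"] w_upd[OF i, of e "Suc (e i)" "fst y" "snd y"]
      by (simp add: algebra_simps)
    then show ?thesis using Mod_w[OF upd_J[OF e i True]] by simp
  next
    case False
    \<comment> \<open>The exponent has reached \<open>m - 1\<close>, so one more factor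
      \<open>s i\<close> calls for the equation of \<open>P\<close>.\<close>
    then have ei: "Suc (e i) = m" using e i by (force simp: J_def PiE_iff)
    have "(\<lambda>y. \<Sum>l<m. - coeff (P (fst y)) l * w (e(i := l)) y) \<in> Mod"
    proof (rule Mod_sum)
      fix l assume "l \<in> {..<m}"
      then show "(\<lambda>y. - coeff (P (fst y)) l * w (e(i := l)) y) \<in> Mod"
        using Mod_scale[OF uminus[OF poly_family_coeff[OF P]] Mod_w[OF upd_J[OF e i, of l]]] by simp
    qed
    then show ?thesis
    proof (rule Mod_cong)
      fix y assume y: "y \<in> Y"
      obtain x s where [simp]: "y = (x, s)" by (cases y)
      have Px: "P x = (\<Prod>i<m. [:- s i, 1:])" using y by (simp add: Y_def)
      then have deg: "degree (P x) = m" by (simp only: degree_prod_linear card_lessThan)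
      have lc: "lead_coeff (P x) = 1" unfolding Px by (rule lead_coeff_prod_linear)
      have "poly (P x) (s i) = 0" using i unfolding Px by (auto simp: poly_prod)
      then have sm: "s i ^ m = - (\<Sum>l<m. coeff (P x) l * s i ^ l)"
        using monic_root_power[OF lc] deg by simp
      have "snd y i * w e y = s i ^ Suc (e i) * (\<Prod>j\<in>{..<m}-{i}. s j ^ e j)"
        using w_upd[OF i, of e "e i" x s] by simp
      also have "\<dots> = (\<Sum>l<m. - coeff (P (fst y)) l * w (e(i := l)) y)"
        unfolding ei sm using w_upd[OF i, of e _ x s]
        by (simp add: sum_distrib_right sum_negf algebra_simps)
      finally show "snd y i * w e y = (\<Sum>l<m. - coeff (P (fst y)) l * w (e(i := l)) y)" .
    qed
  qed
  have shift: "(\<lambda>y. snd y i * F y) \<in> Mod" if i: "i < m" and F: "F \<in> Mod" for i F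
  proof -
    obtain c where c: "\<forall>e\<in>J. c e \<in> A" "\<forall>y\<in>Y. F y = (\<Sum>e\<in>J. c e (fst y) * w e y)"
      using F unfolding Mod_def by blast
    have "(\<lambda>y. \<Sum>e\<in>J. c e (fst y) * (snd y i * w e y)) \<in> Mod"
      using c by (intro Mod_sum Mod_scale shift_w i) auto
    then show ?thesis
      by (rule Mod_cong) (use c in \<open>auto simp: sum_distrib_left algebra_simps\<close>)
  qed
  have A_const: "(\<lambda>_. c) \<in> A" for c by (rule const)
  have act: "\<forall>F\<in>Mod. (\<lambda>y. \<Phi> (snd y) * F y) \<in> Mod"
    using \<Phi>
  proof (induction rule: polynomial_functions.induct)
    case (const c)
    show ?case by (intro ballI) (rule Mod_scale[OF A_const])
  next
    case (coord i)
    then show ?case by (auto intro: shift)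
  next
    case (add f g)
    then show ?case by (auto simp: distrib_right intro: Mod_add)
  next
    case (mult f g)
    then show ?case by (auto simp: mult.assoc)
  qed
  have "\<forall>e\<in>J. \<exists>c. (\<forall>e'\<in>J. c e' \<in> A) \<and>
      (\<forall>y\<in>Y. \<Phi> (snd y) * w e y = (\<Sum>e'\<in>J. c e' (fst y) * w e' y))"
    using act Mod_w unfolding Mod_def by blast
  then obtain c where c: "\<forall>e\<in>J. (\<forall>e'\<in>J. c e e' \<in> A) \<and>
      (\<forall>y\<in>Y. \<Phi> (snd y) * w e y = (\<Sum>e'\<in>J. c e e' (fst y) * w e' y))"
    by metis
  \<comment> \<open>The monomial with all exponents zero is the constant 1.\<close>
  have "\<exists>e\<in>J. w e y \<noteq> 0" for y
    by (rule bexI[of _ "\<lambda>i\<in>{..<m}. 0"]) (auto simp: w_def J_def split: prod.splits)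
  then obtain H where "poly_family H" "\<And>x. degree (H x) = card J" "\<And>x. lead_coeff (H x) = 1"
    "\<And>y. y \<in> Y \<Longrightarrow> poly (H (fst y)) (\<Phi> (snd y)) = 0"
    using integral_equation[OF J, of c Y "\<lambda>y. \<Phi> (snd y)" w fst] c by auto
  then show thesis by (intro that[of H "card J"]) (auto simp: Y_def)
qed

definition monomial :: "'i set \<Rightarrow> ('i \<Rightarrow> nat) \<Rightarrow> ('i \<Rightarrow> complex) \<Rightarrow> complex"
  where "monomial I e v = (\<Prod>i\<in>I. v i ^ e i)"

text \<open>Exponents are extensional functions on \<open>I\<close>, so that different elements of
  \<open>S\<close> are different monomials; the coefficients \<open>c e\<close> may still
  vanish.\<close>

lemma polynomial_function_monomials:
  assumes I: "finite I" and f: "f \<in> polynomial_functions I"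
  obtains S c where "finite S" "S \<subseteq> (I \<rightarrow>\<^sub>E UNIV)" "f = (\<lambda>v. \<Sum>e\<in>S. c e * monomial I e v)"
proof -
  define Sp where "Sp = {f. \<exists>S c. finite S \<and> S \<subseteq> (I \<rightarrow>\<^sub>E (UNIV :: nat set)) \<and>
    f = (\<lambda>v. \<Sum>e\<in>S. c e * monomial I e v)}"
  have mono_in: "(\<lambda>v. c * monomial I e v) \<in> Sp" if "e \<in> I \<rightarrow>\<^sub>E UNIV" for c e
    unfolding Sp_def using that by (intro CollectI exI[of _ "{e}"] exI[of _ "\<lambda>_. c"]) auto
  have Sp_add: "(\<lambda>v. f v + g v) \<in> Sp" if "f \<in> Sp" "g \<in> Sp" for f g
  proof -
    obtain S c where f: "finite S" "S \<subseteq> (I \<rightarrow>\<^sub>E UNIV)" "f = (\<lambda>v. \<Sum>e\<in>S. c e * monomial I e v)"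
      using \<open>f \<in> Sp\<close> unfolding Sp_def by blast
    obtain T d where g: "finite T" "T \<subseteq> (I \<rightarrow>\<^sub>E UNIV)" "g = (\<lambda>v. \<Sum>e\<in>T. d e * monomial I e v)"
      using \<open>g \<in> Sp\<close> unfolding Sp_def by blast
    have "f v + g v = (\<Sum>e\<in>S \<union> T. ((if e \<in> S then c e else 0) + (if e \<in> T then d e else 0)) * monomial I e v)" for v
    proof -
      have "f v = (\<Sum>e\<in>S \<union> T. (if e \<in> S then c e else 0) * monomial I e v)"
        unfolding f(3) using f(1) g(1) by (intro sum.mono_neutral_cong_left) auto
      moreover have "g v = (\<Sum>e\<in>S \<union> T. (if e \<in> T then d e else 0) * monomial I e v)"
        unfolding g(3) using f(1) g(1) by (intro sum.mono_neutral_cong_left) auto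
      ultimately show ?thesis by (simp add: sum.distrib distrib_right)
    qed
    then show ?thesis unfolding Sp_def using f g
      by (intro CollectI exI[of _ "S \<union> T"] exI[of _ "\<lambda>e. (if e \<in> S then c e else 0) + (if e \<in> T then d e else 0)"]) auto
  qed
  have Sp_zero: "(\<lambda>_. 0) \<in> Sp" unfolding Sp_def by (auto intro!: exI[of _ "{}"])
  have Sp_sum: "(\<lambda>v. \<Sum>j\<in>J. F j v) \<in> Sp" if "\<And>j. j \<in> J \<Longrightarrow> F j \<in> Sp" for J :: "'j set" and F
    using that by (induction J rule: infinite_finite_induct) (auto intro: Sp_zero Sp_add)
  have "f \<in> Sp" using f
  proof (induction rule: polynomial_functions.induct)
    case (const c)
    then show ?case using mono_in[of "\<lambda>i\<in>I. 0" c] by (simp add: monomial_def)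
  next
    case (coord i)
    have "monomial I (\<lambda>j\<in>I. if j = i then 1 else 0) v = v i" for v
    proof -
      have "monomial I (\<lambda>j\<in>I. if j = i then 1 else 0) v = (\<Prod>j\<in>I. if j = i then v j else 1)"
        unfolding monomial_def by (rule prod.cong) auto
      then show ?thesis using I coord by simp
    qed
    then show ?case using mono_in[of "\<lambda>j\<in>I. if j = i then 1 else 0" 1] by simp
  next
    case (add f g)
    then show ?case using Sp_add by blast
  next
    case (mult f g)
    obtain S c where f: "S \<subseteq> (I \<rightarrow>\<^sub>E UNIV)" "f = (\<lambda>v. \<Sum>e\<in>S. c e * monomial I e v)"
      using mult.IH(1) unfolding Sp_def by blast
    obtain T d where g: "T \<subseteq> (I \<rightarrow>\<^sub>E UNIV)" "g = (\<lambda>v. \<Sum>e\<in>T. d e * monomial I e v)"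
      using mult.IH(2) unfolding Sp_def by blast
    have "(\<lambda>v. \<Sum>e\<in>S. \<Sum>e'\<in>T. (c e * d e') * monomial I (\<lambda>i\<in>I. e i + e' i) v) \<in> Sp"
      by (intro Sp_sum mono_in) auto
    moreover have "monomial I (\<lambda>i\<in>I. e i + e' i) v = monomial I e v * monomial I e' v" for e e' v
      by (simp add: monomial_def power_add prod.distrib)
    ultimately show ?case unfolding f(2) g(2) by (simp add: sum_product algebra_simps)
  qed
  then show thesis using that unfolding Sp_def by blast
qed

lemma polynomial_functions_restrict:
  "f \<in> polynomial_functions I \<Longrightarrow> (\<And>i. i \<in> I \<Longrightarrow> v i = w i) \<Longrightarrow> f v = f w"
  by (induction rule: polynomial_functions.induct) auto

lemma polynomial_functions_mono: "f \<in> polynomial_functions I \<Longrightarrow> I \<subseteq> J \<Longrightarrow> f \<in> polynomial_functions J"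
  by (induction rule: polynomial_functions.induct) (auto intro: polynomial_functions.intros)

lemma (in function_algebra) polynomial_functions_compose:
  "f \<in> polynomial_functions I \<Longrightarrow> (\<And>i. i \<in> I \<Longrightarrow> (\<lambda>x. y x i) \<in> A) \<Longrightarrow> (\<lambda>x. f (y x)) \<in> A"
  by (induction rule: polynomial_functions.induct) (auto intro: const add mult)

lemma polynomial_function_on_line:
  assumes "f \<in> polynomial_functions I"
  shows "\<exists>P. \<forall>\<tau>. f (\<lambda>i. p i + \<tau> * d i) = poly P \<tau>"
  using assms
proof (induction rule: polynomial_functions.induct)
  case (const c)
  show ?case by (rule exI[of _ "[:c:]"]) simp
next
  case (coord i)
  show ?case by (rule exI[of _ "[:p i, d i:]"]) simp
next
  case (add f g)
  then show ?case by (metis poly_add)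
next
  case (mult f g)
  then show ?case by (metis poly_mult)
qed

text \<open>On the line through \<open>p\<close> and \<open>q\<close> both functions become
  polynomials in the parameter \<tau>, nonzero by their values at 0 and 1, and their product has a
  point where it does not vanish.\<close>

lemma polynomial_functions_no_zero_divisors:
  assumes f: "f \<in> polynomial_functions I" and g: "g \<in> polynomial_functions I"
    and "f p \<noteq> 0" "g q \<noteq> 0"
  shows "\<exists>\<tau>. f (\<lambda>i. p i + \<tau> * (q i - p i)) \<noteq> 0 \<and> g (\<lambda>i. p i + \<tau> * (q i - p i)) \<noteq> 0"
proof -
  obtain P where P: "\<And>\<tau>. f (\<lambda>i. p i + \<tau> * (q i - p i)) = poly P \<tau>"
    using polynomial_function_on_line[OF f, of p "\<lambda>i. q i - p i"] by blast
  obtain Q where Q: "\<And>\<tau>. g (\<lambda>i. p i + \<tau> * (q i - p i)) = poly Q \<tau>"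
    using polynomial_function_on_line[OF g, of p "\<lambda>i. q i - p i"] by blast
  have "P \<noteq> 0" "Q \<noteq> 0" using P[of 0] Q[of 1] assms by auto
  then have "P * Q \<noteq> 0" by simp
  then obtain \<tau> where "poly (P * Q) \<tau> \<noteq> 0" using poly_all_0_iff_0 by blast
  then show ?thesis using P Q by auto
qed

section \<open>Leading terms along a curve\<close>

text \<open>Elimination with cross multiplication in place of division, so that the solution stays
  in the domain: the lemma serves both complex coefficients and integral exponent vectors.\<close>

lemma homogeneous_system:
  fixes a :: "'j \<Rightarrow> 'i \<Rightarrow> 'a :: idom"
  assumes "finite J" "finite I" "card J < card I"
  shows "\<exists>x. (\<exists>i\<in>I. x i \<noteq> 0) \<and> (\<forall>j\<in>J. (\<Sum>i\<in>I. a j i * x i) = 0)"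
  using assms
proof (induction J arbitrary: I a rule: finite_induct)
  case empty
  then obtain i where "i \<in> I" by fastforce
  then show ?case by (intro exI[of _ "\<lambda>_. 1"]) auto
next
  case (insert j J)
  show ?case
  proof (cases "\<forall>i\<in>I. a j i = 0")
    case True
    obtain x where "\<exists>i\<in>I. x i \<noteq> 0" "\<forall>j\<in>J. (\<Sum>i\<in>I. a j i * x i) = 0"
      using insert.IH[of I a] insert.prems insert.hyps by auto
    then show ?thesis using True by (intro exI[of _ x]) auto
  next
    case False
    then obtain i0 where i0: "i0 \<in> I" "a j i0 \<noteq> 0" by blast
    define I' where "I' = I - {i0}"
    have I': "finite I'" "i0 \<notin> I'" "I = insert i0 I'" "card J < card I'"
      using insert i0 by (auto simp: I'_def)
    obtain x where x: "\<exists>i\<in>I'. x i \<noteq> 0"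
      "\<forall>j'\<in>J. (\<Sum>i\<in>I'. (a j i0 * a j' i - a j' i0 * a j i) * x i) = 0"
      using insert.IH[of I' "\<lambda>j' i. a j i0 * a j' i - a j' i0 * a j i"] I' by auto
    define x' where "x' i = (if i = i0 then - (\<Sum>i\<in>I'. a j i * x i) else a j i0 * x i)" for i
    have sum_x': "(\<Sum>i\<in>I. a j' i * x' i) = (\<Sum>i\<in>I'. (a j i0 * a j' i - a j' i0 * a j i) * x i)" for j'
    proof -
      have "(\<Sum>i\<in>I'. a j' i * x' i) = (\<Sum>i\<in>I'. a j' i * (a j i0 * x i))"
        using I'(2) by (intro sum.cong) (auto simp: x'_def)
      then show ?thesis using I'
        by (simp add: x'_def left_diff_distrib sum_subtractf sum_distrib_left algebra_simps)
    qed
    have "\<exists>i\<in>I. x' i \<noteq> 0" using x(1) I' i0 by (force simp: x'_def)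
    moreover have "(\<Sum>i\<in>I. a j' i * x' i) = 0" if "j' \<in> insert j J" for j'
      using that x(2) unfolding sum_x' by (cases "j' = j") auto
    ultimately show ?thesis by blast
  qed
qed

text \<open>
  Logarithms of distinct primes are linearly independent over the rationals, so the growth of a monomial
  on the curve with coordinates \<open>exp (weight i * \<zeta>)\<close> determines its exponents.
\<close>

definition weight :: "nat \<Rightarrow> real"
  where "weight i = ln (real (enumerate {p. prime p} i))"

text \<open>Separating positive and negative exponents and exponentiating gives two equal products
  of prime powers; comparing multiplicities gives \<open>nat (e i) = nat (- e i)\<close>.\<close>

lemma weight_independent:
  assumes "(\<Sum>i\<in>I. real_of_int (e i) * weight i) = 0" "finite I" "i \<in> I"
  shows "e i = 0"
proof -
  define pr where "pr i = enumerate {p :: nat. prime p} i" for i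
  have pr: "prime (pr i)" for i
    using enumerate_in_set[OF primes_infinite, of i] by (simp add: pr_def)
  have inj: "inj pr" unfolding pr_def using inj_enumerate[OF primes_infinite] by (simp add: inj_def)
  have pos: "real (pr i) > 0" for i using prime_gt_0_nat[OF pr] by simp
  have w: "weight i = ln (real (pr i))" for i by (simp add: weight_def pr_def)
  have mult: "multiplicity (pr i) (\<Prod>i\<in>I. pr i ^ f i) = f i" for f
  proof -
    have "(\<Prod>i\<in>I. pr i ^ f i) = (\<Prod>p\<in>pr ` I. p ^ f (inv_into UNIV pr p))"
      using inj by (subst prod.reindex) (auto simp: inj_on_def inj_def)
    also have "multiplicity (pr i) \<dots> = f i"
      using assms inj pr by (subst multiplicity_prod_prime_powers) auto
    finally show ?thesis .
  qed
  have ln_prod: "(\<Sum>i\<in>I. real (f i) * weight i) = ln (real (\<Prod>i\<in>I. pr i ^ f i))" for f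
  proof -
    have "ln (\<Prod>i\<in>I. real (pr i) ^ f i) = (\<Sum>i\<in>I. ln (real (pr i) ^ f i))"
      by (rule ln_prod) (use assms pos in auto)
    then show ?thesis using pos by (simp add: w ln_realpow)
  qed
  have nat_parts: "real (nat a) - real (nat (- a)) = real_of_int a" for a
    by (cases "a \<ge> 0") auto
  have "(\<Sum>i\<in>I. real (nat (e i)) * weight i) - (\<Sum>i\<in>I. real (nat (- e i)) * weight i)
      = (\<Sum>i\<in>I. real_of_int (e i) * weight i)"
    unfolding sum_subtractf[symmetric] left_diff_distrib[symmetric] nat_parts by simp
  then have "ln (real (\<Prod>i\<in>I. pr i ^ nat (e i))) = ln (real (\<Prod>i\<in>I. pr i ^ nat (- e i)))"
    using assms(1) by (simp only: ln_prod)
  moreover have "0 < (\<Prod>i\<in>I. pr i ^ f i)" for f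
    using prime_gt_0_nat[OF pr] by (simp add: prod_pos)
  ultimately have "(\<Prod>i\<in>I. pr i ^ nat (e i)) = (\<Prod>i\<in>I. pr i ^ nat (- e i))"
    by (subst (asm) ln_inj_iff) (simp_all del: of_nat_prod)
  then have "nat (e i) = nat (- e i)" using mult[of "\<lambda>i. nat (e i)"] mult[of "\<lambda>i. nat (- e i)"] by simp
  then show ?thesis by linarith
qed

section \<open>Leading terms along the curve and its sign changes\<close>

definition degree_weight :: "nat \<Rightarrow> (nat \<Rightarrow> int) \<Rightarrow> real"
  where "degree_weight k e = (\<Sum>i=1..k. real_of_int (e i) * weight i)"

lemma degree_weight_inj: "degree_weight k e = degree_weight k e' \<Longrightarrow> i \<in> {1..k} \<Longrightarrow> e i = e' i"
  using weight_independent[of "\<lambda>i. e i - e' i" "{1..k}" i]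
  by (simp add: degree_weight_def left_diff_distrib sum_subtractf)

lemma degree_weight_add: "degree_weight k (\<lambda>i. e i + e' i) = degree_weight k e + degree_weight k e'"
  by (simp add: degree_weight_def distrib_right sum.distrib)

lemma degree_weight_minus: "degree_weight k (\<lambda>i. - e i) = - degree_weight k e"
  by (simp add: degree_weight_def sum_negf)

definition signs :: "(nat \<Rightarrow> complex) set"
  where "signs = {\<epsilon>. \<forall>i. \<epsilon> i = 1 \<or> \<epsilon> i = -1}"

definition flip :: "(nat \<Rightarrow> complex) \<Rightarrow> (nat \<Rightarrow> complex) \<Rightarrow> nat \<Rightarrow> complex"
  where "flip \<epsilon> v = (\<lambda>i. \<epsilon> i * v i)"

definition curve :: "real \<Rightarrow> nat \<Rightarrow> complex"
  where "curve \<zeta> i = of_real (exp (weight i * \<zeta>))"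

definition sign_power :: "nat \<Rightarrow> (nat \<Rightarrow> complex) \<Rightarrow> (nat \<Rightarrow> int) \<Rightarrow> complex"
  where "sign_power k \<epsilon> e = (\<Prod>i=1..k. \<epsilon> i powi e i)"

text \<open>\<open>F\<close> behaves like \<open>c\<close> times the monomial with exponent
  \<open>e\<close>, on the curve and on all its flips at once: the factor
  \<open>sign_power k \<epsilon> e\<close> is what the flip does to that monomial. Exponents may be
  negative, as inverses are needed; only the entries in \<open>{1..k}\<close> matter.\<close>

definition leading :: "nat \<Rightarrow> ((nat \<Rightarrow> complex) \<Rightarrow> complex) \<Rightarrow> (nat \<Rightarrow> int) \<Rightarrow> complex \<Rightarrow> bool"
  where "leading k F e c \<longleftrightarrow> c \<noteq> 0 \<and> (\<forall>\<epsilon>\<in>signs.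
    ((\<lambda>\<zeta>. F (flip \<epsilon> (curve \<zeta>)) * of_real (exp (- degree_weight k e * \<zeta>))) \<longlongrightarrow> c * sign_power k \<epsilon> e) at_top)"

lemma one_signs: "(\<lambda>_. 1) \<in> signs" by (simp add: signs_def)

lemma signs_nonzero: "\<epsilon> \<in> signs \<Longrightarrow> \<epsilon> i \<noteq> 0"
proof -
  assume "\<epsilon> \<in> signs"
  then have "\<epsilon> i = 1 \<or> \<epsilon> i = -1" by (simp add: signs_def)
  then show ?thesis by auto
qed

lemma signs_square: "\<epsilon> \<in> signs \<Longrightarrow> \<epsilon> i * \<epsilon> i = 1"
proof -
  assume "\<epsilon> \<in> signs"
  then have "\<epsilon> i = 1 \<or> \<epsilon> i = -1" by (simp add: signs_def)
  then show ?thesis by auto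
qed

lemma flip_one [simp]: "flip (\<lambda>_. 1) v = v" by (simp add: flip_def)

lemma flip_flip: "\<epsilon> \<in> signs \<Longrightarrow> flip \<epsilon> (flip \<epsilon> v) = v"
  by (simp add: flip_def signs_square flip: mult.assoc)

lemma sign_power_one [simp]: "sign_power k (\<lambda>_. 1) e = 1" by (simp add: sign_power_def)

lemma sign_power_nonzero: "\<epsilon> \<in> signs \<Longrightarrow> sign_power k \<epsilon> e \<noteq> 0"
  by (simp add: sign_power_def signs_nonzero)

lemma sign_power_add:
  "\<epsilon> \<in> signs \<Longrightarrow> sign_power k \<epsilon> (\<lambda>i. e i + e' i) = sign_power k \<epsilon> e * sign_power k \<epsilon> e'"
  unfolding sign_power_def prod.distrib[symmetric]
  by (intro prod.cong refl power_int_add) (simp add: signs_nonzero)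

lemma sign_power_minus: "sign_power k \<epsilon> (\<lambda>i. - e i) = inverse (sign_power k \<epsilon> e)"
  by (simp add: sign_power_def power_int_minus prod_inversef[unfolded comp_def])

lemma leading_const: "c \<noteq> 0 \<Longrightarrow> leading k (\<lambda>_. c) (\<lambda>_. 0) c"
  by (simp add: leading_def degree_weight_def sign_power_def)

lemma leading_mult:
  assumes "leading k F e c" "leading k G e' c'"
  shows "leading k (\<lambda>v. F v * G v) (\<lambda>i. e i + e' i) (c * c')"
  unfolding leading_def
proof (intro conjI ballI)
  show "c * c' \<noteq> 0" using assms by (simp add: leading_def)
  fix \<epsilon> assume \<epsilon>: "\<epsilon> \<in> signs"
  have "((\<lambda>\<zeta>. (F (flip \<epsilon> (curve \<zeta>)) * of_real (exp (- degree_weight k e * \<zeta>))) *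
      (G (flip \<epsilon> (curve \<zeta>)) * of_real (exp (- degree_weight k e' * \<zeta>))))
      \<longlongrightarrow> (c * sign_power k \<epsilon> e) * (c' * sign_power k \<epsilon> e')) at_top"
    by (rule tendsto_mult) (use assms \<epsilon> in \<open>simp_all add: leading_def\<close>)
  then show "((\<lambda>\<zeta>. F (flip \<epsilon> (curve \<zeta>)) * G (flip \<epsilon> (curve \<zeta>)) *
      of_real (exp (- degree_weight k (\<lambda>i. e i + e' i) * \<zeta>)))
      \<longlongrightarrow> c * c' * sign_power k \<epsilon> (\<lambda>i. e i + e' i)) at_top"
    unfolding sign_power_add[OF \<epsilon>] degree_weight_add minus_add_distrib distrib_right exp_add of_real_mult
    by (simp add: mult_ac)
qed

lemma leading_inverse:
  assumes "leading k F e c"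
  shows "leading k (\<lambda>v. inverse (F v)) (\<lambda>i. - e i) (inverse c)"
  unfolding leading_def
proof (intro conjI ballI)
  show "inverse c \<noteq> 0" using assms by (simp add: leading_def)
  fix \<epsilon> assume \<epsilon>: "\<epsilon> \<in> signs"
  have "((\<lambda>\<zeta>. inverse (F (flip \<epsilon> (curve \<zeta>)) * of_real (exp (- degree_weight k e * \<zeta>))))
      \<longlongrightarrow> inverse (c * sign_power k \<epsilon> e)) at_top"
    using assms \<epsilon> sign_power_nonzero[OF \<epsilon>] by (intro tendsto_inverse) (auto simp: leading_def)
  then show "((\<lambda>\<zeta>. inverse (F (flip \<epsilon> (curve \<zeta>))) * of_real (exp (- degree_weight k (\<lambda>i. - e i) * \<zeta>)))
      \<longlongrightarrow> inverse c * sign_power k \<epsilon> (\<lambda>i. - e i)) at_top"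
    by (simp add: sign_power_minus degree_weight_minus exp_minus)
qed

lemma leading_power:
  assumes "leading k F e c"
  shows "leading k (\<lambda>v. F v ^ m) (\<lambda>i. int m * e i) (c ^ m)"
proof (induction m)
  case 0
  show ?case using leading_const[of 1 k] by simp
next
  case (Suc m)
  show ?case using leading_mult[OF assms Suc] by (simp add: algebra_simps)
qed

lemma leading_nonzero:
  assumes "leading k F e c" "\<epsilon> \<in> signs"
  shows "\<forall>\<^sub>F \<zeta> in at_top. F (flip \<epsilon> (curve \<zeta>)) \<noteq> 0"
proof -
  have "((\<lambda>\<zeta>. F (flip \<epsilon> (curve \<zeta>)) * of_real (exp (- degree_weight k e * \<zeta>))) \<longlongrightarrow> c * sign_power k \<epsilon> e) at_top"
    and "c * sign_power k \<epsilon> e \<noteq> 0"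
    using assms sign_power_nonzero by (auto simp: leading_def)
  from tendsto_imp_eventually_ne[OF this] show ?thesis by (rule eventually_mono) auto
qed

lemma leading_cong:
  assumes "leading k F e c"
    and "\<And>\<epsilon>. \<epsilon> \<in> signs \<Longrightarrow> \<forall>\<^sub>F \<zeta> in at_top. F (flip \<epsilon> (curve \<zeta>)) = G (flip \<epsilon> (curve \<zeta>))"
  shows "leading k G e c"
  unfolding leading_def
proof (intro conjI ballI)
  show "c \<noteq> 0" using assms by (simp add: leading_def)
  fix \<epsilon> assume \<epsilon>: "\<epsilon> \<in> signs"
  have "((\<lambda>\<zeta>. F (flip \<epsilon> (curve \<zeta>)) * of_real (exp (- degree_weight k e * \<zeta>))) \<longlongrightarrow> c * sign_power k \<epsilon> e) at_top"
    using assms \<epsilon> by (auto simp: leading_def)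
  then show "((\<lambda>\<zeta>. G (flip \<epsilon> (curve \<zeta>)) * of_real (exp (- degree_weight k e * \<zeta>))) \<longlongrightarrow> c * sign_power k \<epsilon> e) at_top"
    by (rule tendsto_cong[THEN iffD1, rotated])
       (use assms(2)[OF \<epsilon>] in \<open>auto elim!: eventually_mono\<close>)
qed

lemma exp_neg_tendsto_0: "a < 0 \<Longrightarrow> ((\<lambda>\<zeta>. complex_of_real (exp (a * \<zeta>))) \<longlongrightarrow> 0) at_top"
proof -
  assume "a < 0"
  then have "filterlim (\<lambda>\<zeta>::real. a * \<zeta>) at_bot at_top"
    by (intro filterlim_tendsto_neg_mult_at_bot[OF tendsto_const]) (auto simp: filterlim_ident)
  then have "((\<lambda>\<zeta>. exp (a * \<zeta>)) \<longlongrightarrow> 0) at_top"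
    by (rule filterlim_compose[OF exp_at_bot])
  then show ?thesis using tendsto_of_real by fastforce
qed

lemma monomial_curve:
  assumes "\<epsilon> \<in> signs"
  shows "monomial {1..k} e (flip \<epsilon> (curve \<zeta>)) =
    sign_power k \<epsilon> (\<lambda>i. int (e i)) * of_real (exp (degree_weight k (\<lambda>i. int (e i)) * \<zeta>))"
proof -
  have "exp (degree_weight k (\<lambda>i. int (e i)) * \<zeta>) = (\<Prod>i=1..k. exp (weight i * \<zeta>) ^ e i)"
    by (simp add: degree_weight_def sum_distrib_right exp_sum mult.assoc exp_of_nat_mult)
  then show ?thesis
    by (simp add: monomial_def flip_def curve_def sign_power_def power_mult_distrib prod.distrib)
qed

text \<open>The growth rates of different monomials differ, so the one of largest rate dominates; a
  flip only changes signs of terms, so the same monomial dominates on every flipped curve.\<close>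

lemma polynomial_function_leading:
  assumes f: "f \<in> polynomial_functions {1..k}" and nz: "f p \<noteq> 0"
  shows "\<exists>e c. leading k f e c"
proof -
  obtain S0 c where S0: "finite S0" "S0 \<subseteq> ({1..k} \<rightarrow>\<^sub>E UNIV)" "f = (\<lambda>v. \<Sum>e\<in>S0. c e * monomial {1..k} e v)"
    using polynomial_function_monomials[OF _ f] by blast
  define S where "S = {e \<in> S0. c e \<noteq> 0}"
  have S: "finite S" "S \<subseteq> ({1..k} \<rightarrow>\<^sub>E UNIV)" using S0 by (auto simp: S_def)
  have fS: "f v = (\<Sum>e\<in>S. c e * monomial {1..k} e v)" for v
    unfolding S0(3) S_def using S0(1) by (intro sum.mono_neutral_right) auto
  have "S \<noteq> {}" using nz fS[of p] by auto
  define d where "d e = degree_weight k (\<lambda>i. int (e i))" for e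
  have d_inj: "e = e'" if "e \<in> S" "e' \<in> S" "d e = d e'" for e e'
  proof (rule PiE_ext[of e "{1..k}" "\<lambda>_. UNIV"])
    show "e \<in> {1..k} \<rightarrow>\<^sub>E UNIV" "e' \<in> {1..k} \<rightarrow>\<^sub>E UNIV" using that S by auto
    show "e i = e' i" if "i \<in> {1..k}" for i
      using degree_weight_inj[OF \<open>d e = d e'\<close>[unfolded d_def] that] by simp
  qed
  have "Max (d ` S) \<in> d ` S" using S(1) \<open>S \<noteq> {}\<close> by (intro Max_in) auto
  then obtain e0 where e0: "e0 \<in> S" "d e0 = Max (d ` S)" by auto
  then have e0_max: "d e \<le> d e0" if "e \<in> S" for e using S(1) that by simp
  have "leading k f (\<lambda>i. int (e0 i)) (c e0)"
    unfolding leading_def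
  proof (intro conjI ballI)
    show "c e0 \<noteq> 0" using e0 by (simp add: S_def)
    fix \<epsilon> assume \<epsilon>: "\<epsilon> \<in> signs"
    have eq: "f (flip \<epsilon> (curve \<zeta>)) * of_real (exp (- d e0 * \<zeta>)) =
      (\<Sum>e\<in>S. c e * sign_power k \<epsilon> (\<lambda>i. int (e i)) * of_real (exp ((d e - d e0) * \<zeta>)))" for \<zeta>
      unfolding fS monomial_curve[OF \<epsilon>] sum_distrib_right
      by (intro sum.cong refl) (simp add: d_def[symmetric] left_diff_distrib exp_diff exp_minus divide_inverse)
    have "((\<lambda>\<zeta>. \<Sum>e\<in>S. c e * sign_power k \<epsilon> (\<lambda>i. int (e i)) * of_real (exp ((d e - d e0) * \<zeta>)))
      \<longlongrightarrow> (\<Sum>e\<in>S. if e = e0 then c e * sign_power k \<epsilon> (\<lambda>i. int (e i)) else 0)) at_top"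
    proof (rule tendsto_sum)
      fix e assume e: "e \<in> S"
      show "((\<lambda>\<zeta>. c e * sign_power k \<epsilon> (\<lambda>i. int (e i)) * of_real (exp ((d e - d e0) * \<zeta>)))
         \<longlongrightarrow> (if e = e0 then c e * sign_power k \<epsilon> (\<lambda>i. int (e i)) else 0)) at_top"
      proof (cases "e = e0")
        case False
        then have "d e - d e0 < 0" using e0_max[OF e] d_inj[OF e e0(1)] by fastforce
        then show ?thesis using False tendsto_mult_right_zero[OF exp_neg_tendsto_0] by auto
      qed auto
    qed
    moreover have "(\<Sum>e\<in>S. if e = e0 then c e * sign_power k \<epsilon> (\<lambda>i. int (e i)) else 0) =
        c e0 * sign_power k \<epsilon> (\<lambda>i. int (e0 i))"
      using S(1) e0(1) by simp
    ultimately show "((\<lambda>\<zeta>. f (flip \<epsilon> (curve \<zeta>)) * of_real (exp (- degree_weight k (\<lambda>i. int (e0 i)) * \<zeta>)))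
      \<longlongrightarrow> c e0 * sign_power k \<epsilon> (\<lambda>i. int (e0 i))) at_top"
      unfolding d_def[of e0, symmetric] eq by simp
  qed
  then show ?thesis by blast
qed

text \<open>Rescaled by the largest growth rate, all summands of smaller growth tend to zero. If no
  two leading exponents coincided, exactly one summand would survive and the sum could not
  vanish.\<close>

lemma leading_sum_zero:
  assumes L: "finite L" and "l0 \<in> L" "leading k (F l0) e0 c0"
    and dich: "\<And>l. l \<in> L \<Longrightarrow> (\<forall>\<^sub>F \<zeta> in at_top. F l (curve \<zeta>) = 0) \<or> (\<exists>e c. leading k (F l) e c)"
    and zero: "\<forall>\<^sub>F \<zeta> in at_top. (\<Sum>l\<in>L. F l (curve \<zeta>)) = 0"
  shows "\<exists>l\<in>L. \<exists>l'\<in>L. \<exists>e c e' c'. l \<noteq> l' \<and> leading k (F l) e c \<and> leading k (F l') e' c' \<and> (\<forall>i\<in>{1..k}. e i = e' i)"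
proof (rule ccontr)
  assume contr: "\<not> ?thesis"
  define L' where "L' = {l \<in> L. \<exists>e c. leading k (F l) e c}"
  have L': "finite L'" "l0 \<in> L'" using assms by (auto simp: L'_def)
  have "\<forall>l\<in>L'. \<exists>e c. leading k (F l) e c" by (auto simp: L'_def)
  then obtain e c where ec: "\<And>l. l \<in> L' \<Longrightarrow> leading k (F l) (e l) (c l)" by metis
  define d where "d l = degree_weight k (e l)" for l
  have d_inj: "l = l'" if "l \<in> L'" "l' \<in> L'" "d l = d l'" for l l'
  proof (rule ccontr)
    assume "l \<noteq> l'"
    moreover have "\<forall>i\<in>{1..k}. e l i = e l' i" using degree_weight_inj that(3) unfolding d_def by blast
    ultimately show False using contr ec that by (auto simp: L'_def) blast
  qed
  have "Max (d ` L') \<in> d ` L'" using L' by (intro Max_in) auto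
  then obtain m where m: "m \<in> L'" "d m = Max (d ` L')" by auto
  then have m_max: "d l \<le> d m" if "l \<in> L'" for l using L' that by simp
  have lim: "((\<lambda>\<zeta>. F l (curve \<zeta>) * of_real (exp (- d m * \<zeta>))) \<longlongrightarrow> (if l = m then c m else 0)) at_top"
    if "l \<in> L" for l
  proof (cases "l \<in> L'")
    case True
    have base: "((\<lambda>\<zeta>. F l (curve \<zeta>) * of_real (exp (- d l * \<zeta>))) \<longlongrightarrow> c l) at_top"
      using ec[OF True] one_signs unfolding leading_def d_def by fastforce
    show ?thesis
    proof (cases "l = m")
      case False
      then have "d l - d m < 0" using m_max[OF True] d_inj[OF True m(1)] by fastforce
      from tendsto_mult[OF base exp_neg_tendsto_0[OF this]]
      have "((\<lambda>\<zeta>. F l (curve \<zeta>) * of_real (exp (- d l * \<zeta>)) * of_real (exp ((d l - d m) * \<zeta>))) \<longlongrightarrow> 0) at_top"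
        by simp
      moreover have "exp (- d l * \<zeta>) * exp ((d l - d m) * \<zeta>) = exp (- d m * \<zeta>)" for \<zeta>
        by (simp add: exp_add[symmetric] algebra_simps)
      ultimately show ?thesis using False by (simp add: mult.assoc flip: of_real_mult)
    qed (use base in simp)
  next
    case False
    then have "\<forall>\<^sub>F \<zeta> in at_top. F l (curve \<zeta>) = 0" using dich[OF that] that by (auto simp: L'_def)
    then have "\<forall>\<^sub>F \<zeta> in at_top. F l (curve \<zeta>) * of_real (exp (- d m * \<zeta>)) = 0"
      by (rule eventually_mono) simp
    then have "((\<lambda>\<zeta>. F l (curve \<zeta>) * of_real (exp (- d m * \<zeta>))) \<longlongrightarrow> 0) at_top"
      by (rule tendsto_eventually)
    moreover have "l \<noteq> m" using False m(1) by blast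
    ultimately show ?thesis by simp
  qed
  have "((\<lambda>\<zeta>. \<Sum>l\<in>L. F l (curve \<zeta>) * of_real (exp (- d m * \<zeta>))) \<longlongrightarrow> (\<Sum>l\<in>L. if l = m then c m else 0)) at_top"
    by (intro tendsto_sum lim)
  moreover have "(\<Sum>l\<in>L. if l = m then c m else 0) = c m" using L m by (auto simp: L'_def)
  ultimately have lim_c: "((\<lambda>\<zeta>. \<Sum>l\<in>L. F l (curve \<zeta>) * of_real (exp (- d m * \<zeta>))) \<longlongrightarrow> c m) at_top"
    by simp
  have "\<forall>\<^sub>F \<zeta> in at_top. (\<Sum>l\<in>L. F l (curve \<zeta>) * of_real (exp (- d m * \<zeta>))) = 0"
    using zero by (rule eventually_mono) (simp add: sum_distrib_right[symmetric])
  then have "((\<lambda>\<zeta>. \<Sum>l\<in>L. F l (curve \<zeta>) * of_real (exp (- d m * \<zeta>))) \<longlongrightarrow> 0) at_top"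
    by (rule tendsto_eventually)
  from tendsto_unique[OF trivial_limit_at_top_linorder lim_c this]
  show False using ec[OF m(1)] by (simp add: leading_def)
qed

section \<open>Greatest common divisors over rings of polynomial functions\<close>

text \<open>\<open>H\<close> is a nonzero element of least degree in the ideal generated by
  \<open>A\<close> and \<open>B\<close>. As the coefficients form a domain only, pseudo-division
  makes \<open>H\<close> divide constant multiples of both, and \<open>d\<close> collects the
  constants. Cancelling \<open>H\<close> in its own representation leaves the Bezout
  identity.\<close>

lemma pseudo_gcd:
  fixes A B :: "'a :: idom poly"
  assumes B: "B \<noteq> 0"
  obtains H A' B' \<alpha> \<beta> d where "d \<noteq> 0" "H \<noteq> 0" "smult d A = H * A'" "smult d B = H * B'"
    "\<alpha> * A' + \<beta> * B' = [:d:]"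
proof -
  define I where "I = {\<alpha> * A + \<beta> * B | \<alpha> \<beta>. True}"
  have BI: "B \<in> I" unfolding I_def by (rule CollectI, rule exI[of _ 0], rule exI[of _ 1]) simp
  have AI: "A \<in> I" unfolding I_def by (rule CollectI, rule exI[of _ 1], rule exI[of _ 0]) simp
  obtain H where H: "H \<in> I" "H \<noteq> 0" "\<And>F. F \<in> I \<Longrightarrow> F \<noteq> 0 \<Longrightarrow> degree H \<le> degree F"
    using ex_has_least_nat[of "\<lambda>F. F \<in> I \<and> F \<noteq> 0" B degree] BI B by auto
  obtain \<alpha> \<beta> where \<alpha>\<beta>: "H = \<alpha> * A + \<beta> * B" using H(1) by (auto simp: I_def)
  have divides: "\<exists>c F'. c \<noteq> 0 \<and> smult c F = H * F'" if F: "F \<in> I" for F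
  proof -
    obtain q r where qr: "pseudo_divmod F H = (q, r)" by fastforce
    define c where "c = coeff H (degree H) ^ (Suc (degree F) - degree H)"
    have eq: "smult c F = H * q + r" and deg: "r = 0 \<or> degree r < degree H"
      using pseudo_divmod[OF H(2) qr] by (auto simp: c_def)
    obtain \<alpha>' \<beta>' where F': "F = \<alpha>' * A + \<beta>' * B" using F by (auto simp: I_def)
    have "r = smult c F - H * q" using eq by simp
    also have "\<dots> = (smult c \<alpha>' - \<alpha> * q) * A + (smult c \<beta>' - \<beta> * q) * B"
      unfolding F' \<alpha>\<beta> by (simp add: algebra_simps smult_add_right)
    finally have "r \<in> I" unfolding I_def by blast
    then have "r = 0" using H(3) deg by fastforce
    moreover have "c \<noteq> 0" using H(2) by (simp add: c_def)
    ultimately show ?thesis using eq by auto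
  qed
  obtain c A1 where A1: "c \<noteq> 0" "smult c A = H * A1" using divides[OF AI] by blast
  obtain e B1 where B1: "e \<noteq> 0" "smult e B = H * B1" using divides[OF BI] by blast
  define d where "d = c * e"
  have eqA: "smult d A = H * smult e A1" 
    using arg_cong[OF A1(2), of "smult e"] by (simp add: d_def mult.commute)
  have eqB: "smult d B = H * smult c B1" using B1(2) by (simp add: d_def flip: smult_smult)
  have "H * [:d:] = smult d H" by simp
  also have "\<dots> = \<alpha> * smult d A + \<beta> * smult d B" unfolding \<alpha>\<beta> by (simp add: smult_add_right)
  also have "\<dots> = H * (\<alpha> * smult e A1 + \<beta> * smult c B1)" unfolding eqA eqB by (simp only: algebra_simps)
  finally have "\<alpha> * smult e A1 + \<beta> * smult c B1 = [:d:]"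
    using mult_left_cancel[OF H(2)] by metis
  then show thesis using that[of d H "smult e A1" "smult c B1"] A1 B1 H(2) eqA eqB by (simp add: d_def)
qed

typedef polyfun = "polynomial_functions (UNIV :: nat set)" morphisms eval_pf Abs_polyfun
  using pf.const by blast

setup_lifting type_definition_polyfun

instantiation polyfun :: idom
begin

lift_definition zero_polyfun :: polyfun is "\<lambda>_. 0" by (rule pf.const)
lift_definition one_polyfun :: polyfun is "\<lambda>_. 1" by (rule pf.const)
lift_definition plus_polyfun :: "polyfun \<Rightarrow> polyfun \<Rightarrow> polyfun" is "\<lambda>f g v. f v + g v"
  by (rule pf.add)
lift_definition times_polyfun :: "polyfun \<Rightarrow> polyfun \<Rightarrow> polyfun" is "\<lambda>f g v. f v * g v"
  by (rule pf.mult)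
lift_definition uminus_polyfun :: "polyfun \<Rightarrow> polyfun" is "\<lambda>f v. - f v"
  by (rule pf.uminus)
lift_definition minus_polyfun :: "polyfun \<Rightarrow> polyfun \<Rightarrow> polyfun" is "\<lambda>f g v. f v - g v"
  by (rule pf.diff)

instance
proof
  fix a b c :: polyfun
  show "a * b * c = a * (b * c)" by transfer (simp add: mult.assoc)
  show "a * b = b * a" by transfer (simp add: mult.commute)
  show "1 * a = a" by transfer simp
  show "a + b + c = a + (b + c)" by transfer (simp add: add.assoc)
  show "a + b = b + a" by transfer (simp add: add.commute)
  show "0 + a = a" by transfer simp
  show "- a + a = 0" by transfer simp
  show "a - b = a + - b" by transfer simp
  show "(a + b) * c = a * c + b * c" by transfer (simp add: distrib_right)
  show "a * (b + c) = a * b + a * c" by transfer (simp add: distrib_left)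
  show "0 * a = 0" "a * 0 = 0" by (transfer, simp)+
  show "(0 :: polyfun) \<noteq> 1" by transfer (simp add: fun_eq_iff)
  show "a * b \<noteq> 0" if "a \<noteq> 0" "b \<noteq> 0"
    using that
  proof (transfer, intro notI)
    fix a b :: "(nat \<Rightarrow> complex) \<Rightarrow> complex"
    assume ab: "a \<in> polynomial_functions UNIV" "b \<in> polynomial_functions UNIV"
      and "a \<noteq> (\<lambda>_. 0)" "b \<noteq> (\<lambda>_. 0)" and 0: "(\<lambda>v. a v * b v) = (\<lambda>_. 0)"
    then obtain p q where "a p \<noteq> 0" "b q \<noteq> 0" by fastforce
    then show False using polynomial_functions_no_zero_divisors[OF ab] 0 by (metis mult_eq_0_iff)
  qed
qed

end

definition eval_poly_pf :: "polyfun poly \<Rightarrow> (nat \<Rightarrow> complex) \<Rightarrow> complex poly"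
  where "eval_poly_pf F v = map_poly (\<lambda>c. eval_pf c v) F"

lemma eval_pf_zero [simp]: "eval_pf 0 v = 0" by transfer simp
lemma eval_pf_plus [simp]: "eval_pf (f + g) v = eval_pf f v + eval_pf g v" by transfer simp
lemma eval_pf_times [simp]: "eval_pf (f * g) v = eval_pf f v * eval_pf g v" by transfer simp

lemma eval_pf_sum: "eval_pf (\<Sum>i\<in>I. f i) v = (\<Sum>i\<in>I. eval_pf (f i) v)"
  by (induction I rule: infinite_finite_induct) auto

lemma coeff_eval_poly_pf: "coeff (eval_poly_pf F v) l = eval_pf (coeff F l) v"
  by (simp add: eval_poly_pf_def coeff_map_poly)

lemma eval_poly_pf_plus: "eval_poly_pf (F + G) v = eval_poly_pf F v + eval_poly_pf G v"
  by (simp add: poly_eq_iff coeff_eval_poly_pf)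

lemma eval_poly_pf_times: "eval_poly_pf (F * G) v = eval_poly_pf F v * eval_poly_pf G v"
  by (simp add: poly_eq_iff coeff_eval_poly_pf coeff_mult eval_pf_sum)

lemma eval_poly_pf_smult: "eval_poly_pf (smult c F) v = smult (eval_pf c v) (eval_poly_pf F v)"
  by (simp add: poly_eq_iff coeff_eval_poly_pf)

lemma eval_poly_pf_const: "eval_poly_pf [:c:] v = [:eval_pf c v:]"
  by (auto simp: poly_eq_iff coeff_eval_poly_pf coeff_pCons split: nat.splits)

lemma eval_pf_in: "eval_pf f \<in> polynomial_functions UNIV"
  using eval_pf by simp

definition polynomial_family :: "nat set \<Rightarrow> ((nat \<Rightarrow> complex) \<Rightarrow> complex poly) \<Rightarrow> bool"
  where "polynomial_family I F \<longleftrightarrow>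
    pf.poly_family I F \<and> (\<exists>N. \<forall>v. degree (F v) \<le> N)"

text \<open>The degree bound is what allows a single polynomial over the ring to represent the whole
  family.\<close>

lemma polynomial_family_eval:
  assumes "polynomial_family I F"
  obtains p where "\<And>v. eval_poly_pf p v = F v"
proof -
  obtain N where N: "\<And>v. degree (F v) \<le> N" using assms by (auto simp: polynomial_family_def)
  define c where "c l = Abs_polyfun (\<lambda>v. coeff (F v) l)" for l
  have c: "eval_pf (c l) v = coeff (F v) l" for l v
    unfolding c_def using assms polynomial_functions_mono[of _ I UNIV]
    by (subst Abs_polyfun_inverse) (auto simp: polynomial_family_def pf.poly_family_def)
  have "eval_poly_pf (\<Sum>l\<le>N. monom (c l) l) v = F v" for v
  proof (rule poly_eqI)
    fix l
    show "coeff (eval_poly_pf (\<Sum>l\<le>N. monom (c l) l) v) l = coeff (F v) l"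
    proof (cases "l \<le> N")
      case True
      then show ?thesis by (simp add: coeff_eval_poly_pf coeff_sum c)
    next
      case False
      then have "coeff (F v) l = 0" using N[of v] by (intro coeff_eq_0) simp
      then show ?thesis using False by (simp add: coeff_eval_poly_pf coeff_sum)
    qed
  qed
  then show thesis by (rule that)
qed

text \<open>
  The variables outside \<open>I\<close> of the Bezout data over the ring of all polynomial functions
  are frozen to the coordinates of a point where the denominator does not vanish.
\<close>

lemma pseudo_gcd_family:
  assumes A: "polynomial_family I A" and B: "polynomial_family I B" and nz: "B p \<noteq> 0"
  obtains d H A' B' \<alpha> \<beta> N v0 where "d \<in> polynomial_functions I"
    "polynomial_family I H" "polynomial_family I A'" "polynomial_family I B'"
    "\<And>v. smult (d v) (A v) = H v * A' v" "\<And>v. smult (d v) (B v) = H v * B' v"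
    "\<And>v. \<alpha> v * A' v + \<beta> v * B' v = [:d v:]"
    "\<And>v. degree (H v) \<le> N" "d v0 * coeff (H v0) N \<noteq> 0"
proof -
  obtain a where a: "\<And>v. eval_poly_pf a v = A v" using polynomial_family_eval[OF A] by blast
  obtain b where b: "\<And>v. eval_poly_pf b v = B v" using polynomial_family_eval[OF B] by blast
  have "b \<noteq> 0"
  proof
    assume "b = 0"
    then have "B p = 0" using b[of p] by (simp add: eval_poly_pf_def)
    then show False using nz by simp
  qed
  then obtain H A' B' \<alpha> \<beta> d where g: "d \<noteq> 0" "H \<noteq> 0" "smult d a = H * A'" "smult d b = H * B'"
    "\<alpha> * A' + \<beta> * B' = [:d:]"
    by (rule pseudo_gcd)
  \<comment> \<open>At a point where this product does not vanish \<open>H\<close> keeps its degree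
    and the Bezout identity has a nonzero right side.\<close>
  have "d * lead_coeff H \<noteq> 0" using g by simp
  then obtain v0 where v0: "eval_pf (d * lead_coeff H) v0 \<noteq> 0"
    using eval_pf_inject[of "d * lead_coeff H" 0] by (auto simp: fun_eq_iff)
  define J where "J v = (\<lambda>i. if i \<in> I then v i else v0 i)" for v
  have Jin: "(\<lambda>v. f (J v)) \<in> polynomial_functions I" if "f \<in> polynomial_functions UNIV" for f
    using that
  proof (rule pf.polynomial_functions_compose)
    show "(\<lambda>v. J v i) \<in> polynomial_functions I" for i
      by (cases "i \<in> I") (simp_all add: J_def pf.const polynomial_functions.coord)
  qed
  have restrict: "F (J v) = F v" if "polynomial_family I F" for F v
  proof (rule poly_eqI)
    fix l
    have "(\<lambda>v. coeff (F v) l) \<in> polynomial_functions I"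
      using that by (simp add: polynomial_family_def pf.poly_family_def)
    then show "coeff (F (J v)) l = coeff (F v) l"
      by (rule polynomial_functions_restrict) (simp add: J_def)
  qed
  show thesis
  proof
    show "(\<lambda>v. eval_pf d (J v)) \<in> polynomial_functions I" by (rule Jin[OF eval_pf_in])
    have family: "polynomial_family I (\<lambda>v. eval_poly_pf F (J v))" for F
      unfolding polynomial_family_def
    proof
      show "pf.poly_family I (\<lambda>v. eval_poly_pf F (J v))"
        unfolding pf.poly_family_def coeff_eval_poly_pf by (intro allI Jin[OF eval_pf_in])
      show "\<exists>N. \<forall>v. degree (eval_poly_pf F (J v)) \<le> N"
        unfolding eval_poly_pf_def by (intro exI[of _ "degree F"] allI degree_map_poly_le)
    qed
    show "polynomial_family I (\<lambda>v. eval_poly_pf H (J v))" "polynomial_family I (\<lambda>v. eval_poly_pf A' (J v))"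
      "polynomial_family I (\<lambda>v. eval_poly_pf B' (J v))" by (rule family)+
    fix v
    show "smult (eval_pf d (J v)) (A v) = eval_poly_pf H (J v) * eval_poly_pf A' (J v)"
      using arg_cong[OF g(3), of "\<lambda>F. eval_poly_pf F (J v)"]
      by (simp add: eval_poly_pf_smult eval_poly_pf_times a restrict[OF A])
    show "smult (eval_pf d (J v)) (B v) = eval_poly_pf H (J v) * eval_poly_pf B' (J v)"
      using arg_cong[OF g(4), of "\<lambda>F. eval_poly_pf F (J v)"]
      by (simp add: eval_poly_pf_smult eval_poly_pf_times b restrict[OF B])
    show "eval_poly_pf \<alpha> (J v) * eval_poly_pf A' (J v) + eval_poly_pf \<beta> (J v) * eval_poly_pf B' (J v)
        = [:eval_pf d (J v):]"
      using arg_cong[OF g(5), of "\<lambda>F. eval_poly_pf F (J v)"]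
      by (simp add: eval_poly_pf_plus eval_poly_pf_times eval_poly_pf_const)
    show "degree (eval_poly_pf H (J v)) \<le> degree H"
      unfolding eval_poly_pf_def by (rule degree_map_poly_le)
  next
    have "J v0 = v0" by (simp add: J_def fun_eq_iff)
    then show "eval_pf d (J v0) * coeff (eval_poly_pf H (J v0)) (degree H) \<noteq> 0"
      using v0 by (simp add: coeff_eval_poly_pf)
  qed
qed

section \<open>Prime ideals of polynomial functions\<close>

context function_algebra
begin

definition ideal :: "('x \<Rightarrow> complex) set \<Rightarrow> bool"
  where "ideal J \<longleftrightarrow> J \<subseteq> A \<and> (\<lambda>_. 0) \<in> J \<and> (\<forall>f\<in>J. \<forall>g\<in>J. (\<lambda>x. f x + g x) \<in> J) \<and>
    (\<forall>f\<in>A. \<forall>g\<in>J. (\<lambda>x. f x * g x) \<in> J)"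

definition prime_ideal :: "('x \<Rightarrow> complex) set \<Rightarrow> bool"
  where "prime_ideal J \<longleftrightarrow> ideal J \<and> (\<lambda>_. 1) \<notin> J \<and>
    (\<forall>f\<in>A. \<forall>g\<in>A. (\<lambda>x. f x * g x) \<in> J \<longrightarrow> f \<in> J \<or> g \<in> J)"

lemma idealD:
  assumes "ideal J"
  shows "J \<subseteq> A" "(\<lambda>_. 0) \<in> J" "f \<in> J \<Longrightarrow> g \<in> J \<Longrightarrow> (\<lambda>x. f x + g x) \<in> J"
    "f \<in> A \<Longrightarrow> g \<in> J \<Longrightarrow> (\<lambda>x. f x * g x) \<in> J"
  using assms by (auto simp: ideal_def)

lemma ideal_uminus: "ideal J \<Longrightarrow> f \<in> J \<Longrightarrow> (\<lambda>x. - f x) \<in> J"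
  using idealD(4)[of J "\<lambda>_. - 1" f] const by simp

lemma ideal_diff: "ideal J \<Longrightarrow> f \<in> J \<Longrightarrow> g \<in> J \<Longrightarrow> (\<lambda>x. f x - g x) \<in> J"
  using idealD(3)[of J f "\<lambda>x. - g x"] ideal_uminus by simp

lemma ideal_sum: "ideal J \<Longrightarrow> (\<And>i. i \<in> K \<Longrightarrow> f i \<in> J) \<Longrightarrow> (\<lambda>x. \<Sum>i\<in>K. f i x) \<in> J"
  by (induction K rule: infinite_finite_induct) (auto intro: idealD)

lemma prime_idealD:
  assumes "prime_ideal J"
  shows "ideal J" "(\<lambda>_. 1) \<notin> J"
    "f \<in> A \<Longrightarrow> g \<in> A \<Longrightarrow> (\<lambda>x. f x * g x) \<in> J \<Longrightarrow> f \<in> J \<or> g \<in> J"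
  using assms by (auto simp: prime_ideal_def)

lemma prime_ideal_const: "prime_ideal J \<Longrightarrow> (\<lambda>_. c) \<in> J \<Longrightarrow> c = 0"
proof (rule ccontr)
  assume J: "prime_ideal J" "(\<lambda>_. c) \<in> J" and "c \<noteq> 0"
  have "(\<lambda>x. inverse c * c) \<in> J" by (rule idealD(4)[OF prime_idealD(1)[OF J(1)] const J(2)])
  then show False using \<open>c \<noteq> 0\<close> prime_idealD(2)[OF J(1)] by simp
qed

lemma prime_ideal_scale: "prime_ideal J \<Longrightarrow> c \<noteq> 0 \<Longrightarrow> (\<lambda>x. c * f x) \<in> J \<Longrightarrow> f \<in> J"
  using idealD(4)[OF prime_idealD(1), of J "\<lambda>_. inverse c" "\<lambda>x. c * f x"] const
  by (simp add: mult.assoc[symmetric])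

lemma ideal_adjoin:
  assumes J: "ideal J" and f: "f \<in> A"
  defines "K \<equiv> {\<lambda>x. j x + a x * f x | j a. j \<in> J \<and> a \<in> A}"
  shows "ideal K" "J \<subseteq> K" "f \<in> K"
proof -
  show "J \<subseteq> K"
  proof
    fix j assume "j \<in> J"
    then show "j \<in> K" unfolding K_def using const[of 0]
      by (intro CollectI exI[of _ j] exI[of _ "\<lambda>_. 0"]) auto
  qed
  show "f \<in> K" unfolding K_def using const[of 1] idealD(2)[OF J]
    by (intro CollectI exI[of _ "\<lambda>_. 0"] exI[of _ "\<lambda>_. 1"]) auto
  show "ideal K" unfolding ideal_def
  proof (intro conjI ballI)
    show "K \<subseteq> A" unfolding K_def using idealD(1)[OF J] f by (auto intro!: add mult)
    show "(\<lambda>_. 0) \<in> K" using idealD(2)[OF J] \<open>J \<subseteq> K\<close> by blast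
    fix g h assume h: "h \<in> K"
    then obtain j a where ja: "j \<in> J" "a \<in> A" "h = (\<lambda>x. j x + a x * f x)" unfolding K_def by blast
    { assume "g \<in> K"
      then obtain j' a' where ja': "j' \<in> J" "a' \<in> A" "g = (\<lambda>x. j' x + a' x * f x)" unfolding K_def by blast
      show "(\<lambda>x. g x + h x) \<in> K" unfolding K_def
        by (rule CollectI, rule exI[of _ "\<lambda>x. j' x + j x"], rule exI[of _ "\<lambda>x. a' x + a x"])
           (use ja ja' J in \<open>auto simp: algebra_simps intro: idealD add\<close>) }
    { assume "g \<in> A"
      then show "(\<lambda>x. g x * h x) \<in> K" unfolding K_def
        by (intro CollectI, intro exI[of _ "\<lambda>x. g x * j x"] exI[of _ "\<lambda>x. g x * a x"])
           (use ja J in \<open>auto simp: algebra_simps intro: idealD mult\<close>) }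
  qed
qed

text \<open>An ideal maximal among those containing \<open>J\<close> and avoiding \<open>S\<close>
  is prime. The last conclusion records the maximality: an element outside \<open>q\<close> has a
  multiple congruent to a member of \<open>S\<close>.\<close>

lemma prime_ideal_avoiding:
  assumes J: "ideal J" and S: "S \<subseteq> A" "(\<lambda>_. 1) \<in> S" "\<And>s t. s \<in> S \<Longrightarrow> t \<in> S \<Longrightarrow> (\<lambda>x. s x * t x) \<in> S"
    and disj: "J \<inter> S = {}"
  obtains q where "prime_ideal q" "J \<subseteq> q" "q \<inter> S = {}"
    "\<And>f. f \<in> A \<Longrightarrow> f \<notin> q \<Longrightarrow> \<exists>a\<in>A. \<exists>s\<in>S. (\<lambda>x. a x * f x - s x) \<in> q"
proof -
  define \<F> where "\<F> = {K. ideal K \<and> J \<subseteq> K \<and> K \<inter> S = {}}"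
  have "\<exists>q\<in>\<F>. \<forall>K\<in>\<F>. q \<subseteq> K \<longrightarrow> K = q"
  proof (rule subset_Zorn_nonempty)
    show "\<F> \<noteq> {}" using J disj by (auto simp: \<F>_def)
    fix \<C> assume ne: "\<C> \<noteq> {}" and ch: "subset.chain \<F> \<C>"
    have in_F: "K \<in> \<C> \<Longrightarrow> ideal K \<and> J \<subseteq> K \<and> K \<inter> S = {}" for K
      using ch by (auto simp: subset.chain_def \<F>_def)
    have tot: "K \<in> \<C> \<Longrightarrow> L \<in> \<C> \<Longrightarrow> K \<subseteq> L \<or> L \<subseteq> K" for K L
      using ch by (auto simp: subset_chain_def)
    have "ideal (\<Union>\<C>)" unfolding ideal_def
    proof (intro conjI ballI)
      show "\<Union>\<C> \<subseteq> A" using in_F idealD(1) by blast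
      show "(\<lambda>_. 0) \<in> \<Union>\<C>" using ne in_F idealD(2) by blast
      fix f g
      { assume "f \<in> \<Union>\<C>" "g \<in> \<Union>\<C>"
        then obtain K where "K \<in> \<C>" "f \<in> K" "g \<in> K" using tot by blast
        then show "(\<lambda>x. f x + g x) \<in> \<Union>\<C>" using in_F idealD(3) by blast }
      { assume "f \<in> A" "g \<in> \<Union>\<C>"
        then show "(\<lambda>x. f x * g x) \<in> \<Union>\<C>" using in_F idealD(4) by blast }
    qed
    then show "\<Union>\<C> \<in> \<F>" using in_F ne by (auto simp: \<F>_def)
  qed
  then obtain q where q: "ideal q" "J \<subseteq> q" "q \<inter> S = {}" and max: "\<And>K. K \<in> \<F> \<Longrightarrow> q \<subseteq> K \<Longrightarrow> K = q"
    by (auto simp: \<F>_def)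
  have outside: "\<exists>a\<in>A. \<exists>s\<in>S. (\<lambda>x. a x * f x - s x) \<in> q" if f: "f \<in> A" "f \<notin> q" for f
  proof -
    define K where "K = {\<lambda>x. j x + a x * f x | j a. j \<in> q \<and> a \<in> A}"
    have K: "ideal K" "q \<subseteq> K" "f \<in> K" using ideal_adjoin[OF q(1) f(1)] by (simp_all add: K_def)
    then have "K \<notin> \<F>" using max f(2) by blast
    then obtain s where "s \<in> K" "s \<in> S" using K q(2) by (auto simp: \<F>_def)
    then obtain j a where ja: "j \<in> q" "a \<in> A" "s = (\<lambda>x. j x + a x * f x)" unfolding K_def by blast
    have "(\<lambda>x. a x * f x - s x) = (\<lambda>x. - j x)" by (simp add: ja(3))
    then have "(\<lambda>x. a x * f x - s x) \<in> q" using ideal_uminus[OF q(1) ja(1)] by simp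
    then show ?thesis using ja(2) \<open>s \<in> S\<close> by (intro bexI[of _ a] bexI[of _ s])
  qed
  have "prime_ideal q" unfolding prime_ideal_def
  proof (intro conjI ballI impI)
    show "ideal q" by fact
    show "(\<lambda>_. 1) \<notin> q" using q(3) S(2) by blast
    fix f g assume f: "f \<in> A" and g: "g \<in> A" and fg: "(\<lambda>x. f x * g x) \<in> q"
    show "f \<in> q \<or> g \<in> q"
    proof (rule ccontr)
      assume "\<not> ?thesis"
      then obtain a s b t where a: "a \<in> A" "s \<in> S" "(\<lambda>x. a x * f x - s x) \<in> q"
        and b: "b \<in> A" "t \<in> S" "(\<lambda>x. b x * g x - t x) \<in> q"
        using outside f g by blast
      \<comment> \<open>Modulo \<open>q\<close> the product of \<open>s\<close> and \<open>t\<close>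
        equals that of \<open>a\<close>, \<open>b\<close>, \<open>f\<close> and \<open>g\<close>,
        which lies in \<open>q\<close>; but it is also a member of \<open>S\<close>.\<close>
      have 1: "(\<lambda>x. (b x * g x) * (a x * f x - s x)) \<in> q"
        by (rule idealD(4)[OF q(1) mult[OF b(1) g] a(3)])
      have 2: "(\<lambda>x. s x * (b x * g x - t x)) \<in> q"
        by (rule idealD(4)[OF q(1) _ b(3)]) (use a(2) S(1) in auto)
      have 3: "(\<lambda>x. (a x * b x) * (f x * g x)) \<in> q"
        by (rule idealD(4)[OF q(1) mult[OF a(1) b(1)] fg])
      note ideal_diff[OF q(1) 3 idealD(3)[OF q(1) 1 2]]
      also have "(\<lambda>x. (a x * b x) * (f x * g x) - ((b x * g x) * (a x * f x - s x) + s x * (b x * g x - t x)))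
          = (\<lambda>x. s x * t x)" by (simp add: algebra_simps)
      finally show False using S(3)[OF a(2) b(2)] q(3) by blast
    qed
  qed
  then show thesis using that q outside by blast
qed

end

text \<open>
  Amitsur's trick: the polynomial functions form a vector space of countable dimension,
  so no uncountable family is linearly independent.
\<close>

lemma uncountable_family_dependent:
  assumes I: "finite I" and C: "uncountable C" and a: "\<And>c. c \<in> C \<Longrightarrow> a c \<in> polynomial_functions I"
  obtains C0 \<gamma> c0 where "finite C0" "C0 \<subseteq> C" "c0 \<in> C0" "\<gamma> c0 \<noteq> 0" "\<And>v. (\<Sum>c\<in>C0. \<gamma> c * a c v) = 0"
proof -
  define W where "W d = (I \<rightarrow>\<^sub>E {..d :: nat})" for d
  have W: "finite (W d)" for d unfolding W_def using I by (intro finite_PiE) auto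
  have ex: "\<exists>d \<kappa>. \<forall>v. a c v = (\<Sum>e\<in>W d. \<kappa> e * monomial I e v)" if c: "c \<in> C" for c
  proof -
    obtain S \<kappa> where S: "finite S" "S \<subseteq> (I \<rightarrow>\<^sub>E UNIV)" "a c = (\<lambda>v. \<Sum>e\<in>S. \<kappa> e * monomial I e v)"
      using polynomial_function_monomials[OF I a[OF c]] by blast
    define d where "d = Max (insert 0 ((\<lambda>(e, i). e i) ` (S \<times> I)))"
    have "S \<subseteq> W d"
    proof
      fix e assume e: "e \<in> S"
      have "e i \<le> d" if "i \<in> I" for i
        unfolding d_def using S(1) I e that by (intro Max_ge) (auto intro!: finite_imageI)
      then show "e \<in> W d" using e S(2) by (force simp: W_def PiE_iff)
    qed
    then have "a c v = (\<Sum>e\<in>W d. (if e \<in> S then \<kappa> e else 0) * monomial I e v)" for v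
      unfolding S(3) using W by (intro sum.mono_neutral_cong_left) auto
    then show ?thesis by (intro exI[of _ d] exI[of _ "\<lambda>e. if e \<in> S then \<kappa> e else 0"] allI)
  qed
  then obtain d \<kappa> where d\<kappa>: "\<And>c v. c \<in> C \<Longrightarrow> a c v = (\<Sum>e\<in>W (d c). \<kappa> c e * monomial I e v)"
    by metis
  \<comment> \<open>Infinitely many members share one bound \<open>m\<close> on their exponents, so
    more of them can be taken than there are monomials in \<open>W m\<close>, and a linear relation
    exists.\<close>
  have "\<exists>m. infinite {c \<in> C. d c = m}"
  proof (rule ccontr)
    assume "\<not> ?thesis"
    then have "countable (\<Union>m. {c \<in> C. d c = m})" by (intro countable_UN) (auto intro: countable_finite)
    moreover have "(\<Union>m. {c \<in> C. d c = m}) = C" by auto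
    ultimately show False using C by simp
  qed
  then obtain m where "infinite {c \<in> C. d c = m}" by blast
  then obtain C0 where C0: "C0 \<subseteq> {c \<in> C. d c = m}" "finite C0" "card C0 = Suc (card (W m))"
    using infinite_arbitrarily_large by blast
  obtain \<gamma> where \<gamma>: "\<exists>c\<in>C0. \<gamma> c \<noteq> 0" "\<forall>e\<in>W m. (\<Sum>c\<in>C0. \<kappa> c e * \<gamma> c) = 0"
    using homogeneous_system[OF W[of m] C0(2), of "\<lambda>e c. \<kappa> c e"] C0(3) by auto
  have "(\<Sum>c\<in>C0. \<gamma> c * a c v) = 0" for v
  proof -
    have "(\<Sum>c\<in>C0. \<gamma> c * a c v) = (\<Sum>c\<in>C0. \<Sum>e\<in>W m. \<kappa> c e * \<gamma> c * monomial I e v)"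
    proof (rule sum.cong)
      fix c assume "c \<in> C0"
      then have "c \<in> C" "d c = m" using C0 by auto
      then show "\<gamma> c * a c v = (\<Sum>e\<in>W m. \<kappa> c e * \<gamma> c * monomial I e v)"
        using d\<kappa>[of c v] by (simp add: sum_distrib_left mult_ac)
    qed simp
    also have "\<dots> = (\<Sum>e\<in>W m. (\<Sum>c\<in>C0. \<kappa> c e * \<gamma> c) * monomial I e v)"
      by (subst sum.swap) (simp add: sum_distrib_right)
    finally show ?thesis using \<gamma>(2) by simp
  qed
  then show thesis using that C0 \<gamma> by blast
qed

section \<open>Amitsur relations, growing primes and the Nullstellensatz\<close>

lemma uncountable_complex: "uncountable (UNIV :: complex set)"
proof
  assume "countable (UNIV :: complex set)"
  then have "countable (range complex_of_real)" by (rule countable_subset[rotated]) simp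
  then show False using uncountable_UNIV_real countable_image_inj_on inj_of_real by blast
qed

text \<open>Up to normalisation the Lagrange polynomial of \<open>c\<close> for the nodes
  \<open>C\<close>; also the numerator of \<open>1 / (t - c)\<close> over the common denominator of
  all these fractions.\<close>

definition skip_poly :: "complex set \<Rightarrow> complex \<Rightarrow> complex poly"
  where "skip_poly C c = (\<Prod>c'\<in>C - {c}. [:- c', 1:])"

lemma poly_skip_self: "finite C \<Longrightarrow> poly (skip_poly C c) c \<noteq> 0"
  by (auto simp: skip_poly_def poly_prod)

lemma poly_skip_other: "finite C \<Longrightarrow> c0 \<in> C \<Longrightarrow> c0 \<noteq> c \<Longrightarrow> poly (skip_poly C c) c0 = 0"
  by (auto simp: skip_poly_def poly_prod)

lemma poly_skip_mult: "finite C \<Longrightarrow> c \<in> C \<Longrightarrow> (t - c) * poly (skip_poly C c) t = (\<Prod>c\<in>C. t - c)"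
  by (simp add: skip_poly_def poly_prod prod.remove)

lemma sum_skip_self:
  assumes "finite C" "c0 \<in> C"
  shows "(\<Sum>c\<in>C. g c * poly (skip_poly C c) c0) = g c0 * poly (skip_poly C c0) c0"
proof -
  have "(\<Sum>c\<in>C. g c * poly (skip_poly C c) c0) = (\<Sum>c\<in>C. if c = c0 then g c * poly (skip_poly C c) c0 else 0)"
    using assms poly_skip_other by (intro sum.cong) auto
  then show ?thesis using assms by simp
qed

text \<open>Modulo \<open>q\<close>, \<open>a c\<close> plays the part of the fraction of
  \<open>s c\<close> by \<open>f - c\<close>. A linear relation among the \<open>a c\<close>,
  multiplied by the product of the \<open>f - c\<close>, becomes a polynomial relation for
  \<open>f\<close> with coefficients built from the \<open>s c\<close>.\<close>

lemma amitsur_relation: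
  assumes I: "finite I" and C: "uncountable C" and q: "pf.ideal I q"
    and f: "f \<in> polynomial_functions I"
    and a: "\<And>c. c \<in> C \<Longrightarrow> a c \<in> polynomial_functions I"
    and s: "\<And>c. c \<in> C \<Longrightarrow> (\<lambda>v. a c v * (f v - c) - s c v) \<in> q"
  obtains C0 \<gamma> c0 where "finite C0" "C0 \<subseteq> C" "c0 \<in> C0" "\<gamma> c0 \<noteq> 0"
    "(\<lambda>v. \<Sum>c\<in>C0. \<gamma> c * s c v * poly (skip_poly C0 c) (f v)) \<in> q"
proof -
  obtain C0 \<gamma> c0 where C0: "finite C0" "C0 \<subseteq> C" "c0 \<in> C0" "\<gamma> c0 \<noteq> 0"
    and rel: "\<And>v. (\<Sum>c\<in>C0. \<gamma> c * a c v) = 0"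
    by (rule uncountable_family_dependent[of I C a]) (rule I, rule C, rule a, assumption, rule that)
  have skip_in: "(\<lambda>v. poly (skip_poly C0 c) (f v)) \<in> polynomial_functions I" for c
    unfolding skip_poly_def poly_prod
    by (intro pf.prod) (auto intro: pf.diff pf.const f)
  have "(\<lambda>v. \<Sum>c\<in>C0. (\<gamma> c * poly (skip_poly C0 c) (f v)) * - (a c v * (f v - c) - s c v)) \<in> q"
    using C0(2) by (intro pf.ideal_sum[OF q] pf.idealD(4)[OF q]
        pf.ideal_uminus[OF q] s pf.mult pf.const skip_in) auto
  also have "(\<lambda>v. \<Sum>c\<in>C0. (\<gamma> c * poly (skip_poly C0 c) (f v)) * - (a c v * (f v - c) - s c v))
      = (\<lambda>v. \<Sum>c\<in>C0. \<gamma> c * s c v * poly (skip_poly C0 c) (f v))"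
  proof
    fix v
    have "(\<Sum>c\<in>C0. (\<gamma> c * poly (skip_poly C0 c) (f v)) * - (a c v * (f v - c) - s c v))
      = (\<Sum>c\<in>C0. \<gamma> c * s c v * poly (skip_poly C0 c) (f v) - \<gamma> c * a c v * ((f v - c) * poly (skip_poly C0 c) (f v)))"
      by (intro sum.cong) (auto simp: algebra_simps)
    also have "\<dots> = (\<Sum>c\<in>C0. \<gamma> c * s c v * poly (skip_poly C0 c) (f v) - \<gamma> c * a c v * (\<Prod>c\<in>C0. f v - c))"
      using poly_skip_mult[OF C0(1)] by (intro sum.cong) auto
    also have "\<dots> = (\<Sum>c\<in>C0. \<gamma> c * s c v * poly (skip_poly C0 c) (f v))"
      using rel[of v] by (simp add: sum_subtractf sum_distrib_right[symmetric])
    finally show "(\<Sum>c\<in>C0. (\<gamma> c * poly (skip_poly C0 c) (f v)) * - (a c v * (f v - c) - s c v))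
      = (\<Sum>c\<in>C0. \<gamma> c * s c v * poly (skip_poly C0 c) (f v))" .
  qed
  finally show thesis using that C0 by blast
qed

text \<open>Transcendence of the class of \<open>f\<close> over the image of \<open>B\<close> in the
  quotient by \<open>p\<close>, phrased without the quotient: a relation has all its coefficients in
  \<open>p\<close>.\<close>

definition transcendental_mod ::
    "(('x \<Rightarrow> complex) set) \<Rightarrow> ('x \<Rightarrow> complex) set \<Rightarrow> ('x \<Rightarrow> complex) \<Rightarrow> bool"
  where "transcendental_mod p B f \<longleftrightarrow> (\<forall>b m. (\<forall>j\<le>m. b j \<in> B) \<and>
    (\<lambda>x. \<Sum>j\<le>(m::nat). b j x * f x ^ j) \<in> p \<longrightarrow> (\<forall>j\<le>m. b j \<in> p))"

lemma transcendental_modD: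
  assumes "transcendental_mod p B f" "\<And>j. j \<le> m \<Longrightarrow> b j \<in> B"
    "(\<lambda>x. \<Sum>j\<le>(m::nat). b j x * f x ^ j) \<in> p" "j \<le> m"
  shows "b j \<in> p"
  using assms unfolding transcendental_mod_def by blast

text \<open>For a suitable constant \<open>c\<close>, adjoining \<open>f - c\<close> to
  \<open>p\<close> creates no new element of \<open>B\<close>. If every constant failed, each would
  have some \<open>s c\<close> in \<open>B\<close> outside \<open>p\<close> that is a multiple of
  \<open>f - c\<close> modulo \<open>p\<close>, and the Amitsur relation would be an equation for
  \<open>f\<close> over \<open>B\<close> that transcendence forbids.\<close>

lemma larger_prime:
  fixes I :: "'i set"
  assumes I: "finite I" and p: "pf.prime_ideal I p"
    and B: "function_algebra B" "B \<subseteq> polynomial_functions I"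
    and f: "f \<in> polynomial_functions I" and tr: "transcendental_mod p B f"
  obtains q where "pf.prime_ideal I q" "p \<subset> q" "q \<inter> B = p \<inter> B"
proof -
  interpret B: function_algebra B by fact
  note ip = pf.prime_idealD(1)[OF p]
  define S where "S = B - p"
  define K where "K c = {\<lambda>x. j x + a x * (f x - c) | j a. j \<in> p \<and> a \<in> polynomial_functions I}" for c
  have fc: "(\<lambda>v. f v - c) \<in> polynomial_functions I" for c
    by (intro pf.diff f pf.const)
  have K: "pf.ideal I (K c)" "p \<subseteq> K c" "(\<lambda>v. f v - c) \<in> K c" for c
    using pf.ideal_adjoin[OF ip fc] by (simp_all add: K_def)
  have "\<exists>c. K c \<inter> S = {}"
  proof (rule ccontr)
    assume "\<not> ?thesis"
    have "\<exists>s a. s \<in> S \<and> a \<in> polynomial_functions I \<and> (\<lambda>v. s v - a v * (f v - c)) \<in> p" for c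
    proof -
      obtain s where "s \<in> K c" "s \<in> S" using \<open>\<nexists>c. K c \<inter> S = {}\<close> by blast
      then obtain j a where ja: "j \<in> p" "a \<in> polynomial_functions I" "s = (\<lambda>x. j x + a x * (f x - c))"
        unfolding K_def by blast
      have "(\<lambda>v. s v - a v * (f v - c)) = j" by (simp add: ja(3))
      then show ?thesis using ja \<open>s \<in> S\<close> by (intro exI[of _ s] exI[of _ a]) simp
    qed
    then obtain s a where sa: "\<And>c. s c \<in> S" "\<And>c. a c \<in> polynomial_functions I"
      "\<And>c. (\<lambda>v. s c v - a c v * (f v - c)) \<in> p" by metis
    have sa': "(\<lambda>v. a c v * (f v - c) - s c v) \<in> p" for c
      using pf.ideal_uminus[OF ip sa(3)[of c]] by simp
    obtain C0 \<gamma> c0 where C0: "finite C0" "c0 \<in> C0" "\<gamma> c0 \<noteq> 0"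
      and rel: "(\<lambda>v. \<Sum>c\<in>C0. \<gamma> c * s c v * poly (skip_poly C0 c) (f v)) \<in> p"
      by (rule amitsur_relation[of I UNIV p f a s])
        (rule I, rule uncountable_complex, rule ip, rule f, rule sa(2), rule sa', rule that)
    \<comment> \<open>The relation as a polynomial in \<open>f\<close> with coefficients in
      \<open>B\<close>.\<close>
    define G where "G v = (\<Sum>c\<in>C0. [:\<gamma> c * s c v:] * skip_poly C0 c)" for v
    have sB: "s c \<in> B" for c using sa(1) by (auto simp: S_def)
    have G: "B.poly_family G" unfolding G_def
      by (intro B.poly_family_sum B.poly_family_mult B.poly_family_const B.poly_family_const_coeff B.mult B.const sB)
    define m where "m = Max ((\<lambda>c. degree (skip_poly C0 c)) ` C0)"
    have deg: "degree (G v) \<le> m" for v unfolding G_def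
    proof (rule degree_sum_le[OF C0(1)])
      fix c assume "c \<in> C0"
      then have "degree (skip_poly C0 c) \<le> m" unfolding m_def using C0(1) by simp
      then show "degree ([:\<gamma> c * s c v:] * skip_poly C0 c) \<le> m"
        using degree_mult_le[of "[:\<gamma> c * s c v:]" "skip_poly C0 c"] by simp
    qed
    have poly_G: "poly (G v) t = (\<Sum>j\<le>m. coeff (G v) j * t ^ j)" for v t
    proof -
      have "poly (G v) t = (\<Sum>j\<le>degree (G v). coeff (G v) j * t ^ j)" by (rule poly_altdef)
      also have "\<dots> = (\<Sum>j\<le>m. coeff (G v) j * t ^ j)"
        using deg[of v] by (intro sum.mono_neutral_left) (auto simp: coeff_eq_0)
      finally show ?thesis .
    qed
    have poly_G': "poly (G v) t = (\<Sum>c\<in>C0. \<gamma> c * s c v * poly (skip_poly C0 c) t)" for v t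
      by (simp add: G_def poly_sum)
    have "(\<lambda>v. \<Sum>j\<le>m. coeff (G v) j * f v ^ j) \<in> p"
      using rel by (simp add: poly_G[symmetric] poly_G')
    then have coeff_p: "(\<lambda>v. coeff (G v) j) \<in> p" if "j \<le> m" for j
      using transcendental_modD[OF tr, of m "\<lambda>j v. coeff (G v) j" j] that B.poly_family_coeff[OF G] by simp
    \<comment> \<open>Transcendence puts all coefficients of \<open>G\<close> into \<open>p\<close>;
      evaluating at \<open>c0\<close> instead of \<open>f\<close> isolates the term of
      \<open>c0\<close>.\<close>
    have "(\<lambda>v. \<Sum>j\<le>m. c0 ^ j * coeff (G v) j) \<in> p"
      using coeff_p by (intro pf.ideal_sum[OF ip] pf.idealD(4)[OF ip]
        pf.const) auto
    also have "(\<lambda>v. \<Sum>j\<le>m. c0 ^ j * coeff (G v) j) = (\<lambda>v. (\<gamma> c0 * poly (skip_poly C0 c0) c0) * s c0 v)"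
    proof
      fix v
      have "(\<Sum>j\<le>m. c0 ^ j * coeff (G v) j) = poly (G v) c0" by (simp add: poly_G mult.commute)
      then show "(\<Sum>j\<le>m. c0 ^ j * coeff (G v) j) = (\<gamma> c0 * poly (skip_poly C0 c0) c0) * s c0 v"
        using sum_skip_self[OF C0(1,2), of "\<lambda>c. \<gamma> c * s c v"] by (simp add: poly_G')
    qed
    finally have "s c0 \<in> p"
      using pf.prime_ideal_scale[OF p] C0 poly_skip_self by (metis mult_eq_0_iff)
    then show False using sa(1) by (auto simp: S_def)
  qed
  then obtain c where c: "K c \<inter> S = {}" by blast
  have S1: "S \<subseteq> polynomial_functions I" using B(2) by (auto simp: S_def)
  have S3: "f' \<in> S \<Longrightarrow> g \<in> S \<Longrightarrow> (\<lambda>x. f' x * g x) \<in> S" for f' g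
    using pf.prime_idealD(3)[OF p, of f' g] B(2) B.mult by (auto simp: S_def)
  have S2: "(\<lambda>_. 1) \<in> S" using pf.prime_idealD(2)[OF p] B.const by (simp add: S_def)
  obtain q where q: "pf.prime_ideal I q" "K c \<subseteq> q" "q \<inter> S = {}"
    by (rule pf.prime_ideal_avoiding[of I "K c" S])
      (rule K(1), rule S1, rule S2, rule S3, assumption, assumption, rule c, rule that)
  have "(\<lambda>v. f v - c) \<notin> p"
  proof
    assume *: "(\<lambda>v. f v - c) \<in> p"
    define b where "b j = (\<lambda>_ :: 'i \<Rightarrow> complex. if j = 0 then - c else 1)" for j :: nat
    have "(\<lambda>v. \<Sum>j\<le>1. b j v * f v ^ j) \<in> p" using * by (simp add: b_def)
    moreover have "\<forall>j\<le>1. b j \<in> B" by (auto simp: b_def B.const)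
    ultimately have "b 1 \<in> p" using transcendental_modD[OF tr, of 1 b 1] by simp
    then show False using pf.prime_idealD(2)[OF p] by (simp add: b_def)
  qed
  then have "p \<subset> q" using K(2,3)[of c] q(2) by blast
  moreover have "q \<inter> B = p \<inter> B" using \<open>p \<subset> q\<close> q(3) by (auto simp: S_def)
  ultimately show thesis using that q(1) by blast
qed

text \<open>The primes are found from the highest index downwards: enlarging a prime over the last
  algebra below \<open>f\<close> leaves its trace on that algebra unchanged, and relations for the
  earlier \<open>f i\<close> lie in this trace, so these elements stay transcendental. Thus
  \<open>P k\<close> is the given prime and \<open>P 0\<close> the largest one.\<close>

lemma prime_chain:
  assumes I: "finite I" and "pf.prime_ideal I p"
    and B: "\<And>i. i \<le> k \<Longrightarrow> function_algebra (B i)" "\<And>i. i \<le> k \<Longrightarrow> B i \<subseteq> polynomial_functions I"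
      "\<And>i. i < k \<Longrightarrow> B i \<subseteq> B (Suc i)"
    and f: "\<And>i. i < k \<Longrightarrow> f i \<in> B (Suc i)"
    and "\<And>i. i < k \<Longrightarrow> transcendental_mod p (B i) (f i)"
  shows "\<exists>P. P k = p \<and> (\<forall>i\<le>k. pf.prime_ideal I (P i)) \<and> (\<forall>i<k. P (Suc i) \<subset> P i)"
  using assms(2-)
proof (induction k arbitrary: p)
  case 0
  then show ?case by (intro exI[of _ "\<lambda>_. p"]) auto
next
  case (Suc k)
  have "f k \<in> polynomial_functions I" using Suc.prems(3)[of "Suc k"] Suc.prems(5)[of k] by auto
  then obtain q where q: "pf.prime_ideal I q" "p \<subset> q" "q \<inter> B k = p \<inter> B k"
    using larger_prime[OF I Suc.prems(1), of "B k" "f k"] Suc.prems by (metis le_SucI lessI order_refl)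
  have mono: "B i \<subseteq> B k" if "i \<le> k" for i
    using that
  proof (induction rule: dec_induct)
    case (step n)
    then show ?case using Suc.prems(4)[of n] by auto
  qed simp
  have "transcendental_mod q (B i) (f i)" if i: "i < k" for i
    unfolding transcendental_mod_def
  proof (intro allI impI, elim conjE)
    fix b m j assume b: "\<forall>j\<le>m. b j \<in> B i" and sum: "(\<lambda>x. \<Sum>j\<le>m. b j x * f i x ^ j) \<in> q" and j: "j \<le> m"
    interpret Bi: function_algebra "B (Suc i)" using Suc.prems(2) i by simp
    have "(\<lambda>x. \<Sum>j\<le>m. b j x * f i x ^ j) \<in> B (Suc i)"
      using b Suc.prems(4)[of i] Suc.prems(5)[of i] i by (intro Bi.sum Bi.mult Bi.power) auto
    then have "(\<lambda>x. \<Sum>j\<le>m. b j x * f i x ^ j) \<in> p" using sum q(3) mono[of "Suc i"] i by auto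
    then have "b j \<in> p" using transcendental_modD[OF Suc.prems(6)[of i], of m b j] i b j by simp
    then show "b j \<in> q" using q(2) by blast
  qed
  then obtain P where P: "P k = q" "\<forall>i\<le>k. pf.prime_ideal I (P i)" "\<forall>i<k. P (Suc i) \<subset> P i"
    using Suc.IH[OF q(1)] Suc.prems by auto
  show ?case
    by (rule exI[of _ "P(Suc k := p)"]) (use P q Suc.prems(1) in \<open>auto simp: less_Suc_eq le_Suc_eq\<close>)
qed

text \<open>Over the complex numbers \<open>G\<close> splits, and a prime ideal containing a product
  of factors \<open>f - r\<close> contains one of them.\<close>

lemma (in function_algebra) prime_contains_factor:
  assumes q: "prime_ideal q" and f: "f \<in> A" and "G \<noteq> 0" "(\<lambda>v. poly G (f v)) \<in> q"
  shows "\<exists>r. (\<lambda>v. f v - r) \<in> q"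
  using assms(3,4)
proof (induction "degree G" arbitrary: G)
  case 0
  then obtain c where "G = [:c:]" "c \<noteq> 0" by (metis degree_eq_zeroE pCons_0_0)
  then show ?case using prime_ideal_const[OF q, of c] 0 by simp
next
  case (Suc d)
  then have "\<not> constant (poly G)" by (simp add: constant_degree)
  then obtain r where "poly G r = 0" using fundamental_theorem_of_algebra by blast
  then obtain G' where G: "G = [:- r, 1:] * G'" by (auto simp: poly_eq_0_iff_dvd)
  then have "G' \<noteq> 0" using Suc.prems by auto
  then have "degree G' = d" using Suc.hyps(2) G by (simp add: degree_mult_eq del: mult_pCons_left)
  have "(\<lambda>v. (f v - r) * poly G' (f v)) \<in> q" using Suc.prems(2) by (simp add: G algebra_simps)
  moreover have "(\<lambda>v. poly G' (f v)) \<in> A" unfolding poly_altdef by (intro sum mult power f const)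
  ultimately have "(\<lambda>v. f v - r) \<in> q \<or> (\<lambda>v. poly G' (f v)) \<in> q"
    using prime_idealD(3)[OF q diff[OF f const]] by blast
  then show ?case using Suc.hyps(1)[of G'] \<open>degree G' = d\<close> \<open>G' \<noteq> 0\<close> by blast
qed

text \<open>A prime ideal maximal among those that contain \<open>p\<close> and avoid the powers of
  \<open>g\<close> is the ideal of a point: by Amitsur's relation each coordinate is congruent to a
  constant. The members of \<open>S\<close> are powers of \<open>g\<close>, which can be cancelled
  modulo \<open>q\<close>.\<close>

lemma nullstellensatz_prime:
  assumes I: "finite I" and p: "pf.prime_ideal I p"
    and g: "g \<in> polynomial_functions I" "g \<notin> p"
  obtains x where "x \<in> I \<rightarrow>\<^sub>E UNIV" "\<And>f. f \<in> p \<Longrightarrow> f x = 0" "g x \<noteq> 0"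
proof -
  define S where "S = range (\<lambda>m v. g v ^ m)"
  have S1: "S \<subseteq> polynomial_functions I" unfolding S_def using pf.power[OF g(1)] by auto
  have S2: "(\<lambda>_. 1) \<in> S" unfolding S_def by (rule range_eqI[of _ _ 0]) simp
  have S3: "(\<lambda>x. s x * t x) \<in> S" if "s \<in> S" "t \<in> S" for s t
    using that unfolding S_def by (auto simp flip: power_add)
  have "(\<lambda>v. g v ^ m) \<notin> p" for m
  proof (induction m)
    case 0
    then show ?case using pf.prime_idealD(2)[OF p] by simp
  next
    case (Suc m)
    then show ?case
      using pf.prime_idealD(3)[OF p g(1) pf.power[OF g(1)]] g(2) by auto
  qed
  then have "p \<inter> S = {}" by (auto simp: S_def)
  obtain q where q: "pf.prime_ideal I q" "p \<subseteq> q" "q \<inter> S = {}"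
    and outside: "\<And>f. f \<in> polynomial_functions I \<Longrightarrow> f \<notin> q \<Longrightarrow>
      \<exists>a\<in>polynomial_functions I. \<exists>s\<in>S. (\<lambda>x. a x * f x - s x) \<in> q"
    by (rule pf.prime_ideal_avoiding[of I p S])
      (rule pf.prime_idealD(1)[OF p], rule S1, rule S2, rule S3, assumption, assumption, rule \<open>p \<inter> S = {}\<close>, rule that)
  note iq = pf.prime_idealD(1)[OF q(1)]
  have "\<exists>c. (\<lambda>v. v i - c) \<in> q" if i: "i \<in> I" for i
  proof (rule ccontr)
    assume contr: "\<not> ?thesis"
    note vi = polynomial_functions.coord[OF i]
    have "\<exists>a s. a \<in> polynomial_functions I \<and> s \<in> S \<and> (\<lambda>v. a v * (v i - c) - s v) \<in> q" for c
    proof -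
      have "(\<lambda>v. v i - c) \<notin> q" using contr by simp
      from outside[OF pf.diff[OF vi pf.const] this]
      show ?thesis by (simp add: Bex_def)
    qed
    then have "\<forall>c. \<exists>a s. a \<in> polynomial_functions I \<and> s \<in> S \<and> (\<lambda>v. a v * (v i - c) - s v) \<in> q"
      by (rule allI)
    from choice[OF this] obtain a where
      "\<forall>c. \<exists>s. a c \<in> polynomial_functions I \<and> s \<in> S \<and> (\<lambda>v. a c v * (v i - c) - s v) \<in> q" ..
    from choice[OF this] obtain s where
      "\<forall>c. a c \<in> polynomial_functions I \<and> s c \<in> S \<and> (\<lambda>v. a c v * (v i - c) - s c v) \<in> q" ..
    then have as: "\<And>c. a c \<in> polynomial_functions I" "\<And>c. s c \<in> S"
      "\<And>c. (\<lambda>v. a c v * (v i - c) - s c v) \<in> q" by simp_all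
    have "\<forall>c. \<exists>m. s c = (\<lambda>v. g v ^ m)" using as(2) by (auto simp: S_def)
    then obtain e where e: "\<And>c. s c = (\<lambda>v. g v ^ e c)" by metis
    \<comment> \<open>One exponent \<open>m\<close> serves uncountably many constants, so that
      \<open>g ^ m\<close> is a common factor of the relation.\<close>
    have "\<exists>m. uncountable {c. e c = m}"
    proof (rule ccontr)
      assume "\<not> ?thesis"
      then have "countable (\<Union>m. {c. e c = m})" by (intro countable_UN) auto
      moreover have "(\<Union>m. {c. e c = m}) = UNIV" by auto
      ultimately show False using uncountable_complex by simp
    qed
    then obtain m where m: "uncountable {c. e c = m}" by blast
    have "(\<lambda>v. a c v * (v i - c) - g v ^ m) \<in> q" if "c \<in> {c. e c = m}" for c
      using as(3)[of c] e[of c] that by simp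
    note rel_q = this
    obtain C0 \<gamma> c0 where C0: "finite C0" "c0 \<in> C0" "\<gamma> c0 \<noteq> 0"
      and rel: "(\<lambda>v. \<Sum>c\<in>C0. \<gamma> c * g v ^ m * poly (skip_poly C0 c) (v i)) \<in> q"
      by (rule amitsur_relation[of I "{c. e c = m}" q "\<lambda>v. v i" a "\<lambda>_ v. g v ^ m"])
        (rule I, rule m, rule iq, rule vi, rule as(1), rule rel_q, assumption, rule that)
    define G where "G = (\<Sum>c\<in>C0. [:\<gamma> c:] * skip_poly C0 c)"
    have poly_G: "poly G t = (\<Sum>c\<in>C0. \<gamma> c * poly (skip_poly C0 c) t)" for t
      by (simp add: G_def poly_sum)
    have "poly G c0 \<noteq> 0" unfolding poly_G sum_skip_self[OF C0(1,2)] using C0 poly_skip_self by simp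
    then have "G \<noteq> 0" by auto
    have "(\<lambda>v. g v ^ m * poly G (v i)) \<in> q" using rel by (simp add: poly_G sum_distrib_left mult_ac)
    moreover have "(\<lambda>v. g v ^ m) \<notin> q" using q(3) by (auto simp: S_def)
    moreover have "(\<lambda>v. poly G (v i)) \<in> polynomial_functions I" unfolding poly_altdef
      by (intro pf.sum pf.mult pf.power vi pf.const)
    ultimately have "(\<lambda>v. poly G (v i)) \<in> q"
      using pf.prime_idealD(3)[OF q(1) pf.power[OF g(1)]] by blast
    then show False using pf.prime_contains_factor[OF q(1) vi \<open>G \<noteq> 0\<close>] contr by blast
  qed
  then obtain y where y: "\<And>i. i \<in> I \<Longrightarrow> (\<lambda>v. v i - y i) \<in> q" by metis
  define x where "x = restrict y I"
  have sub: "(\<lambda>v. f v - f x) \<in> q" if "f \<in> polynomial_functions I" for f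
    using that
  proof (induction rule: polynomial_functions.induct)
    case (const c)
    show ?case using pf.idealD(2)[OF iq] by simp
  next
    case (coord i)
    then show ?case using y by (simp add: x_def)
  next
    case (add f g)
    from pf.idealD(3)[OF iq add.IH] show ?case by (simp add: algebra_simps)
  next
    case (mult f g)
    have "(\<lambda>v. g v * (f v - f x) + f x * (g v - g x)) \<in> q"
      by (intro pf.idealD(3)[OF iq] pf.idealD(4)[OF iq]
          mult pf.const)
    then show ?case by (simp add: algebra_simps)
  qed
  show thesis
  proof
    show "x \<in> I \<rightarrow>\<^sub>E UNIV" by (simp add: x_def)
    show "f x = 0" if f: "f \<in> p" for f
    proof -
      have "f \<in> polynomial_functions I" using pf.idealD(1)[OF iq] q(2) f by blast
      from pf.ideal_diff[OF iq _ sub[OF this]] f q(2)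
      have "(\<lambda>v. f v - (f v - f x)) \<in> q" by blast
      then show ?thesis using pf.prime_ideal_const[OF q(1)] by simp
    qed
    show "g x \<noteq> 0"
    proof
      assume "g x = 0"
      then have "g \<in> q" using sub[OF g(1)] by simp
      moreover have "g \<in> S" unfolding S_def by (rule range_eqI[of _ _ 1]) simp
      ultimately show False using q(3) by blast
    qed
  qed
qed

section \<open>Families invariant under sign changes\<close>

text \<open>Fractions of polynomial functions without pole on the nonvanishing locus of a fixed
  \<open>G\<close>; elsewhere \<open>F\<close> is arbitrary. The pulled back coordinates of a
  rational map are of this kind.\<close>

definition rational_on :: "nat \<Rightarrow> ((nat \<Rightarrow> complex) \<Rightarrow> complex) \<Rightarrow> ((nat \<Rightarrow> complex) \<Rightarrow> complex) \<Rightarrow> bool"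
  where "rational_on k G F \<longleftrightarrow> (\<exists>n\<in>polynomial_functions {1..k}. \<exists>d\<in>polynomial_functions {1..k}.
    \<forall>v. G v \<noteq> 0 \<longrightarrow> d v \<noteq> 0 \<and> F v = n v / d v)"

lemma rational_on_algebra: "function_algebra {F. rational_on k G F}"
proof
  fix c show "(\<lambda>_. c) \<in> {F. rational_on k G F}"
    unfolding rational_on_def
    by (intro CollectI bexI[of _ "\<lambda>_. c"] bexI[of _ "\<lambda>_. 1"]) (auto intro: pf.const)
next
  fix F F' assume "F \<in> {F. rational_on k G F}" "F' \<in> {F. rational_on k G F}"
  then obtain n d n' d' where nd: "n \<in> polynomial_functions {1..k}" "d \<in> polynomial_functions {1..k}"
      "\<And>v. G v \<noteq> 0 \<Longrightarrow> d v \<noteq> 0 \<and> F v = n v / d v"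
    and nd': "n' \<in> polynomial_functions {1..k}" "d' \<in> polynomial_functions {1..k}"
      "\<And>v. G v \<noteq> 0 \<Longrightarrow> d' v \<noteq> 0 \<and> F' v = n' v / d' v"
    unfolding rational_on_def by blast
  note intros = pf.add pf.mult nd(1,2) nd'(1,2)
  show "(\<lambda>v. F v + F' v) \<in> {F. rational_on k G F}"
    unfolding rational_on_def
    by (intro CollectI bexI[of _ "\<lambda>v. n v * d' v + n' v * d v"] bexI[of _ "\<lambda>v. d v * d' v"] intros)
       (use nd(3) nd'(3) in \<open>auto simp: add_frac_eq\<close>)
  show "(\<lambda>v. F v * F' v) \<in> {F. rational_on k G F}"
    unfolding rational_on_def
    by (intro CollectI bexI[of _ "\<lambda>v. n v * n' v"] bexI[of _ "\<lambda>v. d v * d' v"] intros)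
       (use nd(3) nd'(3) in auto)
qed

lemma eventually_curve_nonzero:
  assumes "f \<in> polynomial_functions {1..k}" "f p \<noteq> 0" "\<epsilon> \<in> signs"
  shows "\<forall>\<^sub>F \<zeta> in at_top. f (flip \<epsilon> (curve \<zeta>)) \<noteq> 0"
  using polynomial_function_leading[OF assms(1,2)] leading_nonzero assms(3) by blast

lemma rational_on_leading:
  assumes G: "G \<in> polynomial_functions {1..k}" and F: "rational_on k G F"
  shows "(\<forall>v. G v \<noteq> 0 \<longrightarrow> F v = 0) \<or> (\<exists>e c. leading k F e c)"
proof (rule disjCI)
  assume "\<not> (\<exists>e c. leading k F e c)"
  show "\<forall>v. G v \<noteq> 0 \<longrightarrow> F v = 0"
  proof (rule ccontr)
    assume "\<not> ?thesis"
    then obtain v where v: "G v \<noteq> 0" "F v \<noteq> 0" by blast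
    obtain n d where nd: "n \<in> polynomial_functions {1..k}" "d \<in> polynomial_functions {1..k}"
      "\<And>v. G v \<noteq> 0 \<Longrightarrow> d v \<noteq> 0 \<and> F v = n v / d v"
      using F unfolding rational_on_def by blast
    obtain e c where e: "leading k n e c"
      using polynomial_function_leading[OF nd(1), of v] nd(3) v by auto
    obtain e' c' where e': "leading k d e' c'"
      using polynomial_function_leading[OF nd(2), of v] nd(3) v by auto
    have "leading k F (\<lambda>i. e i + - e' i) (c * inverse c')"
    proof (rule leading_cong[OF leading_mult[OF e leading_inverse[OF e']]])
      fix \<epsilon> assume "\<epsilon> \<in> signs"
      from eventually_curve_nonzero[OF G v(1) this]
      show "\<forall>\<^sub>F \<zeta> in at_top. n (flip \<epsilon> (curve \<zeta>)) * inverse (d (flip \<epsilon> (curve \<zeta>))) = F (flip \<epsilon> (curve \<zeta>))"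
        by (rule eventually_mono) (use nd(3) in \<open>auto simp: divide_inverse\<close>)
    qed
    then show False using \<open>\<not> (\<exists>e c. leading k F e c)\<close> by blast
  qed
qed

lemma leading_unique:
  assumes "leading k F e c" "leading k F e' c'" "i \<in> {1..k}"
  shows "e i = e' i"
proof -
  have le: "degree_weight k e' \<le> degree_weight k e" if "leading k F e c" "leading k F e' c'" for e c e' c'
  proof (rule ccontr)
    assume "\<not> ?thesis"
    then have neg: "degree_weight k e - degree_weight k e' < 0" by simp
    have 1: "((\<lambda>\<zeta>. F (curve \<zeta>) * of_real (exp (- degree_weight k e * \<zeta>))) \<longlongrightarrow> c) at_top"
      using that(1) one_signs unfolding leading_def by fastforce
    have 2: "((\<lambda>\<zeta>. F (curve \<zeta>) * of_real (exp (- degree_weight k e' * \<zeta>))) \<longlongrightarrow> c') at_top"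
      using that(2) one_signs unfolding leading_def by fastforce
    have "exp (- degree_weight k e * \<zeta>) * exp ((degree_weight k e - degree_weight k e') * \<zeta>)
        = exp (- degree_weight k e' * \<zeta>)" for \<zeta>
      by (simp add: exp_add[symmetric] algebra_simps)
    with tendsto_mult[OF 1 exp_neg_tendsto_0[OF neg]]
    have "((\<lambda>\<zeta>. F (curve \<zeta>) * of_real (exp (- degree_weight k e' * \<zeta>))) \<longlongrightarrow> 0) at_top"
      by (simp add: mult.assoc flip: of_real_mult)
    from tendsto_unique[OF trivial_limit_at_top_linorder 2 this] show False
      using that(2) by (simp add: leading_def)
  qed
  have "degree_weight k e = degree_weight k e'" using le assms by (meson order_antisym)
  then show ?thesis using degree_weight_inj assms(3) by blast
qed

text \<open>The limits along the curve and along its flip are compared. This reads off the parity of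
  an exponent from invariance or anti-invariance of the function.\<close>

lemma leading_flip:
  assumes F: "leading k F e c" and \<epsilon>: "\<epsilon> \<in> signs" and eq: "\<And>v. F (flip \<epsilon> v) = \<kappa> * F v"
  shows "sign_power k \<epsilon> e = \<kappa>"
proof -
  have 1: "((\<lambda>\<zeta>. F (curve \<zeta>) * of_real (exp (- degree_weight k e * \<zeta>))) \<longlongrightarrow> c) at_top"
    using F one_signs unfolding leading_def by fastforce
  have "((\<lambda>\<zeta>. F (flip \<epsilon> (curve \<zeta>)) * of_real (exp (- degree_weight k e * \<zeta>))) \<longlongrightarrow> c * sign_power k \<epsilon> e) at_top"
    using F \<epsilon> unfolding leading_def by blast
  then have "((\<lambda>\<zeta>. \<kappa> * F (curve \<zeta>) * of_real (exp (- degree_weight k e * \<zeta>))) \<longlongrightarrow> c * sign_power k \<epsilon> e) at_top"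
    by (simp only: eq)
  moreover have "((\<lambda>\<zeta>. \<kappa> * F (curve \<zeta>) * of_real (exp (- degree_weight k e * \<zeta>))) \<longlongrightarrow> \<kappa> * c) at_top"
    using tendsto_mult[OF tendsto_const[of \<kappa>] 1] by (simp add: mult.assoc)
  ultimately have "c * sign_power k \<epsilon> e = \<kappa> * c"
    using tendsto_unique[OF trivial_limit_at_top_linorder] by blast
  then show ?thesis using F by (simp add: leading_def mult.commute)
qed

section \<open>Orthogonal integer vectors, parity, and functions pulled back to an even
  family\<close>

definition pairing :: "nat \<Rightarrow> (nat \<Rightarrow> int) \<Rightarrow> (nat \<Rightarrow> int) \<Rightarrow> int"
  where "pairing k l e = (\<Sum>i=1..k. l i * e i)"

lemma pairing_add: "pairing k l (\<lambda>i. e i + e' i) = pairing k l e + pairing k l e'"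
  by (simp add: pairing_def distrib_left sum.distrib)

lemma pairing_minus: "pairing k l (\<lambda>i. - e i) = - pairing k l e"
  by (simp add: pairing_def sum_negf)

lemma pairing_scale: "pairing k l (\<lambda>i. n * e i) = n * pairing k l e"
  by (simp add: pairing_def sum_distrib_left mult_ac)

lemma pairing_cong: "(\<And>i. i \<in> {1..k} \<Longrightarrow> e i = e' i) \<Longrightarrow> pairing k l e = pairing k l e'"
  by (simp add: pairing_def)

lemma leading_pairing_unique:
  "leading k F e c \<Longrightarrow> leading k F e' c' \<Longrightarrow> pairing k l e = pairing k l e'"
  by (rule pairing_cong) (rule leading_unique)

text \<open>A nonzero orthogonal vector with least sum of absolute values works: if all its entries
  were even, half of it would still be orthogonal and smaller.\<close>

lemma odd_orthogonal:
  assumes "\<exists>i\<in>{1..k}. l i \<noteq> 0" "\<And>e. e \<in> E \<Longrightarrow> pairing k l e = 0"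
  obtains l' i where "i \<in> {1..k}" "odd (l' i)" "\<And>e. e \<in> E \<Longrightarrow> pairing k l' e = 0"
proof -
  define good where "good l \<longleftrightarrow> (\<exists>i\<in>{1..k}. l i \<noteq> 0) \<and> (\<forall>e\<in>E. pairing k l e = 0)" for l
  define size where "size l = (\<Sum>i=1..k. nat \<bar>l i\<bar>)" for l :: "nat \<Rightarrow> int"
  obtain l' where l': "good l'" "\<And>l''. good l'' \<Longrightarrow> size l' \<le> size l''"
    using ex_has_least_nat[of good l size] assms by (auto simp: good_def)
  have "\<exists>i\<in>{1..k}. odd (l' i)"
  proof (rule ccontr)
    assume "\<not> ?thesis"
    then have even: "l' i = 2 * (l' i div 2)" if "i \<in> {1..k}" for i using that by simp
    define h where "h i = l' i div 2" for i
    have "pairing k l' e = 2 * pairing k h e" for e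
      unfolding pairing_def sum_distrib_left using even by (intro sum.cong) (auto simp: h_def)
    then have "good h" using l'(1) even unfolding good_def h_def by (metis mult_eq_0_iff mult_zero_right zero_neq_numeral)
    have "nat \<bar>l' i\<bar> = 2 * nat \<bar>h i\<bar>" if "i \<in> {1..k}" for i
      using even[OF that] unfolding h_def by linarith
    then have "size l' = (\<Sum>i=1..k. 2 * nat \<bar>h i\<bar>)"
      unfolding size_def by (intro sum.cong) auto
    then have "size l' = 2 * size h" by (simp add: size_def sum_distrib_left)
    moreover obtain i where i: "i \<in> {1..k}" "h i \<noteq> 0" using \<open>good h\<close> by (auto simp: good_def)
    have "nat \<bar>h i\<bar> \<le> size h" unfolding size_def by (rule member_le_sum) (use i in auto)
    ultimately show False using l'(2)[OF \<open>good h\<close>] i(2) by linarith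
  qed
  then show thesis using that l'(1) by (auto simp: good_def)
qed

text \<open>The sign vector \<open>(-1) ^ l\<close>, chosen so that the monomial with exponent
  \<open>e\<close> is multiplied by \<open>-1\<close> exactly when the pairing of \<open>l\<close>
  and \<open>e\<close> is odd.\<close>

definition parity_sign :: "(nat \<Rightarrow> int) \<Rightarrow> nat \<Rightarrow> complex"
  where "parity_sign l i = (if even (l i) then 1 else - 1)"

lemma parity_sign_in: "parity_sign l \<in> signs"
  by (auto simp: signs_def parity_sign_def)

lemma sign_power_parity: "sign_power k (parity_sign l) e = (if even (pairing k l e) then 1 else - 1)"
proof -
  have "parity_sign l i powi e i = (if even (l i * e i) then 1 else - 1)" for i
    by (auto simp: parity_sign_def power_int_minus_left_even power_int_minus_left_odd)
  moreover have "(\<Prod>i\<in>I. if even (f i) then 1 else - 1 :: complex) = (if even (\<Sum>i\<in>I. f i) then 1 else - 1)"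
    if "finite I" for I and f :: "nat \<Rightarrow> int"
    using that by (induction I rule: finite_induct) auto
  ultimately show ?thesis by (simp add: sign_power_def pairing_def del: even_mult_iff)
qed

text \<open>The data left once everything is pulled back to the parameters \<open>v\<close>. The
  \<open>y v\<close> are coordinates of the point of \<open>Y\<close> in an affine chart inside
  \<open>N\<close>-space; the \<open>r l\<close> are the coefficients of a monic equation for the
  values of \<open>w\<close>, given also as fractions of functions of \<open>y v\<close>;
  \<open>a\<close> and \<open>b\<close> are numerator and denominator of the inducing rational
  function in lowest terms. The relations among them are required where \<open>G\<close> does not
  vanish. In \<open>root\<close> the number \<open>s\<close> merely exists for each \<open>v\<close>
  and \<open>i\<close>; nothing is said about its dependence on \<open>v\<close>.\<close>

locale even_family =
  fixes k N m :: nat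
    and G :: "(nat \<Rightarrow> complex) \<Rightarrow> complex"
    and y :: "(nat \<Rightarrow> complex) \<Rightarrow> nat \<Rightarrow> complex"
    and r p q :: "nat \<Rightarrow> (nat \<Rightarrow> complex) \<Rightarrow> complex"
    and a b :: "(nat \<Rightarrow> complex) \<Rightarrow> complex poly"
    and c v0 :: "nat \<Rightarrow> complex"
  assumes G: "G \<in> polynomial_functions {1..k}" "G v0 \<noteq> 0"
    and y: "i \<in> {1..N} \<Longrightarrow> rational_on k G (\<lambda>v. y v i)"
    and r: "l < m \<Longrightarrow> rational_on k G (r l)"
    and pq: "l < m \<Longrightarrow> p l \<in> polynomial_functions {1..N}" "l < m \<Longrightarrow> q l \<in> polynomial_functions {1..N}"
      "l < m \<Longrightarrow> G v \<noteq> 0 \<Longrightarrow> q l (y v) \<noteq> 0 \<and> r l v = p l (y v) / q l (y v)"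
    and ab: "polynomial_family {1..k} a" "polynomial_family {1..k} b"
    and even: "\<epsilon> \<in> signs \<Longrightarrow> G (flip \<epsilon> v) = G v" "\<epsilon> \<in> signs \<Longrightarrow> l < m \<Longrightarrow> r l (flip \<epsilon> v) = r l v"
      "\<epsilon> \<in> signs \<Longrightarrow> a (flip \<epsilon> v) = a v" "\<epsilon> \<in> signs \<Longrightarrow> b (flip \<epsilon> v) = b v"
    and ab_coprime: "G v \<noteq> 0 \<Longrightarrow> poly (a v) s \<noteq> 0 \<or> poly (b v) s \<noteq> 0"
    and root: "G v \<noteq> 0 \<Longrightarrow> i \<in> {1..k} \<Longrightarrow>
      \<exists>s. s ^ m + (\<Sum>l<m. r l v * s ^ l) = 0 \<and> poly (a v) s = (c i + v i) * poly (b v) s"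
begin

text \<open>The ideal of the Zariski closure of the image of the family in
  \<open>N\<close>-space.\<close>

definition relations :: "((nat \<Rightarrow> complex) \<Rightarrow> complex) set"
  where "relations = {f \<in> polynomial_functions {1..N}. \<forall>v. G v \<noteq> 0 \<longrightarrow> f (y v) = 0}"

lemma pullback_rational: "f \<in> polynomial_functions {1..N} \<Longrightarrow> rational_on k G (\<lambda>v. f (y v))"
  using function_algebra.polynomial_functions_compose[OF rational_on_algebra, of f "{1..N}" y k G] y by simp

lemma pullback_leading:
  "f \<in> polynomial_functions {1..N} \<Longrightarrow> f \<notin> relations \<Longrightarrow> \<exists>e c. leading k (\<lambda>v. f (y v)) e c"
  using rational_on_leading[OF G(1) pullback_rational, of f] by (auto simp: relations_def)

text \<open>Nonzero rational functions have leading terms, and leading terms multiply to a leading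
  term.\<close>

lemma rational_mult_zero:
  assumes "rational_on k G F" "rational_on k G F'" "\<And>v. G v \<noteq> 0 \<Longrightarrow> F v * F' v = 0"
  shows "(\<forall>v. G v \<noteq> 0 \<longrightarrow> F v = 0) \<or> (\<forall>v. G v \<noteq> 0 \<longrightarrow> F' v = 0)"
proof (rule ccontr)
  assume "\<not> ?thesis"
  then obtain e e' d d' where "leading k F e d" "leading k F' e' d'"
    using rational_on_leading[OF G(1) assms(1)] rational_on_leading[OF G(1) assms(2)] by blast
  from leading_nonzero[OF leading_mult[OF this] one_signs]
  have "\<forall>\<^sub>F \<zeta> in at_top. F (curve \<zeta>) * F' (curve \<zeta>) \<noteq> 0" by simp
  moreover have "\<forall>\<^sub>F \<zeta> in at_top. G (curve \<zeta>) \<noteq> 0"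
    using eventually_curve_nonzero[OF G one_signs] by simp
  ultimately have "\<forall>\<^sub>F \<zeta> :: real in at_top. False" by eventually_elim (use assms(3) in blast)
  then show False by simp
qed

lemma relations_prime: "pf.prime_ideal {1..N} relations"
  unfolding pf.prime_ideal_def pf.ideal_def
proof (intro conjI ballI impI)
  show "relations \<subseteq> polynomial_functions {1..N}" "(\<lambda>_. 0) \<in> relations"
    by (auto simp: relations_def intro: pf.const)
  show "(\<lambda>_. 1) \<notin> relations" using G(2) by (auto simp: relations_def)
next
  fix f g assume "f \<in> relations" "g \<in> relations"
  then show "(\<lambda>x. f x + g x) \<in> relations" by (auto simp: relations_def intro: pf.add)
next
  fix f g assume "f \<in> polynomial_functions {1..N}" "g \<in> relations"
  then show "(\<lambda>x. f x * g x) \<in> relations" by (auto simp: relations_def intro: pf.mult)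
next
  fix f g assume f: "f \<in> polynomial_functions {1..N}" and g: "g \<in> polynomial_functions {1..N}"
    and fg: "(\<lambda>x. f x * g x) \<in> relations"
  then show "f \<in> relations \<or> g \<in> relations"
    using rational_mult_zero[OF pullback_rational[OF f] pullback_rational[OF g]] by (auto simp: relations_def)
qed

text \<open>
  The leading exponents of \<open>B\<close> lie in the rational span of \<open>E\<close>; stated through orthogonal integer vectors.
\<close>

definition spanned :: "((nat \<Rightarrow> complex) \<Rightarrow> complex) set \<Rightarrow> (nat \<Rightarrow> int) set \<Rightarrow> bool"
  where "spanned B E \<longleftrightarrow> function_algebra B \<and> B \<subseteq> polynomial_functions {1..N} \<and> finite E \<and>
    (\<forall>f\<in>B. \<forall>e d. leading k (\<lambda>v. f (y v)) e d \<longrightarrow>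
      (\<forall>l. (\<forall>e'\<in>E. pairing k l e' = 0) \<longrightarrow> pairing k l e = 0))"

lemma spanned_const: "spanned {\<lambda>_. z | z. True} {}"
  unfolding spanned_def
proof (intro conjI ballI allI impI)
  show "function_algebra {\<lambda>_. z | z. True}" by unfold_locales auto
  show "{\<lambda>_. z | z. True} \<subseteq> polynomial_functions {1..N}" by (auto intro: pf.const)
  fix f e d l assume "f \<in> {\<lambda>_. z | z. True}" "leading k (\<lambda>v. f (y v)) e d"
  then obtain z where z: "leading k (\<lambda>_. z) e d" by auto
  have "z \<noteq> 0" using leading_nonzero[OF z one_signs] by auto
  from leading_pairing_unique[OF z leading_const[OF this]] show "pairing k l e = 0"
    by (simp add: pairing_def)
qed simp

text \<open>
  An element whose leading exponent is not in the span of those of \<open>B\<close> is transcendental over \<open>B\<close>,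
  since the terms of a polynomial in it have different leading exponents.
\<close>

lemma spanned_extend:
  assumes B: "spanned B E" and f: "f \<in> polynomial_functions {1..N}"
    and e0: "leading k (\<lambda>v. f (y v)) e0 d0" and l: "pairing k l e0 \<noteq> 0" "\<And>e. e \<in> E \<Longrightarrow> pairing k l e = 0"
  shows "\<exists>B'. spanned B' (insert e0 E) \<and> B \<subseteq> B' \<and> f \<in> B' \<and> transcendental_mod relations B f"
proof -
  interpret B: function_algebra B using B by (simp add: spanned_def)
  have B_sub: "B \<subseteq> polynomial_functions {1..N}" and E: "finite E" using B by (auto simp: spanned_def)
  have B_span: "pairing k l' e = 0" if "g \<in> B" "leading k (\<lambda>v. g (y v)) e d" "\<And>e'. e' \<in> E \<Longrightarrow> pairing k l' e' = 0"
    for g e d l' using B that unfolding spanned_def by blast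
  define trm where "trm b j v = b j (y v) * f (y v) ^ j" for b :: "nat \<Rightarrow> (nat \<Rightarrow> complex) \<Rightarrow> complex" and j v
  have dich: "(\<forall>v. G v \<noteq> 0 \<longrightarrow> trm b j v = 0) \<or> (\<exists>e d. leading k (trm b j) e d)" if b: "b j \<in> B" for b j
  proof (cases "b j \<in> relations")
    case True
    then show ?thesis by (auto simp: relations_def trm_def)
  next
    case False
    then obtain e d where "leading k (\<lambda>v. b j (y v)) e d" using pullback_leading B_sub b by blast
    from leading_mult[OF this leading_power[OF e0, of j]] show ?thesis unfolding trm_def by blast
  qed
  have dich_ev: "(\<forall>\<^sub>F \<zeta> in at_top. trm b j (curve \<zeta>) = 0) \<or> (\<exists>e d. leading k (trm b j) e d)" if "b j \<in> B" for b j
  proof -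
    have "\<forall>\<^sub>F \<zeta> in at_top. G (curve \<zeta>) \<noteq> 0" using eventually_curve_nonzero[OF G one_signs] by simp
    then show ?thesis using dich[of b j] that by (auto elim: eventually_mono)
  qed
  \<comment> \<open>If \<open>l'\<close> is orthogonal to \<open>E\<close>, the coefficient
    contributes nothing to the pairing, so that of the \<open>j\<close>-th term is \<open>j\<close>
    times that of \<open>e0\<close>; for the given \<open>l\<close> this separates the
    terms.\<close>
  have exps: "pairing k l' e = j * pairing k l' e0"
    if b: "b j \<in> B" and e: "leading k (trm b j) e d" and l': "\<And>e'. e' \<in> E \<Longrightarrow> pairing k l' e' = 0" for b j e d l'
  proof -
    have "b j \<notin> relations"
    proof
      assume "b j \<in> relations"
      then have zero: "\<forall>v. G v \<noteq> 0 \<longrightarrow> trm b j v = 0" by (auto simp: relations_def trm_def)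
      have "\<forall>\<^sub>F \<zeta> in at_top. G (curve \<zeta>) \<noteq> 0 \<and> trm b j (curve \<zeta>) \<noteq> 0"
        using eventually_conj[OF eventually_curve_nonzero[OF G one_signs] leading_nonzero[OF e one_signs]] by simp
      then have "\<forall>\<^sub>F \<zeta> :: real in at_top. False" by (rule eventually_mono) (use zero in blast)
      then show False by simp
    qed
    then obtain e1 d1 where e1: "leading k (\<lambda>v. b j (y v)) e1 d1" using pullback_leading B_sub b by blast
    have "leading k (trm b j) (\<lambda>i. e1 i + int j * e0 i) (d1 * d0 ^ j)"
      using leading_mult[OF e1 leading_power[OF e0, of j]] by (simp add: trm_def[abs_def])
    from leading_pairing_unique[OF e this, of l'] B_span[OF b e1 l'] show ?thesis
      by (simp add: pairing_add pairing_scale)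
  qed
  have distinct: "j = j'"
    if "b j \<in> B" "b j' \<in> B" "leading k (trm b j) e d" "leading k (trm b j') e' d'" "\<forall>i\<in>{1..k}. e i = e' i"
    for b j j' e d e' d'
  proof -
    have "pairing k l e = pairing k l e'" using that(5) by (intro pairing_cong) auto
    then show ?thesis using exps[OF that(1,3), of l] exps[OF that(2,4), of l] l by simp
  qed
  have tr: "transcendental_mod relations B f"
    unfolding transcendental_mod_def
  proof (intro allI impI, elim conjE)
    fix b n j assume b: "\<forall>j\<le>n. b j \<in> B" and sum: "(\<lambda>x. \<Sum>j\<le>n. b j x * f x ^ j) \<in> relations" and j: "j \<le> n"
    show "b j \<in> relations"
    proof (rule ccontr)
      assume "b j \<notin> relations"
      then obtain e d where "leading k (\<lambda>v. b j (y v)) e d" using pullback_leading B_sub b j by blast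
      from leading_mult[OF this leading_power[OF e0, of j]]
      have lead: "leading k (trm b j) (\<lambda>i. e i + int j * e0 i) (d * d0 ^ j)" by (simp add: trm_def[abs_def])
      have "\<forall>\<^sub>F \<zeta> in at_top. G (curve \<zeta>) \<noteq> 0" using eventually_curve_nonzero[OF G one_signs] by simp
      then have "\<forall>\<^sub>F \<zeta> in at_top. (\<Sum>j\<in>{..n}. trm b j (curve \<zeta>)) = 0"
        by (rule eventually_mono) (use sum in \<open>simp add: relations_def trm_def\<close>)
      from leading_sum_zero[OF _ _ lead dich_ev this] b j obtain j1 j2 e1 d1 e2 d2 where
        "j1 \<le> n" "j2 \<le> n" "j1 \<noteq> j2" "leading k (trm b j1) e1 d1" "leading k (trm b j2) e2 d2" "\<forall>i\<in>{1..k}. e1 i = e2 i"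
        by auto
      then show False using distinct[of b j1 j2] b by blast
    qed
  qed
  define B' where "B' = {\<lambda>x. poly (F x) (f x) | F. B.poly_family F \<and> (\<exists>n. \<forall>x. degree (F x) \<le> n)}"
  have B'_alg: "function_algebra B'"
  proof
    fix z show "(\<lambda>_. z) \<in> B'" unfolding B'_def
      by (intro CollectI exI[of _ "\<lambda>_. [:z:]"]) (auto intro: B.poly_family_const)
  next
    fix g h assume "g \<in> B'" "h \<in> B'"
    then obtain F n F' n' where F: "B.poly_family F" "\<And>x. degree (F x) \<le> n" "g = (\<lambda>x. poly (F x) (f x))"
      and F': "B.poly_family F'" "\<And>x. degree (F' x) \<le> n'" "h = (\<lambda>x. poly (F' x) (f x))"
      unfolding B'_def by blast
    have "degree (F x + F' x) \<le> max n n'" for x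
      using degree_add_le_max[of "F x" "F' x"] F(2)[of x] F'(2)[of x] by linarith
    then show "(\<lambda>x. g x + h x) \<in> B'" unfolding B'_def F(3) F'(3)
      by (intro CollectI exI[of _ "\<lambda>x. F x + F' x"]) (auto intro: B.poly_family_add F F')
    have "degree (F x * F' x) \<le> n + n'" for x
      using degree_mult_le[of "F x" "F' x"] F(2)[of x] F'(2)[of x] by linarith
    then show "(\<lambda>x. g x * h x) \<in> B'" unfolding B'_def F(3) F'(3)
      by (intro CollectI exI[of _ "\<lambda>x. F x * F' x"]) (auto intro: B.poly_family_mult F F')
  qed
  have B'_expand: "\<exists>b n. (\<forall>j\<le>n. b j \<in> B) \<and> g = (\<lambda>x. \<Sum>j\<le>n. b j x * f x ^ j)" if g: "g \<in> B'" for g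
  proof -
    obtain F n where F: "B.poly_family F" "\<And>x. degree (F x) \<le> n" "g = (\<lambda>x. poly (F x) (f x))"
      using g unfolding B'_def by blast
    have "poly (F x) t = (\<Sum>j\<le>n. coeff (F x) j * t ^ j)" for x t
      unfolding poly_altdef using F(2)[of x] by (intro sum.mono_neutral_left) (auto simp: coeff_eq_0)
    then show ?thesis
      by (intro exI[of _ "\<lambda>j x. coeff (F x) j"] exI[of _ n]) (use F in \<open>auto intro: B.poly_family_coeff\<close>)
  qed
  have "B \<subseteq> B'"
  proof
    fix g assume "g \<in> B"
    then show "g \<in> B'" unfolding B'_def
      by (intro CollectI exI[of _ "\<lambda>x. [:g x:]"]) (auto intro: B.poly_family_const_coeff)
  qed
  moreover have "f \<in> B'" unfolding B'_def
    by (intro CollectI exI[of _ "\<lambda>x. [:0, 1:]"]) (auto intro: B.poly_family_const)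
  moreover have "spanned B' (insert e0 E)"
    unfolding spanned_def
  proof (intro conjI ballI allI impI)
    show "function_algebra B'" by fact
    show "finite (insert e0 E)" using E by simp
    show "B' \<subseteq> polynomial_functions {1..N}"
    proof
      fix g assume "g \<in> B'"
      then obtain b n where b: "\<forall>j\<le>n. b j \<in> B" "g = (\<lambda>x. \<Sum>j\<le>n. b j x * f x ^ j)"
        using B'_expand by blast
      show "g \<in> polynomial_functions {1..N}" unfolding b(2)
        using b(1) B_sub by (intro pf.sum pf.mult pf.power f) auto
    qed
    fix g e d l' assume g: "g \<in> B'" and lead: "leading k (\<lambda>v. g (y v)) e d"
      and l': "\<forall>e'\<in>insert e0 E. pairing k l' e' = 0"
    obtain b n where b: "\<forall>j\<le>n. b j \<in> B" "g = (\<lambda>x. \<Sum>j\<le>n. b j x * f x ^ j)"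
      using B'_expand[OF g] by blast
    \<comment> \<open>The extra summand with index \<open>Suc n\<close> is \<open>- g\<close>, so
      that the sum vanishes and two summands share an exponent. The terms of the expansion have
      different exponents, so one of the two is \<open>- g\<close>, and the exponent of
      \<open>g\<close> is that of a term.\<close>
    define F where "F j v = (if j \<le> n then trm b j v else - 1 * g (y v))" for j v
    have F_le: "j \<le> n \<Longrightarrow> F j = trm b j" for j by (simp add: F_def fun_eq_iff)
    have F_Suc: "leading k (F (Suc n)) e (- 1 * d)"
      using leading_mult[OF leading_const[of "-1" k] lead] by (simp add: F_def[abs_def])
    have "\<forall>\<^sub>F \<zeta> in at_top. (\<Sum>j\<in>{..Suc n}. F j (curve \<zeta>)) = 0"
    proof (intro always_eventually allI)
      fix \<zeta>
      have "(\<Sum>j\<le>n. F j (curve \<zeta>)) = g (y (curve \<zeta>))" unfolding b(2) by (simp add: F_def trm_def)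
      then show "(\<Sum>j\<in>{..Suc n}. F j (curve \<zeta>)) = 0" by (simp add: F_def)
    qed
    moreover have "(\<forall>\<^sub>F \<zeta> in at_top. F j (curve \<zeta>) = 0) \<or> (\<exists>e d. leading k (F j) e d)" if "j \<in> {..Suc n}" for j
      using that dich_ev[of b j] F_le[of j] F_Suc b(1) by (cases "j \<le> n") (auto simp: le_Suc_eq)
    ultimately obtain j1 j2 e1 d1 e2 d2 where j: "j1 \<le> Suc n" "j2 \<le> Suc n" "j1 \<noteq> j2" "leading k (F j1) e1 d1"
      "leading k (F j2) e2 d2" "\<forall>i\<in>{1..k}. e1 i = e2 i"
      using leading_sum_zero[of "{..Suc n}" "Suc n" k F e "- 1 * d"] F_Suc by auto
    have p12: "pairing k l' e1 = pairing k l' e2" using j(6) by (intro pairing_cong) auto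
    have small: "pairing k l' e' = 0" if "j \<le> n" "leading k (F j) e' d'" for j e' d'
      using exps[of b j e' d' l'] that b(1) l' F_le[of j] by auto
    have big: "pairing k l' e' = pairing k l' e" if "leading k (F (Suc n)) e' d'" for e' d'
      using leading_pairing_unique[OF that F_Suc] .
    show "pairing k l' e = 0"
    proof (cases "j1 \<le> n \<and> j2 \<le> n")
      case True
      then have False using distinct[of b j1 j2 e1 d1 e2 d2] j b(1) F_le by auto
      then show ?thesis ..
    next
      case False
      then show ?thesis using j small big p12 by (metis le_Suc_eq)
    qed
  qed
  ultimately show ?thesis using tr by blast
qed

text \<open>\<open>E j\<close> has at most \<open>j\<close> elements, so for \<open>j < k\<close>
  there is a nonzero integer vector orthogonal to it, and by \<open>no\<close> some function has an
  exponent outside the span; adjoining this function extends the tower of algebras.\<close>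

lemma chain_or_orthogonal:
  assumes no: "\<And>l. \<exists>i\<in>{1..k}. l i \<noteq> 0 \<Longrightarrow>
    \<exists>f\<in>polynomial_functions {1..N}. \<exists>e d. leading k (\<lambda>v. f (y v)) e d \<and> pairing k l e \<noteq> 0"
  shows "\<exists>P. P k = relations \<and> (\<forall>i\<le>k. pf.prime_ideal {1..N} (P i)) \<and> (\<forall>i<k. P (Suc i) \<subset> P i)"
proof -
  have "\<exists>B f E. (\<forall>i\<le>j. spanned (B i) (E i) \<and> card (E i) \<le> i) \<and>
    (\<forall>i<j. B i \<subseteq> B (Suc i) \<and> f i \<in> B (Suc i) \<and> transcendental_mod relations (B i) (f i))" if "j \<le> k" for j
    using that
  proof (induction j)
    case 0
    show ?case using spanned_const
      by (intro exI[of _ "\<lambda>_. {\<lambda>_. z | z. True}"] exI[of _ undefined] exI[of _ "\<lambda>_. {}"]) simp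
  next
    case (Suc j)
    then obtain B f E where IH: "\<And>i. i \<le> j \<Longrightarrow> spanned (B i) (E i) \<and> card (E i) \<le> i"
      "\<And>i. i < j \<Longrightarrow> B i \<subseteq> B (Suc i) \<and> f i \<in> B (Suc i) \<and> transcendental_mod relations (B i) (f i)"
      by auto
    have Ej: "finite (E j)" "card (E j) \<le> j" and Bj: "spanned (B j) (E j)" using IH(1)[of j] by (auto simp: spanned_def)
    obtain l where l: "\<exists>i\<in>{1..k}. l i \<noteq> 0" "\<forall>e\<in>E j. (\<Sum>i=1..k. e i * l i) = 0"
      using homogeneous_system[of "E j" "{1..k}" "\<lambda>e i. e i"] Ej Suc.prems by auto
    have l': "pairing k l e = 0" if "e \<in> E j" for e using l(2) that by (simp add: pairing_def mult.commute)
    obtain g e d where g: "g \<in> polynomial_functions {1..N}" "leading k (\<lambda>v. g (y v)) e d" "pairing k l e \<noteq> 0"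
      using no[OF l(1)] by blast
    obtain B' where B': "spanned B' (insert e (E j))" "B j \<subseteq> B'" "g \<in> B'" "transcendental_mod relations (B j) g"
      using spanned_extend[OF Bj g l'] by blast
    have "card (insert e (E j)) \<le> Suc j" using Ej by (simp add: card_insert_if)
    then show ?case
      by (intro exI[of _ "B(Suc j := B')"] exI[of _ "f(j := g)"] exI[of _ "E(Suc j := insert e (E j))"])
         (use IH B' in \<open>auto simp: le_Suc_eq less_Suc_eq\<close>)
  qed
  then obtain B f E where BfE: "\<And>i. i \<le> k \<Longrightarrow> spanned (B i) (E i)"
    "\<And>i. i < k \<Longrightarrow> B i \<subseteq> B (Suc i) \<and> f i \<in> B (Suc i) \<and> transcendental_mod relations (B i) (f i)"
    by (metis order_refl)
  show ?thesis
    by (rule prime_chain[OF _ relations_prime, where B = B and f = f]) (use BfE in \<open>auto simp: spanned_def\<close>)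
qed

end

section \<open>Divisors of the equation and the impossibility of an orthogonal vector\<close>

lemma (in function_algebra) poly_family_monom: "f \<in> A \<Longrightarrow> poly_family (\<lambda>x. monom (f x) j)"
  unfolding poly_family_def
proof
  fix i assume "f \<in> A" then show "(\<lambda>x. coeff (monom (f x) j) i) \<in> A"
    by (cases "i = j") (auto intro: const)
qed

lemma polynomial_functions_flip:
  "f \<in> polynomial_functions I \<Longrightarrow> (\<lambda>v. f (flip \<epsilon> v)) \<in> polynomial_functions I"
proof (erule pf.polynomial_functions_compose)
  fix i assume "i \<in> I"
  then show "(\<lambda>v. flip \<epsilon> v i) \<in> polynomial_functions I"
    unfolding flip_def by (intro pf.mult pf.const polynomial_functions.coord)
qed

lemma polynomial_functions_nonzero_mult:
  assumes "f \<in> polynomial_functions I" "g \<in> polynomial_functions I" "\<exists>v. f v \<noteq> 0" "\<exists>v. g v \<noteq> 0"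
  shows "\<exists>v. f v * g v \<noteq> 0"
  using polynomial_functions_no_zero_divisors[OF assms(1,2)] assms(3,4) by (metis mult_eq_0_iff)

lemma monic_splits:
  fixes P :: "complex poly"
  assumes "lead_coeff P = 1"
  shows "\<exists>s. P = (\<Prod>i<degree P. [:- s i, 1:])"
proof -
  obtain as where as: "smult (lead_coeff P) (\<Prod>a\<leftarrow>as. [:- a, 1:]) = P" "length as = degree P"
    using fundamental_theorem_algebra_factorized[of P] by blast
  have "P = (\<Prod>a\<leftarrow>as. [:- a, 1:])" using as(1) assms by simp
  also have "\<dots> = (\<Prod>i<degree P. [:- (as ! i), 1:])"
    by (simp add: prod.list_conv_set_nth as(2) atLeast0LessThan)
  finally show ?thesis by blast
qed

text \<open>Roots may coincide, so the divisor is recorded by a set of indices. Each linear factor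
  either divides \<open>Q\<close> or can be cancelled from the product.\<close>

lemma monic_dvd_prod_linear:
  fixes Q :: "complex poly"
  assumes "finite I" "Q dvd (\<Prod>i\<in>I. [:- s i, 1:])" "lead_coeff Q = 1"
  shows "\<exists>K\<subseteq>I. Q = (\<Prod>i\<in>K. [:- s i, 1:])"
  using assms
proof (induction I arbitrary: Q rule: finite_induct)
  case empty
  then have "degree Q = 0" by (auto dest: dvd_imp_degree_le)
  then have "Q = 1" using empty.prems(2) by (metis degree_eq_zeroE lead_coeff_pCons(2) one_pCons)
  then show ?case by auto
next
  case (insert i I)
  show ?case
  proof (cases "poly Q (s i) = 0")
    case True
    then obtain Q' where Q': "Q = [:- s i, 1:] * Q'" by (auto simp: poly_eq_0_iff_dvd)
    have "[:- s i, 1:] * Q' dvd [:- s i, 1:] * (\<Prod>i\<in>I. [:- s i, 1:])" using insert Q' by simp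
    then have "Q' dvd (\<Prod>i\<in>I. [:- s i, 1:])" by (subst (asm) dvd_times_left_cancel_iff) auto
    moreover have "lead_coeff Q' = 1" using insert.prems(2) unfolding Q' lead_coeff_mult by simp
    ultimately obtain K where "K \<subseteq> I" "Q' = (\<Prod>i\<in>K. [:- s i, 1:])" using insert.IH by blast
    then show ?thesis using Q' insert.hyps
      by (intro exI[of _ "insert i K"]) (auto simp: finite_subset prod.insert_if simp del: mult_pCons_left)
  next
    case False
    obtain X where X: "[:- s i, 1:] * (\<Prod>i\<in>I. [:- s i, 1:]) = Q * X"
      using insert.prems(1) insert.hyps by (auto simp del: mult_pCons_left elim: dvdE)
    from arg_cong[OF this, of "\<lambda>F. poly F (s i)"] have "poly X (s i) = 0" using False by simp
    then obtain X' where "X = [:- s i, 1:] * X'" by (auto simp: poly_eq_0_iff_dvd)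
    then have "[:- s i, 1:] * (\<Prod>i\<in>I. [:- s i, 1:]) = [:- s i, 1:] * (Q * X')"
      using X by (simp only: mult.left_commute)
    then have "(\<Prod>i\<in>I. [:- s i, 1:]) = Q * X'" by (subst (asm) mult_left_cancel) auto
    then have "Q dvd (\<Prod>i\<in>I. [:- s i, 1:])" by simp
    then show ?thesis using insert.IH[OF _ insert.prems(2)] by blast
  qed
qed

context even_family
begin

lemma leading_not_zero: "leading k F e d \<Longrightarrow> \<exists>v. G v \<noteq> 0 \<and> F v \<noteq> 0"
proof (rule ccontr)
  assume F: "leading k F e d" and no: "\<not> ?thesis"
  have "\<forall>\<^sub>F \<zeta> in at_top. G (curve \<zeta>) \<noteq> 0 \<and> F (curve \<zeta>) \<noteq> 0"
    using eventually_conj[OF eventually_curve_nonzero[OF G one_signs] leading_nonzero[OF F one_signs]] by simp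
  then have "\<forall>\<^sub>F \<zeta> :: real in at_top. False" by (rule eventually_mono) (use no in blast)
  then show False by simp
qed

definition equation :: "(nat \<Rightarrow> complex) \<Rightarrow> complex poly"
  where "equation v = monom 1 m + (\<Sum>j<m. monom (r j v) j)"

lemma poly_equation: "poly (equation v) s = s ^ m + (\<Sum>j<m. r j v * s ^ j)"
  by (simp add: equation_def poly_monom poly_sum)

lemma degree_equation: "degree (equation v) = m" "lead_coeff (equation v) = 1"
proof -
  have c: "coeff (equation v) m = 1" by (simp add: equation_def coeff_sum)
  have "degree (equation v) \<le> m" unfolding equation_def
    by (intro degree_add_le degree_monom_le degree_sum_le) (auto intro: order.trans[OF degree_monom_le])
  moreover have "m \<le> degree (equation v)" using c by (intro le_degree) simp
  ultimately show "degree (equation v) = m" by simp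
  then show "lead_coeff (equation v) = 1" using c by simp
qed

lemma equation_flip: "\<epsilon> \<in> signs \<Longrightarrow> equation (flip \<epsilon> v) = equation v"
  by (simp add: equation_def even)

text \<open>The gcd is formed over polynomial functions, so the equation is multiplied by the
  product of the denominators of its coefficients.\<close>

lemma cleared_equation:
  obtains D P where "D \<in> polynomial_functions {1..k}" "polynomial_family {1..k} P"
    "\<And>v. G v \<noteq> 0 \<Longrightarrow> D v \<noteq> 0 \<and> P v = smult (D v) (equation v)"
proof -
  have "\<forall>j\<in>{..<m}. \<exists>nd. fst nd \<in> polynomial_functions {1..k} \<and> snd nd \<in> polynomial_functions {1..k} \<and>
    (\<forall>v. G v \<noteq> 0 \<longrightarrow> snd nd v \<noteq> 0 \<and> r j v = fst nd v / snd nd v)"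
    using r unfolding rational_on_def by fastforce
  from bchoice[OF this] obtain nd where nd: "\<And>j. j < m \<Longrightarrow> fst (nd j) \<in> polynomial_functions {1..k}"
    "\<And>j. j < m \<Longrightarrow> snd (nd j) \<in> polynomial_functions {1..k}"
    "\<And>j v. j < m \<Longrightarrow> G v \<noteq> 0 \<Longrightarrow> snd (nd j) v \<noteq> 0 \<and> r j v = fst (nd j) v / snd (nd j) v"
    by auto
  define D where "D v = (\<Prod>j<m. snd (nd j) v)" for v
  define co where "co j v = fst (nd j) v * (\<Prod>i\<in>{..<m}-{j}. snd (nd i) v)" for j v
  define P where "P v = monom (D v) m + (\<Sum>j<m. monom (co j v) j)" for v
  have D: "D \<in> polynomial_functions {1..k}" unfolding D_def
    by (intro pf.prod nd) auto
  have co: "co j \<in> polynomial_functions {1..k}" if "j < m" for j unfolding co_def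
    by (intro pf.mult pf.prod nd) (use that in auto)
  have "degree (P v) \<le> m" for v unfolding P_def
    by (intro degree_add_le degree_monom_le degree_sum_le) (auto intro: order.trans[OF degree_monom_le])
  moreover have "pf.poly_family {1..k} P" unfolding P_def[abs_def]
    by (intro pf.poly_family_add pf.poly_family_sum
      pf.poly_family_monom D co) auto
  ultimately have P: "polynomial_family {1..k} P" unfolding polynomial_family_def by blast
  have "D v \<noteq> 0 \<and> P v = smult (D v) (equation v)" if v: "G v \<noteq> 0" for v
  proof
    show "D v \<noteq> 0" using nd(3)[OF _ v] by (simp add: D_def)
    have "co j v = D v * r j v" if j: "j < m" for j
      unfolding co_def D_def using nd(3)[OF j v] j by (simp add: prod.remove[of "{..<m}" j])
    then show "P v = smult (D v) (equation v)"
      by (simp add: P_def equation_def smult_add_right smult_monom smult_sum2)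
  qed
  then show thesis using that D P by blast
qed

text \<open>The functions of \<open>y v\<close> localised at the product of the \<open>q j\<close>.
  This ring contains the coefficients of the equation, while leading exponents of its elements are
  still differences of exponents of pulled back functions.\<close>

definition coefficients :: "((nat \<Rightarrow> complex) \<Rightarrow> complex) set"
  where "coefficients = {F. \<exists>g\<in>polynomial_functions {1..N}. \<exists>t. \<forall>v. G v \<noteq> 0 \<longrightarrow>
    F v = g (y v) / (\<Prod>j<m. q j (y v)) ^ t}"

lemma denominator_nonzero: "G v \<noteq> 0 \<Longrightarrow> (\<Prod>j<m. q j (y v)) \<noteq> 0"
  using pq(3) by simp

lemma denominator_in: "(\<lambda>x. \<Prod>j<m. q j x) \<in> polynomial_functions {1..N}"
  by (intro pf.prod pq) auto

lemma coefficients_algebra: "function_algebra coefficients"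
proof
  fix z show "(\<lambda>_. z) \<in> coefficients" unfolding coefficients_def
    by (intro CollectI bexI[of _ "\<lambda>_. z"] exI[of _ 0]) (auto intro: pf.const)
next
  fix F F' assume "F \<in> coefficients" "F' \<in> coefficients"
  then obtain g t g' t' where g: "g \<in> polynomial_functions {1..N}"
      "\<And>v. G v \<noteq> 0 \<Longrightarrow> F v = g (y v) / (\<Prod>j<m. q j (y v)) ^ t"
    and g': "g' \<in> polynomial_functions {1..N}"
      "\<And>v. G v \<noteq> 0 \<Longrightarrow> F' v = g' (y v) / (\<Prod>j<m. q j (y v)) ^ t'"
    unfolding coefficients_def by blast
  note intros = pf.add pf.mult pf.power
    g(1) g'(1) denominator_in
  show "(\<lambda>v. F v + F' v) \<in> coefficients" unfolding coefficients_def
    by (intro CollectI bexI[of _ "\<lambda>x. g x * (\<Prod>j<m. q j x) ^ t' + g' x * (\<Prod>j<m. q j x) ^ t"] exI[of _ "t + t'"] intros)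
       (use g(2) g'(2) denominator_nonzero in \<open>auto simp: power_add add_frac_eq\<close>)
  show "(\<lambda>v. F v * F' v) \<in> coefficients" unfolding coefficients_def
    by (intro CollectI bexI[of _ "\<lambda>x. g x * g' x"] exI[of _ "t + t'"] intros)
       (use g(2) g'(2) in \<open>auto simp: power_add\<close>)
qed

lemma r_coefficients: "j < m \<Longrightarrow> r j \<in> coefficients"
  unfolding coefficients_def
proof (intro CollectI bexI[of _ "\<lambda>x. p j x * (\<Prod>i\<in>{..<m}-{j}. q i x)"] exI[of _ 1] allI impI)
  assume j: "j < m"
  show "(\<lambda>x. p j x * (\<Prod>i\<in>{..<m}-{j}. q i x)) \<in> polynomial_functions {1..N}"
    by (intro pf.mult pf.prod pq) (use j in auto)
  fix v assume "G v \<noteq> 0"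
  then show "r j v = p j (y v) * (\<Prod>i\<in>{..<m}-{j}. q i (y v)) / (\<Prod>j<m. q j (y v)) ^ 1"
    using pq(3)[OF j, of v] pq(3)[of _ v] j by (simp add: prod.remove[of "{..<m}" j])
qed

lemma equation_coefficients: "function_algebra.poly_family coefficients equation"
proof -
  interpret C: function_algebra coefficients by (rule coefficients_algebra)
  show ?thesis unfolding equation_def[abs_def]
    by (intro C.poly_family_add C.poly_family_const C.poly_family_sum C.poly_family_monom r_coefficients) auto
qed

lemma coefficients_leading:
  assumes neutral: "\<And>f e d. f \<in> polynomial_functions {1..N} \<Longrightarrow> leading k (\<lambda>v. f (y v)) e d \<Longrightarrow> pairing k l e = 0"
    and F: "F \<in> coefficients"
  shows "(\<forall>v. G v \<noteq> 0 \<longrightarrow> F v = 0) \<or> (\<exists>e d. leading k F e d \<and> pairing k l e = 0)"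
proof -
  obtain g t where g: "g \<in> polynomial_functions {1..N}"
      "\<And>v. G v \<noteq> 0 \<Longrightarrow> F v = g (y v) / (\<Prod>j<m. q j (y v)) ^ t"
    using F unfolding coefficients_def by blast
  show ?thesis
  proof (cases "g \<in> relations")
    case True
    then show ?thesis using g(2) by (auto simp: relations_def)
  next
    case False
    then obtain e d where e: "leading k (\<lambda>v. g (y v)) e d" using pullback_leading g(1) by blast
    have "(\<lambda>x. \<Prod>j<m. q j x) \<notin> relations" using denominator_nonzero[OF G(2)] G(2) by (auto simp: relations_def)
    then obtain e' d' where e': "leading k (\<lambda>v. \<Prod>j<m. q j (y v)) e' d'"
      using pullback_leading[OF denominator_in] by blast
    have "leading k F (\<lambda>i. e i + - (int t * e' i)) (d * inverse (d' ^ t))"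
    proof (rule leading_cong[OF leading_mult[OF e leading_inverse[OF leading_power[OF e', of t]]]])
      fix \<epsilon> assume "\<epsilon> \<in> signs"
      from eventually_curve_nonzero[OF G this]
      show "\<forall>\<^sub>F \<zeta> in at_top. g (y (flip \<epsilon> (curve \<zeta>))) * inverse ((\<Prod>j<m. q j (y (flip \<epsilon> (curve \<zeta>)))) ^ t)
          = F (flip \<epsilon> (curve \<zeta>))"
        by (rule eventually_mono) (use g(2) in \<open>auto simp: divide_inverse\<close>)
    qed
    moreover have "pairing k l (\<lambda>i. e i + - (int t * e' i)) = 0"
      unfolding pairing_add pairing_minus pairing_scale
      using neutral[OF g(1) e] neutral[OF denominator_in e'] by simp
    ultimately show ?thesis by blast
  qed
qed

text \<open>
  The greatest common divisor of the equation of \<open>w\<close> and of \<open>a - (c i0 + v i0) b\<close> over the rational functions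
  in \<open>v\<close>; the sign change moves one of its coefficients, for otherwise a root of it would be
  mapped by \<open>a / b\<close> both to \<open>c i0 + v i0\<close> and to \<open>c i0 - v i0\<close>.
\<close>

lemma moved_coefficient:
  assumes \<epsilon>: "\<epsilon> \<in> signs" and i0: "i0 \<in> {1..k}" "\<epsilon> i0 = - 1"
  obtains H \<eta> W w j where "pf.poly_family {1..k} H" "\<eta> \<in> polynomial_functions {1..k}"
    "W \<in> polynomial_functions {1..k}" "W w \<noteq> 0"
    "\<And>v. W v \<noteq> 0 \<Longrightarrow> G v \<noteq> 0 \<and> \<eta> v \<noteq> 0 \<and> \<eta> (flip \<epsilon> v) \<noteq> 0"
    "\<And>v. W v \<noteq> 0 \<Longrightarrow> smult (inverse (\<eta> v)) (H v) dvd equation v"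
    "\<And>v. W v \<noteq> 0 \<Longrightarrow> smult (inverse (\<eta> (flip \<epsilon> v))) (H (flip \<epsilon> v)) dvd equation v"
    "\<And>v. W v \<noteq> 0 \<Longrightarrow> lead_coeff (smult (inverse (\<eta> v)) (H v)) = 1"
    "\<And>v. W v \<noteq> 0 \<Longrightarrow> lead_coeff (smult (inverse (\<eta> (flip \<epsilon> v))) (H (flip \<epsilon> v))) = 1"
    "coeff (H w) j * \<eta> (flip \<epsilon> w) \<noteq> coeff (H (flip \<epsilon> w)) j * \<eta> w"
proof -
  obtain D P where D: "D \<in> polynomial_functions {1..k}" and P: "polynomial_family {1..k} P"
    and DP: "\<And>v. G v \<noteq> 0 \<Longrightarrow> D v \<noteq> 0 \<and> P v = smult (D v) (equation v)"
    using cleared_equation by blast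
  \<comment> \<open>Apart from common zeros of \<open>a\<close> and \<open>b\<close>, its roots are
    the points at which \<open>a / b\<close> takes the value \<open>c i0 + v i0\<close>.\<close>
  define B where "B v = a v + [:- (c i0 + v i0):] * b v" for v
  have B: "polynomial_family {1..k} B" unfolding polynomial_family_def
  proof
    have "(\<lambda>v. - (c i0 + v i0)) \<in> polynomial_functions {1..k}"
      by (intro pf.uminus pf.add pf.const
          polynomial_functions.coord i0)
    then show "pf.poly_family {1..k} B" using ab unfolding B_def[abs_def] polynomial_family_def
      by (intro pf.poly_family_add pf.poly_family_mult
          pf.poly_family_const_coeff) auto
    obtain na nb where nab: "\<And>v. degree (a v) \<le> na" "\<And>v. degree (b v) \<le> nb"
      using ab by (auto simp: polynomial_family_def)
    have "degree (B v) \<le> max na nb" for v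
    proof -
      have "degree ([:- (c i0 + v i0):] * b v) \<le> nb"
        using degree_mult_le[of "[:- (c i0 + v i0):]" "b v"] nab(2)[of v] by simp
      then show ?thesis unfolding B_def using degree_add_le_max[of "a v" "[:- (c i0 + v i0):] * b v"] nab(1)[of v]
        by linarith
    qed
    then show "\<exists>n. \<forall>v. degree (B v) \<le> n" by blast
  qed
  have "equation v0 \<noteq> 0" using degree_equation(2)[of v0] by auto
  then have "P v0 \<noteq> 0" using DP[OF G(2)] by simp
  then obtain H B' P' \<alpha> \<beta> d M w0 where d: "d \<in> polynomial_functions {1..k}"
    and H': "polynomial_family {1..k} H" and "polynomial_family {1..k} B'" "polynomial_family {1..k} P'"
    and HB: "\<And>v. smult (d v) (B v) = H v * B' v" and HP: "\<And>v. smult (d v) (P v) = H v * P' v"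
    and bez: "\<And>v. \<alpha> v * B' v + \<beta> v * P' v = [:d v:]"
    and deg: "\<And>v. degree (H v) \<le> M" and w0: "d w0 * coeff (H w0) M \<noteq> 0"
    by (rule pseudo_gcd_family[OF B P]) (rule that)
  have H: "pf.poly_family {1..k} H" using H' by (simp add: polynomial_family_def)
  define \<eta> where "\<eta> v = coeff (H v) M" for v
  have \<eta>: "\<eta> \<in> polynomial_functions {1..k}"
    unfolding \<eta>_def[abs_def] by (rule pf.poly_family_coeff[OF H])
  define V where "V v = G v * (d v * \<eta> v)" for v
  have V: "V \<in> polynomial_functions {1..k}" unfolding V_def[abs_def] by (intro pf.mult G d \<eta>)
  have "\<exists>v. V v \<noteq> 0" unfolding V_def
    by (intro polynomial_functions_nonzero_mult[of _ "{1..k}"] pf.mult G d \<eta>)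
       (use w0 G(2) in \<open>auto simp: \<eta>_def\<close>)
  then obtain v1 where v1: "V v1 \<noteq> 0" by blast
  \<comment> \<open>Everything has to hold at \<open>v\<close> and at its flip; the factor
    \<open>v i0\<close> keeps \<open>c i0 + v i0\<close> and \<open>c i0 - v i0\<close>
    apart.\<close>
  define W where "W v = V v * (V (flip \<epsilon> v) * v i0)" for v
  have W: "W \<in> polynomial_functions {1..k}" unfolding W_def[abs_def]
    by (intro pf.mult V polynomial_functions_flip polynomial_functions.coord i0)
  have "\<exists>v. W v \<noteq> 0" unfolding W_def
  proof (intro polynomial_functions_nonzero_mult[of _ "{1..k}"] pf.mult V
      polynomial_functions_flip polynomial_functions.coord i0)
    show "\<exists>v. V v \<noteq> 0" using v1 by blast
    show "\<exists>v. V (flip \<epsilon> v) \<noteq> 0" using v1 flip_flip[OF \<epsilon>] by metis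
    show "\<exists>v. v i0 \<noteq> (0 :: complex)" by (rule exI[of _ "\<lambda>_. 1"]) simp
  qed
  then obtain w where w: "W w \<noteq> 0" by blast
  have good: "G v \<noteq> 0" "d v \<noteq> 0" "\<eta> v \<noteq> 0" "degree (H v) = M" if "V v \<noteq> 0" for v
  proof -
    show "G v \<noteq> 0" "d v \<noteq> 0" "\<eta> v \<noteq> 0" using that by (auto simp: V_def)
    then show "degree (H v) = M" using deg[of v] le_degree[of "H v" M] by (simp add: \<eta>_def)
  qed
  have WV: "V v \<noteq> 0" "V (flip \<epsilon> v) \<noteq> 0" "v i0 \<noteq> 0" if "W v \<noteq> 0" for v using that by (auto simp: W_def)
  have monic: "lead_coeff (smult (inverse (\<eta> v)) (H v)) = 1" if "V v \<noteq> 0" for v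
    using good[OF that] by (simp add: \<eta>_def)
  have dvd: "smult (inverse (\<eta> v)) (H v) dvd equation v" if V: "V v \<noteq> 0" for v
  proof -
    have "smult (d v) (smult (D v) (equation v)) = H v * P' v" using HP[of v] DP good(1)[OF V] by simp
    then have "H v dvd smult (d v * D v) (equation v)" by simp
    moreover have "d v * D v \<noteq> 0" using DP good[OF V] by simp
    ultimately have "H v dvd equation v" using dvd_smult_cancel by blast
    then show ?thesis using good(3)[OF V] by (simp add: smult_dvd_iff)
  qed
  have BH: "poly (a v) s = (c i0 + v i0) * poly (b v) s" if "V v \<noteq> 0" "poly (H v) s = 0" for v s
  proof -
    have "d v * poly (B v) s = 0" using arg_cong[OF HB[of v], of "\<lambda>F. poly F s"] that(2) by simp
    then have "poly (B v) s = 0" using good(2)[OF that(1)] by simp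
    then show ?thesis by (simp add: B_def algebra_simps)
  qed
  \<comment> \<open>The equation and \<open>B\<close> have a common root by \<open>root\<close>;
    were \<open>H w\<close> a nonzero constant, the Bezout identity would fail at this root.\<close>
  have "M \<noteq> 0"
  proof
    assume "M = 0"
    then obtain h where h: "H w = [:h:]" using good(4)[OF WV(1)[OF w]] by (metis degree_eq_zeroE)
    then have "h \<noteq> 0" using good(3)[OF WV(1)[OF w]] \<open>M = 0\<close> by (simp add: \<eta>_def)
    obtain s where s: "poly (equation w) s = 0" "poly (a w) s = (c i0 + w i0) * poly (b w) s"
      using root[OF good(1)[OF WV(1)[OF w]] i0(1)] by (auto simp: poly_equation)
    have "poly (B w) s = 0" using s(2) by (simp add: B_def algebra_simps)
    then have "poly (B' w) s = 0" using arg_cong[OF HB[of w], of "\<lambda>F. poly F s"] h \<open>h \<noteq> 0\<close> by simp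
    moreover have "poly (P w) s = 0" using s(1) DP good(1)[OF WV(1)[OF w]] by simp
    then have "poly (P' w) s = 0" using arg_cong[OF HP[of w], of "\<lambda>F. poly F s"] h \<open>h \<noteq> 0\<close> by simp
    ultimately have "d w = 0" using arg_cong[OF bez[of w], of "\<lambda>F. poly F s"] by simp
    then show False using good(2)[OF WV(1)[OF w]] by simp
  qed
  have "\<exists>j. coeff (H w) j * \<eta> (flip \<epsilon> w) \<noteq> coeff (H (flip \<epsilon> w)) j * \<eta> w"
  proof (rule ccontr)
    assume "\<not> ?thesis"
    then have eq: "smult (\<eta> (flip \<epsilon> w)) (H w) = smult (\<eta> w) (H (flip \<epsilon> w))"
      by (simp add: poly_eq_iff mult.commute)
    have "\<not> constant (poly (H w))" using good(4)[OF WV(1)[OF w]] \<open>M \<noteq> 0\<close> by (simp add: constant_degree)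
    then obtain s where s: "poly (H w) s = 0" using fundamental_theorem_of_algebra by blast
    then have s': "poly (H (flip \<epsilon> w)) s = 0"
      using arg_cong[OF eq, of "\<lambda>F. poly F s"] good(3)[OF WV(1)[OF w]] by simp
    have flip_w: "flip \<epsilon> w i0 = - w i0" by (simp add: flip_def i0)
    have "poly (a w) s = (c i0 - w i0) * poly (b w) s"
      using BH[OF WV(2)[OF w] s'] even(3,4)[OF \<epsilon>, of w] flip_w by simp
    moreover have "poly (a w) s = (c i0 + w i0) * poly (b w) s" using BH[OF WV(1)[OF w] s] .
    ultimately have "2 * (w i0 * poly (b w) s) = 0" by (simp add: algebra_simps)
    then have "poly (b w) s = 0" using WV(3)[OF w] by simp
    then show False using ab_coprime[OF good(1)[OF WV(1)[OF w]], of s] BH[OF WV(1)[OF w] s] by simp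
  qed
  then obtain j where j: "coeff (H w) j * \<eta> (flip \<epsilon> w) \<noteq> coeff (H (flip \<epsilon> w)) j * \<eta> w" by blast
  show thesis
  proof (rule that[OF H \<eta> W w])
    fix v assume v: "W v \<noteq> 0"
    show "G v \<noteq> 0 \<and> \<eta> v \<noteq> 0 \<and> \<eta> (flip \<epsilon> v) \<noteq> 0" using good WV v by blast
    show "smult (inverse (\<eta> v)) (H v) dvd equation v" by (rule dvd[OF WV(1)[OF v]])
    show "smult (inverse (\<eta> (flip \<epsilon> v))) (H (flip \<epsilon> v)) dvd equation v"
      using dvd[OF WV(2)[OF v]] by (simp only: equation_flip[OF \<epsilon>])
    show "lead_coeff (smult (inverse (\<eta> v)) (H v)) = 1" by (rule monic[OF WV(1)[OF v]])
    show "lead_coeff (smult (inverse (\<eta> (flip \<epsilon> v))) (H (flip \<epsilon> v))) = 1" by (rule monic[OF WV(2)[OF v]])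
  qed (rule j)
qed

text \<open>The function \<open>f\<close>, a normalised coefficient of the divisor minus its flip,
  is anti-invariant, so its exponent \<open>e0\<close> pairs oddly with \<open>l'\<close>. It is
  also a root of a monic \<open>R\<close> over \<open>coefficients\<close>, whose exponents pair to
  zero with \<open>l'\<close>. The term of degree \<open>i\<close> therefore pairs to
  \<open>i\<close> times the pairing of \<open>e0\<close>, and the terms have different exponents,
  so they cannot cancel.\<close>

lemma not_orthogonal:
  assumes l0: "\<exists>i\<in>{1..k}. l i \<noteq> 0"
  shows "\<exists>f\<in>polynomial_functions {1..N}. \<exists>e d. leading k (\<lambda>v. f (y v)) e d \<and> pairing k l e \<noteq> 0"
proof (rule ccontr)
  assume contr: "\<not> ?thesis"
  define E where "E = {e. \<exists>f\<in>polynomial_functions {1..N}. \<exists>d. leading k (\<lambda>v. f (y v)) e d}"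
  have "pairing k l e = 0" if "e \<in> E" for e using contr that unfolding E_def by blast
  then obtain l' i0 where i0: "i0 \<in> {1..k}" "odd (l' i0)" and l': "\<And>e. e \<in> E \<Longrightarrow> pairing k l' e = 0"
    using odd_orthogonal[OF l0, of E] by blast
  have neutral: "pairing k l' e = 0" if "f \<in> polynomial_functions {1..N}" "leading k (\<lambda>v. f (y v)) e d" for f e d
    using l' that unfolding E_def by blast
  define \<epsilon> where "\<epsilon> = parity_sign l'"
  have \<epsilon>: "\<epsilon> \<in> signs" "\<epsilon> i0 = - 1" using i0 by (auto simp: \<epsilon>_def parity_sign_in parity_sign_def)
  obtain H \<eta> W w j where H: "pf.poly_family {1..k} H" and \<eta>: "\<eta> \<in> polynomial_functions {1..k}"
    and W: "W \<in> polynomial_functions {1..k}" "W w \<noteq> 0"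
    and good: "\<And>v. W v \<noteq> 0 \<Longrightarrow> G v \<noteq> 0 \<and> \<eta> v \<noteq> 0 \<and> \<eta> (flip \<epsilon> v) \<noteq> 0"
    and dvd: "\<And>v. W v \<noteq> 0 \<Longrightarrow> smult (inverse (\<eta> v)) (H v) dvd equation v"
    "\<And>v. W v \<noteq> 0 \<Longrightarrow> smult (inverse (\<eta> (flip \<epsilon> v))) (H (flip \<epsilon> v)) dvd equation v"
    and monic: "\<And>v. W v \<noteq> 0 \<Longrightarrow> lead_coeff (smult (inverse (\<eta> v)) (H v)) = 1"
    "\<And>v. W v \<noteq> 0 \<Longrightarrow> lead_coeff (smult (inverse (\<eta> (flip \<epsilon> v))) (H (flip \<epsilon> v))) = 1"
    and neq: "coeff (H w) j * \<eta> (flip \<epsilon> w) \<noteq> coeff (H (flip \<epsilon> w)) j * \<eta> w"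
    by (rule moved_coefficient[OF \<epsilon>(1) i0(1) \<epsilon>(2)]) (rule that)
  \<comment> \<open>Cleared of the leading coefficients: under the flip \<open>num\<close> changes
    sign and \<open>den\<close> is unchanged.\<close>
  define num where "num v = coeff (H v) j * \<eta> (flip \<epsilon> v) - coeff (H (flip \<epsilon> v)) j * \<eta> v" for v
  define den where "den v = \<eta> v * \<eta> (flip \<epsilon> v)" for v
  have Hj: "(\<lambda>v. coeff (H v) j) \<in> polynomial_functions {1..k}"
    by (rule pf.poly_family_coeff[OF H])
  have num: "num \<in> polynomial_functions {1..k}" unfolding num_def[abs_def]
    by (intro pf.diff pf.mult Hj \<eta> polynomial_functions_flip[OF Hj] polynomial_functions_flip[OF \<eta>])
  have den: "den \<in> polynomial_functions {1..k}" unfolding den_def[abs_def]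
    by (intro pf.mult \<eta> polynomial_functions_flip)
  obtain e1 d1 where e1: "leading k num e1 d1"
    using polynomial_function_leading[OF num, of w] neq by (auto simp: num_def)
  obtain e2 d2 where e2: "leading k den e2 d2"
    using polynomial_function_leading[OF den, of w] good[OF W(2)] by (auto simp: den_def)
  have "sign_power k \<epsilon> e1 = - 1"
    by (rule leading_flip[OF e1 \<epsilon>(1)]) (simp add: num_def flip_flip[OF \<epsilon>(1)])
  then have odd1: "odd (pairing k l' e1)" by (auto simp: \<epsilon>_def sign_power_parity split: if_splits)
  have "sign_power k \<epsilon> e2 = 1"
    by (rule leading_flip[OF e2 \<epsilon>(1)]) (simp add: den_def flip_flip[OF \<epsilon>(1)])
  then have even2: "even (pairing k l' e2)" by (auto simp: \<epsilon>_def sign_power_parity split: if_splits)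
  define f where "f v = num v * inverse (den v)" for v
  define e0 where "e0 i = e1 i + - e2 i" for i
  have f: "leading k f e0 (d1 * inverse d2)"
    using leading_mult[OF e1 leading_inverse[OF e2]] by (simp add: f_def[abs_def] e0_def[abs_def])
  have "odd (pairing k l' e0)" unfolding e0_def[abs_def] pairing_add pairing_minus using odd1 even2 by simp
  then have e0: "pairing k l' e0 \<noteq> 0" by auto
  interpret C: function_algebra coefficients by (rule coefficients_algebra)
  \<comment> \<open>Which roots make up the two divisors may vary with \<open>v\<close>, so all
    pairs of index sets are treated together and \<open>R\<close> is the product of their
    equations.\<close>
  define Z where "Z = Pow {..<m} \<times> Pow {..<m}"
  define \<Phi> where "\<Phi> z s = coeff (\<Prod>i\<in>fst z. [:- s i, 1:]) j - coeff (\<Prod>i\<in>snd z. [:- s i, 1:]) j"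
    for z :: "nat set \<times> nat set" and s :: "nat \<Rightarrow> complex"
  have ex: "\<exists>hD. C.poly_family (fst hD) \<and> (\<forall>x. degree (fst hD x) = snd hD) \<and> (\<forall>x. lead_coeff (fst hD x) = 1) \<and>
    (\<forall>x s. equation x = (\<Prod>i<m. [:- s i, 1:]) \<longrightarrow> poly (fst hD x) (\<Phi> z s) = 0)" if z: "z \<in> Z" for z
  proof -
    have "(\<lambda>s. coeff (\<Prod>i\<in>K. [:- s i, 1:]) j) \<in> polynomial_functions {..<m}" if "K \<subseteq> {..<m}" for K
      by (rule pf.poly_family_coeff)
         (intro pf.poly_family_prod pf.poly_family_linear
            polynomial_functions.coord, use that in auto)
    then have \<Phi>: "\<Phi> z \<in> polynomial_functions {..<m}" unfolding \<Phi>_def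
      by (intro pf.diff) (use z in \<open>auto simp: Z_def\<close>)
    obtain h D where "C.poly_family h" "\<And>x. degree (h x) = D" "\<And>x. lead_coeff (h x) = 1"
      "\<And>x s. equation x = (\<Prod>i<m. [:- s i, 1:]) \<Longrightarrow> poly (h x) (\<Phi> z s) = 0"
      by (rule C.root_polynomial_integral[OF equation_coefficients \<Phi>]) (rule that)
    then show ?thesis by (intro exI[of _ "(h, D)"]) simp
  qed
  from bchoice[OF ballI[OF ex]] obtain hD where hD: "\<forall>z\<in>Z. C.poly_family (fst (hD z)) \<and>
    (\<forall>x. degree (fst (hD z) x) = snd (hD z)) \<and> (\<forall>x. lead_coeff (fst (hD z) x) = 1) \<and>
    (\<forall>x s. equation x = (\<Prod>i<m. [:- s i, 1:]) \<longrightarrow> poly (fst (hD z) x) (\<Phi> z s) = 0)" ..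
  define R where "R v = (\<Prod>z\<in>Z. fst (hD z) v)" for v
  define \<Delta> where "\<Delta> = (\<Sum>z\<in>Z. snd (hD z))"
  have finZ: "finite Z" by (simp add: Z_def)
  have R_fam: "C.poly_family R" unfolding R_def[abs_def] using hD by (intro C.poly_family_prod) auto
  have R_lead: "lead_coeff (R v) = 1" for v unfolding R_def lead_coeff_prod by (rule prod.neutral) (use hD in blast)
  have R_deg: "degree (R v) = \<Delta>" for v
  proof -
    have "fst (hD z) v \<noteq> 0" if "z \<in> Z" for z
    proof -
      have "lead_coeff (fst (hD z) v) = 1" using hD that by blast
      then show ?thesis by auto
    qed
    then have "degree (R v) = (\<Sum>z\<in>Z. degree (fst (hD z) v))" unfolding R_def
      by (rule degree_prod_sum_eq)
    then show ?thesis using hD by (simp add: \<Delta>_def)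
  qed
  have R_root: "poly (R v) (f v) = 0" if v: "W v \<noteq> 0" for v
  proof -
    obtain s where s: "equation v = (\<Prod>i<m. [:- s i, 1:])"
      using monic_splits[OF degree_equation(2)[of v]] by (auto simp: degree_equation(1))
    obtain K where K: "K \<subseteq> {..<m}" "smult (inverse (\<eta> v)) (H v) = (\<Prod>i\<in>K. [:- s i, 1:])"
      using monic_dvd_prod_linear[OF _ dvd(1)[OF v, unfolded s] monic(1)[OF v]] by auto
    obtain K' where K': "K' \<subseteq> {..<m}" "smult (inverse (\<eta> (flip \<epsilon> v))) (H (flip \<epsilon> v)) = (\<Prod>i\<in>K'. [:- s i, 1:])"
      using monic_dvd_prod_linear[OF _ dvd(2)[OF v, unfolded s] monic(2)[OF v]] by auto
    have z: "(K, K') \<in> Z" using K K' by (simp add: Z_def)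
    have "\<Phi> (K, K') s = f v"
      unfolding \<Phi>_def fst_conv snd_conv K(2)[symmetric] K'(2)[symmetric] f_def num_def den_def
      using good[OF v] by (simp add: field_simps)
    then have "poly (fst (hD (K, K')) v) (f v) = 0" using hD z s by metis
    then show ?thesis unfolding R_def poly_prod using z finZ by (auto intro!: prod_zero)
  qed
  define trm where "trm i v = coeff (R v) i * f v ^ i" for i v
  have coeff_lead: "(\<forall>v. G v \<noteq> 0 \<longrightarrow> coeff (R v) i = 0) \<or> (\<exists>e d. leading k (\<lambda>v. coeff (R v) i) e d \<and> pairing k l' e = 0)" for i
    by (rule coefficients_leading[OF _ C.poly_family_coeff[OF R_fam]]) (rule neutral)
  have trm_lead: "(\<forall>v. G v \<noteq> 0 \<longrightarrow> trm i v = 0) \<or> (\<exists>e d. leading k (trm i) e d \<and> pairing k l' e = int i * pairing k l' e0)" for i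
  proof (cases "\<forall>v. G v \<noteq> 0 \<longrightarrow> coeff (R v) i = 0")
    case True
    then show ?thesis by (simp add: trm_def)
  next
    case False
    then obtain e d where e: "leading k (\<lambda>v. coeff (R v) i) e d" "pairing k l' e = 0" using coeff_lead by blast
    have "leading k (trm i) (\<lambda>j. e j + int i * e0 j) (d * (d1 * inverse d2) ^ i)"
      using leading_mult[OF e(1) leading_power[OF f, of i]] by (simp add: trm_def[abs_def])
    then show ?thesis using e(2) by (intro disjI2 exI conjI) (auto simp: pairing_add pairing_scale)
  qed
  have trm_exp: "pairing k l' e = int i * pairing k l' e0" if e: "leading k (trm i) e d" for i e d
    using trm_lead[of i] leading_not_zero[OF e] leading_pairing_unique[OF e] by metis
  \<comment> \<open>\<open>R\<close> is monic, so its top term is a power of \<open>f\<close> and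
    certainly has a leading exponent.\<close>
  have top: "leading k (trm \<Delta>) (\<lambda>i. int \<Delta> * e0 i) ((d1 * inverse d2) ^ \<Delta>)"
  proof -
    have "trm \<Delta> = (\<lambda>v. f v ^ \<Delta>)" using R_lead unfolding R_deg by (simp add: trm_def fun_eq_iff)
    then show ?thesis using leading_power[OF f, of \<Delta>] by simp
  qed
  have "\<forall>\<^sub>F \<zeta> in at_top. W (curve \<zeta>) \<noteq> 0" using eventually_curve_nonzero[OF W one_signs] by simp
  then have zero: "\<forall>\<^sub>F \<zeta> in at_top. (\<Sum>i\<in>{..\<Delta>}. trm i (curve \<zeta>)) = 0"
    by (rule eventually_mono) (use R_root R_deg in \<open>simp add: trm_def poly_altdef\<close>)
  have "\<forall>\<^sub>F \<zeta> in at_top. G (curve \<zeta>) \<noteq> 0" using eventually_curve_nonzero[OF G one_signs] by simp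
  then have dich: "(\<forall>\<^sub>F \<zeta> in at_top. trm i (curve \<zeta>) = 0) \<or> (\<exists>e d. leading k (trm i) e d)" for i
    using trm_lead[of i] by (auto elim: eventually_mono)
  obtain i i' e d e' d' where "i \<noteq> i'" "leading k (trm i) e d" "leading k (trm i') e' d'" "\<forall>j\<in>{1..k}. e j = e' j"
    using leading_sum_zero[OF _ _ top dich zero] by auto
  moreover from this have "pairing k l' e = pairing k l' e'" by (intro pairing_cong) auto
  ultimately have "int i * pairing k l' e0 = int i' * pairing k l' e0" using trm_exp by metis
  then show False using e0 \<open>i \<noteq> i'\<close> by simp
qed

theorem relations_chain:
  "\<exists>P. P k = relations \<and> (\<forall>i\<le>k. pf.prime_ideal {1..N} (P i)) \<and> (\<forall>i<k. P (Suc i) \<subset> P i)"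
  by (rule chain_or_orthogonal[OF not_orthogonal])

end

section \<open>Regular functions on affine space and on its product with the line\<close>

text \<open>By definition the nonvanishing loci are only a subbase; products of members of
  \<open>A\<close> give their intersections, so they form a base.\<close>

lemma openin_space_of_algebra:
  assumes A: "function_algebra A" and U: "openin (zariski (space_of_algebra S A)) U" "x \<in> U"
  shows "x \<in> S" "\<exists>g\<in>A. g x \<noteq> 0 \<and> {x \<in> S. g x \<noteq> 0} \<subseteq> U"
proof -
  interpret function_algebra A by fact
  have "generate_topology_on ((\<lambda>a. {x \<in> S. a x \<noteq> 0}) ` A) U"
    using U(1) by (simp add: space_of_algebra_def Let_def openin_topology_generated_by)
  then have "\<forall>x\<in>U. x \<in> S \<and> (\<exists>g\<in>A. g x \<noteq> 0 \<and> {x \<in> S. g x \<noteq> 0} \<subseteq> U)"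
  proof (induction rule: generate_topology_on.induct)
    case (Int a b)
    show ?case
    proof
      fix x assume x: "x \<in> a \<inter> b"
      obtain g h where g: "g \<in> A" "g x \<noteq> 0" "{x \<in> S. g x \<noteq> 0} \<subseteq> a" and h: "h \<in> A" "h x \<noteq> 0" "{x \<in> S. h x \<noteq> 0} \<subseteq> b"
        using Int.IH x by blast
      have "\<exists>g\<in>A. g x \<noteq> 0 \<and> {x \<in> S. g x \<noteq> 0} \<subseteq> a \<inter> b"
        by (rule bexI[of _ "\<lambda>x. g x * h x"]) (use g h in \<open>auto intro: mult\<close>)
      then show "x \<in> S \<and> (\<exists>g\<in>A. g x \<noteq> 0 \<and> {x \<in> S. g x \<noteq> 0} \<subseteq> a \<inter> b)" using Int.IH x by blast
    qed
  next
    case (UN K)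
    show ?case
    proof
      fix x assume "x \<in> \<Union>K"
      then obtain k where k: "k \<in> K" "x \<in> k" by blast
      then have "x \<in> S \<and> (\<exists>g\<in>A. g x \<noteq> 0 \<and> {x \<in> S. g x \<noteq> 0} \<subseteq> k)" using UN.IH by blast
      then show "x \<in> S \<and> (\<exists>g\<in>A. g x \<noteq> 0 \<and> {x \<in> S. g x \<noteq> 0} \<subseteq> \<Union>K)" using k(1) by blast
    qed
  qed auto
  then show "x \<in> S" "\<exists>g\<in>A. g x \<noteq> 0 \<and> {x \<in> S. g x \<noteq> 0} \<subseteq> U" using U(2) by auto
qed

lemma openin_nonzero_locus: "g \<in> A \<Longrightarrow> openin (zariski (space_of_algebra S A)) {x \<in> S. g x \<noteq> 0}"
  by (auto simp: space_of_algebra_def Let_def intro!: topology_generated_by_Basis)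

lemma points_space_of_algebra: "function_algebra A \<Longrightarrow> points (space_of_algebra S A) = S"
proof -
  assume "function_algebra A"
  then interpret function_algebra A .
  show ?thesis
    using openin_nonzero_locus[OF const[of 1], of S] openin_space_of_algebra(1)[OF function_algebra_axioms openin_topspace, of _ S]
    by (auto dest: openin_subset)
qed

text \<open>Fractions over \<open>A\<close> defined near \<open>x\<close>, as functions and not as
  germs: off the nonvanishing locus of \<open>g\<close> nothing is required.\<close>

definition local_quotients :: "'a set \<Rightarrow> ('a \<Rightarrow> complex) set \<Rightarrow> 'a \<Rightarrow> ('a \<Rightarrow> complex) set"
  where "local_quotients S A x = {f. \<exists>g\<in>A. \<exists>a\<in>A. \<exists>b\<in>A. g x \<noteq> 0 \<and>
    (\<forall>s\<in>S. g s \<noteq> 0 \<longrightarrow> b s \<noteq> 0 \<and> f s = a s / b s)}"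

lemma local_quotientsE:
  assumes "f \<in> local_quotients S A x"
  obtains g a b where "g \<in> A" "a \<in> A" "b \<in> A" "g x \<noteq> 0"
    "\<And>s. s \<in> S \<Longrightarrow> g s \<noteq> 0 \<Longrightarrow> b s \<noteq> 0 \<and> f s = a s / b s"
  using assms unfolding local_quotients_def by blast

lemma local_quotientsI:
  assumes "g \<in> A" "a \<in> A" "b \<in> A" "g x \<noteq> 0"
    "\<And>s. s \<in> S \<Longrightarrow> g s \<noteq> 0 \<Longrightarrow> b s \<noteq> 0 \<and> f s = a s / b s"
  shows "f \<in> local_quotients S A x"
  using assms unfolding local_quotients_def by blast

context function_algebra
begin

lemma local_quotients_base: "f \<in> A \<Longrightarrow> f \<in> local_quotients S A x"
  by (rule local_quotientsI[of "\<lambda>_. 1" _ f "\<lambda>_. 1"]) (auto intro: const)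

lemma local_quotients_algebra: "function_algebra (local_quotients S A x)"
proof
  show "(\<lambda>_. c) \<in> local_quotients S A x" for c by (intro local_quotients_base const)
  fix f f' assume "f \<in> local_quotients S A x" "f' \<in> local_quotients S A x"
  then obtain g a b g' a' b' where g: "g \<in> A" "a \<in> A" "b \<in> A" "g x \<noteq> 0"
      "\<And>s. s \<in> S \<Longrightarrow> g s \<noteq> 0 \<Longrightarrow> b s \<noteq> 0 \<and> f s = a s / b s"
    and g': "g' \<in> A" "a' \<in> A" "b' \<in> A" "g' x \<noteq> 0"
      "\<And>s. s \<in> S \<Longrightarrow> g' s \<noteq> 0 \<Longrightarrow> b' s \<noteq> 0 \<and> f' s = a' s / b' s"
    by (metis local_quotientsE)
  show "(\<lambda>s. f s + f' s) \<in> local_quotients S A x"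
    by (rule local_quotientsI[of "\<lambda>s. g s * g' s" _ "\<lambda>s. a s * b' s + a' s * b s" "\<lambda>s. b s * b' s"])
       (use g g' in \<open>auto intro: add mult simp: add_frac_eq\<close>)
  show "(\<lambda>s. f s * f' s) \<in> local_quotients S A x"
    by (rule local_quotientsI[of "\<lambda>s. g s * g' s" _ "\<lambda>s. a s * a' s" "\<lambda>s. b s * b' s"])
       (use g g' in \<open>auto intro: add mult\<close>)
qed

lemma local_quotients_cong:
  assumes f: "f \<in> local_quotients S A x" and h: "h \<in> A" "h x \<noteq> 0" "\<And>s. s \<in> S \<Longrightarrow> h s \<noteq> 0 \<Longrightarrow> f' s = f s"
  shows "f' \<in> local_quotients S A x"
proof -
  obtain g a b where g: "g \<in> A" "a \<in> A" "b \<in> A" "g x \<noteq> 0"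
      "\<And>s. s \<in> S \<Longrightarrow> g s \<noteq> 0 \<Longrightarrow> b s \<noteq> 0 \<and> f s = a s / b s"
    using f by (rule local_quotientsE) blast
  then show ?thesis
    by (intro local_quotientsI[of "\<lambda>s. g s * h s" _ a b]) (use h in \<open>auto intro: mult\<close>)
qed

lemma local_quotients_inverse:
  assumes f: "f \<in> local_quotients S A x" and x: "x \<in> S" "f x \<noteq> 0"
  shows "(\<lambda>s. inverse (f s)) \<in> local_quotients S A x"
proof -
  obtain g a b where g: "g \<in> A" "a \<in> A" "b \<in> A" "g x \<noteq> 0"
      "\<And>s. s \<in> S \<Longrightarrow> g s \<noteq> 0 \<Longrightarrow> b s \<noteq> 0 \<and> f s = a s / b s"
    using f by (rule local_quotientsE) blast
  then show ?thesis
    by (intro local_quotientsI[of "\<lambda>s. g s * a s" _ b a]) (use x g(5)[OF x(1)] in \<open>auto intro: mult\<close>)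
qed

lemma local_quotients_nonzero:
  assumes f: "f \<in> local_quotients S A x" and x: "x \<in> S" "f x \<noteq> 0"
  obtains h where "h \<in> A" "h x \<noteq> 0" "\<And>s. s \<in> S \<Longrightarrow> h s \<noteq> 0 \<Longrightarrow> f s \<noteq> 0"
proof -
  obtain g a b where g: "g \<in> A" "a \<in> A" "b \<in> A" "g x \<noteq> 0"
      "\<And>s. s \<in> S \<Longrightarrow> g s \<noteq> 0 \<Longrightarrow> b s \<noteq> 0 \<and> f s = a s / b s"
    using f by (rule local_quotientsE) blast
  show thesis
    by (rule that[of "\<lambda>s. g s * a s"]) (use g x g(5)[OF x(1)] in \<open>auto intro: mult\<close>)
qed

lemma regular_space_of_algebra:
  assumes f: "f \<in> regular (space_of_algebra S A) U" and x: "x \<in> U"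
  shows "f \<in> local_quotients S A x"
proof -
  have "\<exists>W a b. openin (zariski (space_of_algebra S A)) W \<and> x \<in> W \<and> W \<subseteq> U \<and> a \<in> A \<and> b \<in> A \<and>
    (\<forall>y\<in>W. b y \<noteq> 0 \<and> f y = a y / b y)"
    using f x by (simp add: space_of_algebra_def Let_def)
  then obtain W a b where W: "openin (zariski (space_of_algebra S A)) W" "x \<in> W" "W \<subseteq> U" "a \<in> A" "b \<in> A"
    "\<forall>y\<in>W. b y \<noteq> 0 \<and> f y = a y / b y"
    by blast
  obtain g where g: "g \<in> A" "g x \<noteq> 0" "{x \<in> S. g x \<noteq> 0} \<subseteq> W"
    using openin_space_of_algebra(2)[OF function_algebra_axioms W(1,2)] by blast
  show ?thesis by (rule local_quotientsI[of g _ a b]) (use g W in auto)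
qed

end

lemma affine_points: "points (affine_space n) = {1..n} \<rightarrow>\<^sub>E UNIV"
  unfolding affine_space_def by (rule points_space_of_algebra) (rule pf.function_algebra_axioms)

lemma poly_algebra: "function_algebra (range (poly :: complex poly \<Rightarrow> _))"
proof
  show "(\<lambda>_. c) \<in> range poly" for c :: complex by (rule range_eqI[of _ _ "[:c:]"]) (simp add: fun_eq_iff)
  fix f g :: "complex \<Rightarrow> complex" assume "f \<in> range poly" "g \<in> range poly"
  then obtain p q where "f = poly p" "g = poly q" by blast
  then have "(\<lambda>x. f x + g x) = poly (p + q)" "(\<lambda>x. f x * g x) = poly (p * q)" by (simp_all add: fun_eq_iff)
  then show "(\<lambda>x. f x + g x) \<in> range poly" "(\<lambda>x. f x * g x) \<in> range poly" by blast+
qed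

lemma line_points: "points affine_line = UNIV"
  unfolding affine_line_def by (rule points_space_of_algebra) (rule poly_algebra)

text \<open>The coordinate ring of affine \<open>n\<close>-space times the line, written as
  polynomials in \<open>t\<close> over polynomial functions of \<open>x\<close>, the form to which
  the pseudo-gcd applies.\<close>

definition product_functions :: "nat \<Rightarrow> ((nat \<Rightarrow> complex) \<times> complex \<Rightarrow> complex) set"
  where "product_functions n = {\<lambda>(x, t). poly (F x) t | F. polynomial_family {1..n} F}"

lemma polynomial_family_const_coeff: "f \<in> polynomial_functions I \<Longrightarrow> polynomial_family I (\<lambda>x. [:f x:])"
  by (auto simp: polynomial_family_def intro: pf.poly_family_const_coeff)

lemma polynomial_family_const: "polynomial_family I (\<lambda>_. p)"
  by (auto simp: polynomial_family_def intro: pf.poly_family_const)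

lemma polynomial_family_add:
  assumes "polynomial_family I F" "polynomial_family I G"
  shows "polynomial_family I (\<lambda>x. F x + G x)"
proof -
  obtain m n where "\<And>x. degree (F x) \<le> m" "\<And>x. degree (G x) \<le> n"
    using assms by (auto simp: polynomial_family_def)
  then have "degree (F x + G x) \<le> max m n" for x
    using degree_add_le_max[of "F x" "G x"] by (meson le_max_iff_disj max.mono order_trans)
  then show ?thesis using assms pf.poly_family_add by (auto simp: polynomial_family_def)
qed

lemma polynomial_family_mult:
  assumes "polynomial_family I F" "polynomial_family I G"
  shows "polynomial_family I (\<lambda>x. F x * G x)"
proof -
  obtain m n where "\<And>x. degree (F x) \<le> m" "\<And>x. degree (G x) \<le> n"
    using assms by (auto simp: polynomial_family_def)
  then have "degree (F x * G x) \<le> m + n" for x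
    using degree_mult_le[of "F x" "G x"] by (meson add_mono order_trans)
  then show ?thesis using assms pf.poly_family_mult by (auto simp: polynomial_family_def)
qed

lemma product_functions_algebra: "function_algebra (product_functions n)"
proof
  show "(\<lambda>_. c) \<in> product_functions n" for c unfolding product_functions_def
    by (intro CollectI exI[of _ "\<lambda>_. [:c:]"] conjI polynomial_family_const) (simp add: case_prod_unfold)
  fix f g assume "f \<in> product_functions n" "g \<in> product_functions n"
  then obtain F G where F: "polynomial_family {1..n} F" "f = (\<lambda>(x, t). poly (F x) t)"
    and G: "polynomial_family {1..n} G" "g = (\<lambda>(x, t). poly (G x) t)"
    unfolding product_functions_def by blast
  show "(\<lambda>x. f x + g x) \<in> product_functions n" unfolding product_functions_def
    by (intro CollectI exI[of _ "\<lambda>x. F x + G x"] conjI polynomial_family_add F(1) G(1))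
       (simp add: F(2) G(2) case_prod_unfold)
  show "(\<lambda>x. f x * g x) \<in> product_functions n" unfolding product_functions_def
    by (intro CollectI exI[of _ "\<lambda>x. F x * G x"] conjI polynomial_family_mult F(1) G(1))
       (simp add: F(2) G(2) case_prod_unfold)
qed

lemma product_functions_fst: "f \<in> polynomial_functions {1..n} \<Longrightarrow> (\<lambda>s. f (fst s)) \<in> product_functions n"
  unfolding product_functions_def
  by (intro CollectI exI[of _ "\<lambda>x. [:f x:]"]) (auto intro: polynomial_family_const_coeff)

lemma product_functions_snd: "(\<lambda>s. poly p (snd s)) \<in> product_functions n"
  unfolding product_functions_def
  by (intro CollectI exI[of _ "\<lambda>_. p"]) (auto intro: polynomial_family_const)

text \<open>Coordinates of affine space are numbered from 1, so that slot 0 is free for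
  \<open>t\<close>.\<close>

lemma product_functions_polynomial:
  assumes "h \<in> product_functions n"
  obtains f where "f \<in> polynomial_functions {0..n}" "\<And>x t. h (x, t) = f (x(0 := t))"
proof -
  obtain F where F: "polynomial_family {1..n} F" "h = (\<lambda>(x, t). poly (F x) t)"
    using assms unfolding product_functions_def by blast
  obtain m where m: "\<And>x. degree (F x) \<le> m" using F(1) by (auto simp: polynomial_family_def)
  have co: "(\<lambda>x. coeff (F x) j) \<in> polynomial_functions {1..n}" for j
    using F(1) by (auto simp: polynomial_family_def intro: pf.poly_family_coeff)
  show thesis
  proof
    show "(\<lambda>v. \<Sum>j\<le>m. coeff (F v) j * v 0 ^ j) \<in> polynomial_functions {0..n}"
      by (intro pf.sum pf.mult pf.power
          polynomial_functions.coord polynomial_functions_mono[OF co]) auto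
    fix x t
    have "poly (F x) t = (\<Sum>j\<le>m. coeff (F x) j * t ^ j)"
      unfolding poly_altdef using m[of x] by (intro sum.mono_neutral_left) (auto simp: coeff_eq_0)
    moreover have "coeff (F (x(0 := t))) j = coeff (F x) j" for j
      by (rule polynomial_functions_restrict[OF co]) auto
    ultimately show "h (x, t) = (\<Sum>j\<le>m. coeff (F (x(0 := t))) j * (x(0 := t)) 0 ^ j)"
      by (simp add: F(2))
  qed
qed

lemma product_functions_nonzero_mult:
  assumes f: "f \<in> product_functions n" "f p \<noteq> 0" and g: "g \<in> product_functions n" "g q \<noteq> 0"
  obtains x t where "x \<in> points (affine_space n)" "f (x, t) \<noteq> 0" "g (x, t) \<noteq> 0"
proof -
  obtain f' where f': "f' \<in> polynomial_functions {0..n}" "\<And>x t. f (x, t) = f' (x(0 := t))"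
    using product_functions_polynomial[OF f(1)] by blast
  obtain g' where g': "g' \<in> polynomial_functions {0..n}" "\<And>x t. g (x, t) = g' (x(0 := t))"
    using product_functions_polynomial[OF g(1)] by blast
  obtain v where v: "f' v \<noteq> 0" "g' v \<noteq> 0"
    using polynomial_functions_no_zero_divisors[OF f'(1) g'(1)] f(2) g(2) f'(2) g'(2) by (metis surj_pair)
  have "f' ((restrict v {1..n})(0 := v 0)) = f' v" "g' ((restrict v {1..n})(0 := v 0)) = g' v"
    by (rule polynomial_functions_restrict[OF f'(1)], force, rule polynomial_functions_restrict[OF g'(1)], force)
  then show thesis using v by (intro that[of "restrict v {1..n}" "v 0"]) (auto simp: f'(2) g'(2) affine_points)
qed

text \<open>Factors depending on one of the two variables are local fractions, and these are closed
  under sums and products.\<close>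

lemma tensor_local_quotients:
  assumes h: "h \<in> tensor_functions (affine_space n) affine_line U V" and q: "fst q \<in> U" "snd q \<in> V"
  shows "h \<in> local_quotients (points (affine_space n) \<times> UNIV) (product_functions n) q"
proof -
  interpret P: function_algebra "product_functions n" by (rule product_functions_algebra)
  interpret L: function_algebra "local_quotients (points (affine_space n) \<times> UNIV) (product_functions n) q"
    by (rule P.local_quotients_algebra)
  have fst: "(\<lambda>s. f (fst s)) \<in> local_quotients (points (affine_space n) \<times> UNIV) (product_functions n) q"
    if f: "f \<in> regular (affine_space n) U" for f
  proof -
    have "f \<in> local_quotients ({1..n} \<rightarrow>\<^sub>E UNIV) (polynomial_functions {1..n}) (fst q)"
      by (rule pf.regular_space_of_algebra) (use f q in \<open>simp_all add: affine_space_def\<close>)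
    then obtain g a b where g: "g \<in> polynomial_functions {1..n}" "a \<in> polynomial_functions {1..n}"
      "b \<in> polynomial_functions {1..n}" "g (fst q) \<noteq> 0"
      "\<And>s. s \<in> {1..n} \<rightarrow>\<^sub>E UNIV \<Longrightarrow> g s \<noteq> 0 \<Longrightarrow> b s \<noteq> 0 \<and> f s = a s / b s"
      by (rule local_quotientsE) blast
    show ?thesis
      by (rule local_quotientsI[of "\<lambda>s. g (fst s)" _ "\<lambda>s. a (fst s)" "\<lambda>s. b (fst s)"])
         (use g in \<open>auto intro: product_functions_fst simp: affine_points\<close>)
  qed
  have snd: "(\<lambda>s. f (snd s)) \<in> local_quotients (points (affine_space n) \<times> UNIV) (product_functions n) q"
    if f: "f \<in> regular affine_line V" for f
  proof -
    have "f \<in> local_quotients UNIV (range poly) (snd q)"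
      by (rule function_algebra.regular_space_of_algebra[OF poly_algebra]) (use f q in \<open>simp_all add: affine_line_def\<close>)
    then obtain g a b where g: "g \<in> range poly" "a \<in> range poly" "b \<in> range poly" "g (snd q) \<noteq> 0"
      "\<And>s. g s \<noteq> 0 \<Longrightarrow> b s \<noteq> 0 \<and> f s = a s / b s"
      by (rule local_quotientsE) blast
    show ?thesis
      by (rule local_quotientsI[of "\<lambda>s. g (snd s)" _ "\<lambda>s. a (snd s)" "\<lambda>s. b (snd s)"])
         (use g in \<open>auto intro: product_functions_snd\<close>)
  qed
  obtain k :: nat and f g where fg: "\<And>i. i < k \<Longrightarrow> f i \<in> regular (affine_space n) U \<and> g i \<in> regular affine_line V"
    "h = (\<lambda>(x, y). \<Sum>i<k. f i x * g i y)"
    using h unfolding tensor_functions_def by blast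
  have "(\<lambda>s. \<Sum>i<k. f i (fst s) * g i (snd s)) \<in> local_quotients (points (affine_space n) \<times> UNIV) (product_functions n) q"
    by (intro L.sum L.mult fst snd) (use fg(1) in auto)
  then show ?thesis unfolding fg(2) by (simp add: case_prod_unfold)
qed

lemma zariski_product_space: "zariski (product_space X Y) = product_zariski X Y"
  by (simp add: product_space_def)

text \<open>As for affine space, products give intersections of loci; a basic open set contains a
  locus around each of its points because tensors are local fractions.\<close>

lemma openin_product_affine:
  assumes "openin (product_zariski (affine_space n) affine_line) W" "q \<in> W"
  shows "fst q \<in> points (affine_space n)"
    "\<exists>g\<in>product_functions n. g q \<noteq> 0 \<and> {s \<in> points (affine_space n) \<times> UNIV. g s \<noteq> 0} \<subseteq> W"
proof -
  interpret P: function_algebra "product_functions n" by (rule product_functions_algebra)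
  let ?S = "points (affine_space n) \<times> UNIV"
  have "generate_topology_on {{q \<in> U \<times> V. h q \<noteq> 0} | U V h.
      openin (zariski (affine_space n)) U \<and> openin (zariski affine_line) V \<and>
      h \<in> tensor_functions (affine_space n) affine_line U V} W"
    using assms(1) unfolding product_zariski_def by (rule openin_topology_generated_by)
  then have "\<forall>q\<in>W. q \<in> ?S \<and> (\<exists>g\<in>product_functions n. g q \<noteq> 0 \<and> {s \<in> ?S. g s \<noteq> 0} \<subseteq> W)"
  proof (induction rule: generate_topology_on.induct)
    case (Int a b)
    show ?case
    proof
      fix x assume x: "x \<in> a \<inter> b"
      obtain g h where g: "g \<in> product_functions n" "g x \<noteq> 0" "{x \<in> ?S. g x \<noteq> 0} \<subseteq> a"
        and h: "h \<in> product_functions n" "h x \<noteq> 0" "{x \<in> ?S. h x \<noteq> 0} \<subseteq> b"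
        using Int.IH x by blast
      have "\<exists>g\<in>product_functions n. g x \<noteq> 0 \<and> {x \<in> ?S. g x \<noteq> 0} \<subseteq> a \<inter> b"
        by (rule bexI[of _ "\<lambda>x. g x * h x"]) (use g h in \<open>auto intro: P.mult\<close>)
      then show "x \<in> ?S \<and> (\<exists>g\<in>product_functions n. g x \<noteq> 0 \<and> {x \<in> ?S. g x \<noteq> 0} \<subseteq> a \<inter> b)" using Int.IH x by blast
    qed
  next
    case (UN K)
    show ?case
    proof
      fix x assume "x \<in> \<Union>K"
      then obtain k where k: "k \<in> K" "x \<in> k" by blast
      then have "x \<in> ?S \<and> (\<exists>g\<in>product_functions n. g x \<noteq> 0 \<and> {x \<in> ?S. g x \<noteq> 0} \<subseteq> k)" using UN.IH by blast
      then show "x \<in> ?S \<and> (\<exists>g\<in>product_functions n. g x \<noteq> 0 \<and> {x \<in> ?S. g x \<noteq> 0} \<subseteq> \<Union>K)" using k(1) by blast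
    qed
  next
    case (Basis B)
    then obtain U V h where B: "B = {q \<in> U \<times> V. h q \<noteq> 0}" and U: "openin (zariski (affine_space n)) U"
      and V: "openin (zariski affine_line) V" and h: "h \<in> tensor_functions (affine_space n) affine_line U V" by blast
    show ?case
    proof
      fix q assume q: "q \<in> B"
      then have qUV: "fst q \<in> U" "snd q \<in> V" "h q \<noteq> 0" using B by auto
      have qS: "q \<in> ?S" using qUV(1) openin_subset[OF U] by (cases q) auto
      obtain g1 where g1: "g1 \<in> polynomial_functions {1..n}" "g1 (fst q) \<noteq> 0" "{x \<in> {1..n} \<rightarrow>\<^sub>E UNIV. g1 x \<noteq> 0} \<subseteq> U"
        using openin_space_of_algebra(2)[OF pf.function_algebra_axioms U[unfolded affine_space_def] qUV(1)]
        by blast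
      obtain g2 where g2: "g2 \<in> range poly" "g2 (snd q) \<noteq> 0" "{x \<in> UNIV. g2 x \<noteq> 0} \<subseteq> V"
        using openin_space_of_algebra(2)[OF poly_algebra V[unfolded affine_line_def] qUV(2)] by blast
      obtain g3 where g3: "g3 \<in> product_functions n" "g3 q \<noteq> 0" "\<And>s. s \<in> ?S \<Longrightarrow> g3 s \<noteq> 0 \<Longrightarrow> h s \<noteq> 0"
        using P.local_quotients_nonzero[OF tensor_local_quotients[OF h qUV(1,2)] qS qUV(3)] by blast
      have g2': "(\<lambda>s. g2 (snd s)) \<in> product_functions n" using g2(1) product_functions_snd by auto
      have "(\<lambda>s. g1 (fst s) * (g2 (snd s) * g3 s)) \<in> product_functions n"
        by (intro P.mult product_functions_fst g1 g2' g3)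
      moreover have "{s \<in> ?S. g1 (fst s) * (g2 (snd s) * g3 s) \<noteq> 0} \<subseteq> B"
        using g1(3) g2(3) g3(3) by (auto simp: B affine_points)
      ultimately show "q \<in> ?S \<and> (\<exists>g\<in>product_functions n. g q \<noteq> 0 \<and> {s \<in> ?S. g s \<noteq> 0} \<subseteq> B)"
        using qS g1(2) g2(2) g3(2) by (intro conjI bexI[of _ "\<lambda>s. g1 (fst s) * (g2 (snd s) * g3 s)"]) auto
    qed
  qed auto
  then show "fst q \<in> points (affine_space n)"
    "\<exists>g\<in>product_functions n. g q \<noteq> 0 \<and> {s \<in> ?S. g s \<noteq> 0} \<subseteq> W" using assms(2) by auto
qed

lemma regular_product_affine:
  assumes R: "R \<in> regular (product_space (affine_space n) affine_line) E" and q: "q \<in> E"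
  shows "R \<in> local_quotients (points (affine_space n) \<times> UNIV) (product_functions n) q"
proof -
  interpret P: function_algebra "product_functions n" by (rule product_functions_algebra)
  let ?S = "points (affine_space n) \<times> UNIV"
  interpret L: function_algebra "local_quotients ?S (product_functions n) q" by (rule P.local_quotients_algebra)
  have "\<forall>q\<in>E. \<exists>U V N a b. openin (zariski (affine_space n)) U \<and> openin (zariski affine_line) V \<and>
      openin (product_zariski (affine_space n) affine_line) N \<and> q \<in> N \<and> N \<subseteq> E \<inter> (U \<times> V) \<and>
      a \<in> tensor_functions (affine_space n) affine_line U V \<and> b \<in> tensor_functions (affine_space n) affine_line U V \<and>
      (\<forall>s\<in>N. b s \<noteq> 0 \<and> R s = a s / b s)"
    using R unfolding product_space_def fun_space.select_convs by (rule CollectD)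
  from bspec[OF this q] obtain U V N a b
    where N: "openin (product_zariski (affine_space n) affine_line) N" "q \<in> N" "N \<subseteq> E \<inter> (U \<times> V)"
    and ab: "a \<in> tensor_functions (affine_space n) affine_line U V" "b \<in> tensor_functions (affine_space n) affine_line U V"
    "\<forall>s\<in>N. b s \<noteq> 0 \<and> R s = a s / b s"
    by (elim exE conjE) (rule that)
  have q': "fst q \<in> U" "snd q \<in> V" "q \<in> ?S" using N openin_product_affine(1)[OF N(1,2)] by (cases q, auto)+
  obtain g where g: "g \<in> product_functions n" "g q \<noteq> 0" "{s \<in> ?S. g s \<noteq> 0} \<subseteq> N"
    using openin_product_affine(2)[OF N(1,2)] by blast
  have "(\<lambda>s. a s * inverse (b s)) \<in> local_quotients ?S (product_functions n) q"
    by (intro L.mult P.local_quotients_inverse tensor_local_quotients[OF ab(1) q'(1,2)]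
        tensor_local_quotients[OF ab(2) q'(1,2)] q'(3)) (use ab(3) N(2) in auto)
  then show ?thesis
    by (rule P.local_quotients_cong[OF _ g(1,2)]) (use g(3) ab(3) in \<open>auto simp: divide_inverse\<close>)
qed

text \<open>A local fraction for \<open>R\<close> at one point is reduced by the pseudo-gcd in
  \<open>t\<close>. The Bezout identity leaves \<open>a x\<close> and \<open>b x\<close> without
  common root for every single \<open>x\<close> with \<open>d x \<noteq> 0\<close>, and
  irreducibility of the product carries the fraction to all of \<open>E\<close> over this
  locus.\<close>

lemma rational_function_reduced:
  assumes "rational_function (product_space (affine_space n) affine_line) E R"
  obtains a b d x0 where "polynomial_family {1..n} a" "polynomial_family {1..n} b"
    "d \<in> polynomial_functions {1..n}" "x0 \<in> points (affine_space n)" "d x0 \<noteq> 0"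
    "\<And>x t. d x \<noteq> 0 \<Longrightarrow> poly (a x) t \<noteq> 0 \<or> poly (b x) t \<noteq> 0"
    "\<And>x t. d x \<noteq> 0 \<Longrightarrow> (x, t) \<in> E \<Longrightarrow> poly (a x) t = R (x, t) * poly (b x) t"
proof -
  interpret P: function_algebra "product_functions n" by (rule product_functions_algebra)
  let ?S = "points (affine_space n) \<times> UNIV"
  have E: "openin (product_zariski (affine_space n) affine_line) E" "E \<noteq> {}"
    and R: "R \<in> regular (product_space (affine_space n) affine_line) E"
    using assms unfolding rational_function_def zariski_product_space by blast+
  have inS: "q \<in> ?S" if "q \<in> E" for q using openin_product_affine(1)[OF E(1) that] by (cases q) auto
  obtain q0 where q0: "q0 \<in> E" using E(2) by blast
  obtain g0 a0 b0 where g0: "g0 \<in> product_functions n" "a0 \<in> product_functions n" "b0 \<in> product_functions n" "g0 q0 \<noteq> 0"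
    "\<And>s. s \<in> ?S \<Longrightarrow> g0 s \<noteq> 0 \<Longrightarrow> b0 s \<noteq> 0 \<and> R s = a0 s / b0 s"
    using regular_product_affine[OF R q0] by (rule local_quotientsE) blast
  obtain A where A: "polynomial_family {1..n} A" "a0 = (\<lambda>(x, t). poly (A x) t)"
    using g0(2) unfolding product_functions_def by blast
  obtain B where B: "polynomial_family {1..n} B" "b0 = (\<lambda>(x, t). poly (B x) t)"
    using g0(3) unfolding product_functions_def by blast
  have "B (fst q0) \<noteq> 0" using g0(5)[OF inS[OF q0] g0(4)] B(2) by (auto simp: case_prod_unfold)
  then obtain d H A' B' \<alpha> \<beta> M w0 where d: "d \<in> polynomial_functions {1..n}"
    and fam: "polynomial_family {1..n} H" "polynomial_family {1..n} A'" "polynomial_family {1..n} B'"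
    and HA: "\<And>v. smult (d v) (A v) = H v * A' v" and HB: "\<And>v. smult (d v) (B v) = H v * B' v"
    and bez: "\<And>v. \<alpha> v * A' v + \<beta> v * B' v = [:d v:]"
    and "\<And>v. degree (H v) \<le> M" and w0: "d w0 * coeff (H w0) M \<noteq> 0"
    by (rule pseudo_gcd_family[OF A(1) B(1)]) (rule that)
  define x0 where "x0 = restrict w0 {1..n}"
  have "d x0 = d w0" by (rule polynomial_functions_restrict[OF d]) (simp add: x0_def)
  then have dx0: "d x0 \<noteq> 0" using w0 by simp
  define h where "h = (\<lambda>(x, t). poly (H x) t)"
  define a' where "a' = (\<lambda>(x, t). poly (A' x) t)"
  define b' where "b' = (\<lambda>(x, t). poly (B' x) t)"
  have h: "h \<in> product_functions n" "a' \<in> product_functions n" "b' \<in> product_functions n"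
    unfolding product_functions_def h_def a'_def b'_def using fam by blast+
  have "H w0 \<noteq> 0" using w0 by auto
  then obtain t0 where "poly (H w0) t0 \<noteq> 0" using poly_all_0_iff_0 by blast
  then have h_nz: "h (w0, t0) \<noteq> 0" by (simp add: h_def)
  have Ha: "d (fst s) * a0 s = h s * a' s" for s
    using arg_cong[OF HA[of "fst s"], of "\<lambda>F. poly F (snd s)"] by (simp add: A(2) h_def a'_def case_prod_unfold)
  have Hb: "d (fst s) * b0 s = h s * b' s" for s
    using arg_cong[OF HB[of "fst s"], of "\<lambda>F. poly F (snd s)"] by (simp add: B(2) h_def b'_def case_prod_unfold)
  have coprime: "poly (A' x) t \<noteq> 0 \<or> poly (B' x) t \<noteq> 0" if "d x \<noteq> 0" for x t
    using arg_cong[OF bez[of x], of "\<lambda>F. poly F t"] that by auto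
  have "poly (A' x) t = R (x, t) * poly (B' x) t" if x: "d x \<noteq> 0" "(x, t) \<in> E" for x t
  proof -
    obtain g a b where g: "g \<in> product_functions n" "a \<in> product_functions n" "b \<in> product_functions n" "g (x, t) \<noteq> 0"
      "\<And>s. s \<in> ?S \<Longrightarrow> g s \<noteq> 0 \<Longrightarrow> b s \<noteq> 0 \<and> R s = a s / b s"
      using regular_product_affine[OF R x(2)] by (rule local_quotientsE) blast
    define \<delta> where "\<delta> s = a' s * b s - a s * b' s" for s
    have \<delta>: "\<delta> \<in> product_functions n" unfolding \<delta>_def[abs_def] by (intro P.diff P.mult g h)
    have "\<delta> (x, t) = 0"
    proof (rule ccontr)
      \<comment> \<open>The nonvanishing loci of \<open>g\<close>, \<open>g0\<close>,
        \<open>h\<close> and \<delta> would meet, at a point where both fractions represent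
        \<open>R\<close> and \<delta> must vanish.\<close>
      assume nz: "\<delta> (x, t) \<noteq> 0"
      obtain x1 t1 where 1: "x1 \<in> points (affine_space n)" "g (x1, t1) \<noteq> 0" "g0 (x1, t1) \<noteq> 0"
        using product_functions_nonzero_mult[OF g(1,4) g0(1,4)] by blast
      then have "g (x1, t1) * g0 (x1, t1) \<noteq> 0" by simp
      then obtain x2 t2 where 2: "x2 \<in> points (affine_space n)" "g (x2, t2) * g0 (x2, t2) \<noteq> 0" "h (x2, t2) \<noteq> 0"
        using product_functions_nonzero_mult[OF P.mult[OF g(1) g0(1)] _ h(1) h_nz] by blast
      then have "g (x2, t2) * g0 (x2, t2) * h (x2, t2) \<noteq> 0" by simp
      then obtain x3 t3 where 3: "x3 \<in> points (affine_space n)" "g (x3, t3) * g0 (x3, t3) * h (x3, t3) \<noteq> 0" "\<delta> (x3, t3) \<noteq> 0"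
        using product_functions_nonzero_mult[OF P.mult[OF P.mult[OF g(1) g0(1)] h(1)] _ \<delta> nz] by blast
      let ?s = "(x3, t3)"
      have s: "?s \<in> ?S" "g ?s \<noteq> 0" "g0 ?s \<noteq> 0" "h ?s \<noteq> 0" using 3 by auto
      have "a0 ?s * b ?s = a ?s * b0 ?s" using g0(5)[OF s(1,3)] g(5)[OF s(1,2)] by (auto simp: field_simps)
      moreover have "h ?s * a' ?s = d x3 * a0 ?s" "h ?s * b' ?s = d x3 * b0 ?s" using Ha[of ?s] Hb[of ?s] by simp_all
      moreover have "h ?s * \<delta> ?s = (h ?s * a' ?s) * b ?s - a ?s * (h ?s * b' ?s)" by (simp add: \<delta>_def algebra_simps)
      ultimately have "h ?s * \<delta> ?s = 0" by (simp add: mult.assoc mult.left_commute)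
      then show False using s(4) 3(3) by simp
    qed
    moreover have "b (x, t) \<noteq> 0 \<and> R (x, t) = a (x, t) / b (x, t)" using g(5)[OF inS[OF x(2)] g(4)] .
    ultimately show ?thesis by (auto simp: \<delta>_def a'_def b'_def field_simps)
  qed
  moreover have "x0 \<in> points (affine_space n)" by (simp add: x0_def affine_points PiE_iff)
  ultimately show thesis using that[OF fam(2,3) d _ dx0 coprime] by blast
qed

section \<open>Coverings, affine neighbourhoods and zero sets\<close>

context space_with_functions
begin

text \<open>Restriction to a smaller open set is the sheaf axiom for the cover of \<open>U\<close>
  by \<open>U\<close> and \<open>V\<close>.\<close>

lemma regular_restrict:
  assumes "openin (zariski X) U" "openin (zariski X) V" "V \<subseteq> U" "f \<in> regular X U"
  shows "f \<in> regular X V"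
  using regular_sheaf[of "{U, V}" f] assms by (auto simp: Un_absorb2)

lemma regular_function_algebra: "openin (zariski X) U \<Longrightarrow> function_algebra (regular X U)"
  by unfold_locales (auto intro: regular_const regular_add regular_mult)

lemma regular_open_subspace:
  assumes V: "openin (zariski X) V" and f: "f \<in> regular (subspace_of X S) V"
  shows "f \<in> regular X V"
proof -
  define \<U> where "\<U> = {U. openin (zariski X) U \<and> U \<subseteq> V \<and> f \<in> regular X U}"
  have "V \<subseteq> \<Union>\<U>"
  proof
    fix x assume x: "x \<in> V"
    then obtain W g where W: "openin (zariski X) W" "x \<in> W" "g \<in> regular X W" "\<forall>y\<in>W \<inter> V. f y = g y"
      using f unfolding subspace_of_def by auto
    have WV: "openin (zariski X) (W \<inter> V)" using W V by (simp add: openin_Int)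
    have "g \<in> regular X (W \<inter> V)" by (rule regular_restrict[OF W(1) WV _ W(3)]) simp
    then have "f \<in> regular X (W \<inter> V)" using regular_cong[OF WV, of g f] W(4) by auto
    then have "W \<inter> V \<in> \<U>" using WV by (simp add: \<U>_def)
    then show "x \<in> \<Union>\<U>" using x W(2) by blast
  qed
  then have eq: "\<Union>\<U> = V" by (auto simp: \<U>_def)
  have "f \<in> regular X (\<Union>\<U>)" using regular_sheaf[of \<U> f] by (auto simp: \<U>_def)
  then show ?thesis by (simp add: eq)
qed

end

lemma points_subspace_of: "points (subspace_of X S) = points X \<inter> S"
  by (simp add: subspace_of_def)

lemma openin_open_subspace:
  "openin (zariski X) S \<Longrightarrow> openin (zariski (subspace_of X S)) V \<longleftrightarrow> openin (zariski X) V \<and> V \<subseteq> S"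
  by (simp add: subspace_of_def openin_open_subtopology)

text \<open>Finiteness provides a \<open>V\<close> over which the functions on the preimage form a
  finitely generated module; multiplication by the value function acts on it, and the determinant
  trick yields the equation.\<close>

lemma values_integral:
  assumes Y: "space_with_functions Y" and w: "algebraic_function_over Y T w" and y0: "y0 \<in> T"
  obtains V H m where "openin (zariski Y) V" "y0 \<in> V"
    "\<And>j. (\<lambda>y. coeff (H y) j) \<in> regular Y V" "\<And>y. degree (H y) = m" "\<And>y. lead_coeff (H y) = 1"
    "\<And>y t. y \<in> V \<Longrightarrow> t \<in> values_at w y \<Longrightarrow> poly (H y) t = 0"
proof -
  interpret Y: space_with_functions Y by fact
  define X where "X = covering_space w"
  define p where "p = covering_map w"
  define z where "z = covering_value w"
  have T: "openin (zariski Y) T" "T \<subseteq> points Y"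
    using w by (auto simp: algebraic_function_over_def dest: openin_subset)
  have af: "variety X" "finite_morphism X (subspace_of Y T) p" "z \<in> regular X (points X)"
    using w by (auto simp: algebraic_function_over_def algebraic_function_def branched_covering_def X_def p_def z_def)
  interpret X: variety X by fact
  have y0': "y0 \<in> points (subspace_of Y T)" using y0 T by (auto simp: points_subspace_of)
  obtain V G where V: "openin (zariski (subspace_of Y T)) V" "y0 \<in> V"
    and G: "finite G" "G \<subseteq> regular X {x \<in> points X. p x \<in> V}"
    and gen: "\<forall>h\<in>regular X {x \<in> points X. p x \<in> V}. \<exists>c. (\<forall>g\<in>G. c g \<in> regular (subspace_of Y T) V) \<and>
            (\<forall>x\<in>{x \<in> points X. p x \<in> V}. h x = (\<Sum>g\<in>G. c g (p x) * g x))"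
    using af(2) y0' unfolding finite_morphism_def Let_def by blast
  define P where "P = {x \<in> points X. p x \<in> V}"
  note G = G[folded P_def] and gen = gen[folded P_def]
  have VY: "openin (zariski Y) V" using V(1) T(1) by (simp add: openin_open_subspace)
  have "continuous_map (zariski X) (zariski (subspace_of Y T)) p"
    using af(2) by (simp add: finite_morphism_def morphism_def)
  then have P: "openin (zariski X) P" unfolding P_def using V(1) by (rule openin_continuous_map_preimage)
  have zP: "z \<in> regular X P"
    by (rule X.regular_restrict[OF openin_topspace P _ af(3)]) (auto simp: P_def)
  interpret A: function_algebra "regular Y V" by (rule Y.regular_function_algebra[OF VY])
  have "\<forall>g\<in>G. \<exists>c. (\<forall>g'\<in>G. c g' \<in> regular Y V) \<and> (\<forall>x\<in>P. z x * g x = (\<Sum>g'\<in>G. c g' (p x) * g' x))"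
  proof
    fix g assume "g \<in> G"
    then have "(\<lambda>x. z x * g x) \<in> regular X P" using X.regular_mult[OF P zP] G(2) by auto
    from bspec[OF gen this] obtain c where "\<forall>g'\<in>G. c g' \<in> regular (subspace_of Y T) V"
      "\<forall>x\<in>P. z x * g x = (\<Sum>g'\<in>G. c g' (p x) * g' x)"
      by blast
    then show "\<exists>c. (\<forall>g'\<in>G. c g' \<in> regular Y V) \<and> (\<forall>x\<in>P. z x * g x = (\<Sum>g'\<in>G. c g' (p x) * g' x))"
      using Y.regular_open_subspace[OF VY] by blast
  qed
  from bchoice[OF this] obtain C where C: "\<forall>g\<in>G. (\<forall>g'\<in>G. C g g' \<in> regular Y V) \<and>
    (\<forall>x\<in>P. z x * g x = (\<Sum>g'\<in>G. C g g' (p x) * g' x))" ..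
  \<comment> \<open>The constant 1 is a combination of the generators, so these have no common
    zero.\<close>
  have nz: "\<exists>g\<in>G. g x \<noteq> 0" if x: "x \<in> P" for x
  proof (rule ccontr)
    assume "\<not> ?thesis"
    moreover from bspec[OF gen X.regular_const[OF P, of 1]]
    obtain c where "\<forall>x\<in>P. (1 :: complex) = (\<Sum>g\<in>G. c g (p x) * g x)"
      by blast
    moreover have "(\<Sum>g\<in>G. c g (p x) * g x) = 0" for c :: "_ \<Rightarrow> _ \<Rightarrow> complex"
      by (rule sum.neutral) (use \<open>\<not> (\<exists>g\<in>G. g x \<noteq> 0)\<close> in auto)
    moreover have "(1 :: complex) = (\<Sum>g\<in>G. c g (p x) * g x)" using calculation(2) x by blast
    ultimately show False by simp
  qed
  obtain H where H: "A.poly_family H" "\<And>x. degree (H x) = card G" "\<And>x. lead_coeff (H x) = 1"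
    "\<And>x. x \<in> P \<Longrightarrow> poly (H (p x)) (z x) = 0"
    by (rule A.integral_equation[of G C P z "\<lambda>g. g" p]) (use G(1) C nz in auto)
  show thesis
  proof
    show "(\<lambda>y. coeff (H y) j) \<in> regular Y V" for j by (rule A.poly_family_coeff[OF H(1)])
    show "poly (H y) t = 0" if "y \<in> V" "t \<in> values_at w y" for y t
      using that H(4) by (auto simp: values_at_def P_def X_def p_def z_def)
  qed (use VY V H in auto)
qed

lemma affine_neighbourhood:
  assumes "variety Y" "y0 \<in> points Y"
  obtains V N Z \<phi> \<psi> where "openin (zariski Y) V" "y0 \<in> V" "closedin (zariski (affine_space N)) Z"
    "morphism (subspace_of Y V) (subspace_of (affine_space N) Z) \<phi>"
    "morphism (subspace_of (affine_space N) Z) (subspace_of Y V) \<psi>"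
    "\<And>y. y \<in> V \<Longrightarrow> \<phi> y \<in> Z \<and> \<psi> (\<phi> y) = y" "\<And>z. z \<in> Z \<Longrightarrow> \<psi> z \<in> V \<and> \<phi> (\<psi> z) = z"
proof -
  interpret variety Y by fact
  obtain V where V: "openin (zariski Y) V" "y0 \<in> V" "affine_variety (subspace_of Y V)"
    using finite_affine_cover assms(2) by (metis UnionE)
  from V(3) obtain N Z where Z: "closedin (zariski (affine_space N)) Z"
    and iso: "isomorphic (subspace_of Y V) (subspace_of (affine_space N) Z)"
    unfolding affine_variety_def by blast
  from iso obtain \<phi> \<psi> where mor: "morphism (subspace_of Y V) (subspace_of (affine_space N) Z) \<phi>"
      "morphism (subspace_of (affine_space N) Z) (subspace_of Y V) \<psi>"
    and inv: "\<forall>x\<in>points (subspace_of Y V). \<psi> (\<phi> x) = x"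
      "\<forall>y\<in>points (subspace_of (affine_space N) Z). \<phi> (\<psi> y) = y"
    unfolding isomorphic_def by blast
  have pts: "points (subspace_of Y V) = V" "points (subspace_of (affine_space N) Z) = Z"
    using openin_subset[OF V(1)] closedin_subset[OF Z] by (simp_all add: points_subspace_of Int_absorb1)
  have cont: "continuous_map (zariski (subspace_of Y V)) (zariski (subspace_of (affine_space N) Z)) \<phi>"
    "continuous_map (zariski (subspace_of (affine_space N) Z)) (zariski (subspace_of Y V)) \<psi>"
    using mor by (simp_all add: morphism_def)
  have im: "\<phi> ` V \<subseteq> Z" "\<psi> ` Z \<subseteq> V"
    using continuous_map_image_subset_topspace[OF cont(1)] continuous_map_image_subset_topspace[OF cont(2)]
    by (simp_all only: pts)
  show thesis
    by (rule that[OF V(1,2) Z mor]) (use im inv in \<open>auto simp only: pts\<close>)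
qed

lemma openin_affineE:
  assumes U: "openin (zariski (affine_space n)) U" "x \<in> U"
  obtains g where "g \<in> polynomial_functions {1..n}" "g x \<noteq> 0" "{x \<in> points (affine_space n). g x \<noteq> 0} \<subseteq> U"
proof -
  have "openin (zariski (space_of_algebra ({1..n} \<rightarrow>\<^sub>E UNIV) (polynomial_functions {1..n}))) U"
    using U(1) by (simp only: affine_space_def)
  from openin_space_of_algebra(2)[OF pf.function_algebra_axioms this U(2)]
  obtain g where "g \<in> polynomial_functions {1..n}" "g x \<noteq> 0" "{x \<in> {1..n} \<rightarrow>\<^sub>E UNIV. g x \<noteq> 0} \<subseteq> U"
    by (elim bexE conjE) (rule that)
  then show thesis by (intro that[of g]) (simp_all add: affine_points)
qed

text \<open>\<open>S\<close> is arbitrary because two cases occur: the open domain of the rational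
  map, and the closed set \<open>Z\<close> of an affine chart.\<close>

lemma pullback_quotient:
  assumes r: "morphism (subspace_of (affine_space n) S) Y r" and V: "openin (zariski Y) V" and f: "f \<in> regular Y V"
    and x0: "x0 \<in> S" "x0 \<in> points (affine_space n)" "r x0 \<in> V"
  obtains g a b where "g \<in> polynomial_functions {1..n}" "a \<in> polynomial_functions {1..n}"
    "b \<in> polynomial_functions {1..n}" "g x0 \<noteq> 0"
    "\<And>x. x \<in> points (affine_space n) \<Longrightarrow> g x \<noteq> 0 \<Longrightarrow> x \<in> S \<Longrightarrow> r x \<in> V \<Longrightarrow> b x \<noteq> 0 \<and> f (r x) = a x / b x"
proof -
  define P where "P = {x \<in> points (subspace_of (affine_space n) S). r x \<in> V}"
  have "f \<circ> r \<in> regular (subspace_of (affine_space n) S) P"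
    using r V f unfolding morphism_def P_def by blast
  moreover have "x0 \<in> P" using x0 by (simp add: P_def points_subspace_of)
  ultimately obtain W g where W: "openin (zariski (affine_space n)) W" "x0 \<in> W" "g \<in> regular (affine_space n) W"
    "\<forall>y\<in>W \<inter> P. (f \<circ> r) y = g y"
    unfolding subspace_of_def by auto
  obtain g1 where g1: "g1 \<in> polynomial_functions {1..n}" "g1 x0 \<noteq> 0" "{x \<in> points (affine_space n). g1 x \<noteq> 0} \<subseteq> W"
    by (rule openin_affineE[OF W(1,2)]) (rule that)
  have "g \<in> local_quotients ({1..n} \<rightarrow>\<^sub>E UNIV) (polynomial_functions {1..n}) x0"
    by (rule pf.regular_space_of_algebra[OF W(3)[unfolded affine_space_def] W(2)])
  then obtain g2 a b where g2: "g2 \<in> polynomial_functions {1..n}" "a \<in> polynomial_functions {1..n}"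
    "b \<in> polynomial_functions {1..n}" "g2 x0 \<noteq> 0"
    "\<And>s. s \<in> points (affine_space n) \<Longrightarrow> g2 s \<noteq> 0 \<Longrightarrow> b s \<noteq> 0 \<and> g s = a s / b s"
    unfolding affine_points[symmetric] by (rule local_quotientsE) blast
  show thesis
  proof (rule that[of "\<lambda>x. g1 x * g2 x" a b])
    fix x assume x: "x \<in> points (affine_space n)" "g1 x * g2 x \<noteq> 0" "x \<in> S" "r x \<in> V"
    then have "x \<in> W \<inter> P" using g1(3) by (auto simp: P_def points_subspace_of)
    then show "b x \<noteq> 0 \<and> f (r x) = a x / b x" using W(4) g2(5)[OF x(1)] x(2) by auto
  qed (use g1 g2 in \<open>auto intro: pf.mult\<close>)
qed

lemma pullback_open:
  assumes D: "openin (zariski (affine_space n)) D" and r: "continuous_map (zariski (subspace_of (affine_space n) D)) (zariski Y) r"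
    and V: "openin (zariski Y) V" and x0: "x0 \<in> D" "r x0 \<in> V"
  obtains g where "g \<in> polynomial_functions {1..n}" "g x0 \<noteq> 0"
    "\<And>x. x \<in> points (affine_space n) \<Longrightarrow> g x \<noteq> 0 \<Longrightarrow> x \<in> D \<and> r x \<in> V"
proof -
  define P where "P = {x \<in> points (subspace_of (affine_space n) D). r x \<in> V}"
  have "openin (zariski (subspace_of (affine_space n) D)) P"
    unfolding P_def by (rule openin_continuous_map_preimage[OF r V])
  then have P: "openin (zariski (affine_space n)) P" using D by (simp add: openin_open_subspace)
  have "x0 \<in> P" using x0 openin_subset[OF D] by (auto simp: P_def points_subspace_of)
  then obtain g where g: "g \<in> polynomial_functions {1..n}" "g x0 \<noteq> 0" "{x \<in> points (affine_space n). g x \<noteq> 0} \<subseteq> P"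
    by (rule openin_affineE[OF P]) (rule that)
  then show thesis by (intro that[of g]) (auto simp: P_def points_subspace_of)
qed

lemma coordinate_regular:
  assumes "i \<in> {1..N}" "Z \<subseteq> points (affine_space N)"
  shows "(\<lambda>z. z i) \<in> regular (subspace_of (affine_space N) Z) Z"
proof -
  let ?P = "{1..N} \<rightarrow>\<^sub>E (UNIV :: complex set)"
  have op: "openin (zariski (affine_space N)) ?P" using openin_topspace[of "zariski (affine_space N)"] by (simp add: affine_points)
  have "(\<lambda>z. z i) \<in> regular (affine_space N) ?P"
    unfolding affine_space_def space_of_algebra_def Let_def
  proof (simp only: fun_space.select_convs mem_Collect_eq, intro ballI exI conjI)
    fix x assume "x \<in> ?P"
    then show "x \<in> ?P" .
    show "openin (topology_generated_by ((\<lambda>a. {x \<in> ?P. a x \<noteq> 0}) ` polynomial_functions {1..N})) ?P"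
      using op by (simp add: affine_space_def space_of_algebra_def Let_def)
    show "(\<lambda>z. z i) \<in> polynomial_functions {1..N}" using assms(1) by (rule polynomial_functions.coord)
    show "(\<lambda>_. 1) \<in> polynomial_functions {1..N}" by (rule pf.const)
    show "x i = x i / 1" if "x \<in> ?P" for x :: "nat \<Rightarrow> complex" by simp
  qed auto
  then show ?thesis using op assms(2) unfolding subspace_of_def by (auto simp: affine_points)
qed

text \<open>The equation puts \<open>(x, t)\<close> into the closed subspace; it remains to see that
  it is a point of the product, whose points are the union of the basic open sets. The constant 1,
  as a tensor with one term, gives a basic open set containing it.\<close>

lemma universal_values:
  assumes x: "x \<in> points (affine_space n)" and t: "t ^ n + (\<Sum>i=1..n. x i * t ^ (n - i)) = 0"
  shows "t \<in> values_at (universal_algfun n) x"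
proof -
  have one: "(\<lambda>_. 1) \<in> regular (space_of_algebra S A) S" if "function_algebra A" for S and A :: "('a \<Rightarrow> complex) set"
  proof -
    interpret function_algebra A by fact
    have "openin (zariski (space_of_algebra S A)) S"
      using openin_topspace[of "zariski (space_of_algebra S A)"] points_space_of_algebra[OF that] by metis
    then show ?thesis unfolding space_of_algebra_def Let_def
      by (auto intro!: exI[of _ S] exI[of _ "\<lambda>_. 1"] const)
  qed
  define h where "h = (\<lambda>(x :: nat \<Rightarrow> complex, y :: complex). \<Sum>i<(1::nat). (1 :: complex) * 1)"
  have "h \<in> tensor_functions (affine_space n) affine_line (points (affine_space n)) (points affine_line)"
    unfolding tensor_functions_def h_def mem_Collect_eq
    by (rule exI[of _ 1], rule exI[of _ "\<lambda>_ _. 1"], rule exI[of _ "\<lambda>_ _. 1"])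
       (use one[OF pf.function_algebra_axioms] one[OF poly_algebra] in
         \<open>simp add: affine_points line_points, simp add: affine_space_def affine_line_def\<close>)
  then have "{q \<in> points (affine_space n) \<times> points affine_line. h q \<noteq> 0} \<in>
     {{q \<in> U \<times> V. h q \<noteq> 0} | U V h. openin (zariski (affine_space n)) U \<and> openin (zariski affine_line) V \<and>
      h \<in> tensor_functions (affine_space n) affine_line U V}"
    using openin_topspace by blast
  moreover have "(x, t) \<in> {q \<in> points (affine_space n) \<times> points affine_line. h q \<noteq> 0}"
    using x by (simp add: h_def line_points)
  ultimately have "(x, t) \<in> points (product_space (affine_space n) affine_line)"
    unfolding product_space_def product_zariski_def fun_space.select_convs topology_generated_by_topspace
    by (rule UnionI)
  then have "(x, t) \<in> points (covering_space (universal_algfun n))"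
    using x t by (simp add: universal_algfun_def points_subspace_of)
  then show ?thesis by (force simp: values_at_def universal_algfun_def)
qed

section \<open>The family of polynomials with paired roots\<close>

lemma prod_pairs:
  fixes g :: "nat \<Rightarrow> 'a :: comm_monoid_mult"
  shows "(\<Prod>i=1..k. g (2 * i - 2) * g (2 * i - 1)) = (\<Prod>j<2 * k. g j)"
proof (induction k)
  case (Suc k)
  have "2 * Suc k - 2 = 2 * k" "2 * Suc k - 1 = Suc (2 * k)" "2 * Suc k = Suc (Suc (2 * k))" by simp_all
  then have "(\<Prod>i=1..Suc k. g (2 * i - 2) * g (2 * i - 1)) = (\<Prod>j<2 * k. g j) * (g (2 * k) * g (Suc (2 * k)))"
    using Suc by (subst prod.cl_ivl_Suc) simp
  also have "\<dots> = (\<Prod>j<Suc (Suc (2 * k)). g j)" by (simp only: prod.lessThan_Suc mult.assoc)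
  finally show ?case by simp
qed simp

text \<open>Every \<open>x0\<close> lies on such a family: the roots of its polynomial, numbered
  from 0, are paired as \<open>2 * i - 2\<close> and \<open>2 * i - 1\<close>, with
  \<open>c i\<close> their half sum and \<open>v0 i\<close> their half difference; for odd
  \<open>n\<close> the last root is kept fixed. Thus the family can be made to pass through a point
  where nothing degenerates.\<close>

lemma even_root_family:
  assumes x0: "x0 \<in> points (affine_space n)"
  obtains X c v0 where "\<And>v. X v \<in> points (affine_space n)" "X v0 = x0"
    "\<And>i. i \<in> {1..n} \<Longrightarrow> (\<lambda>v. X v i) \<in> polynomial_functions {1..n div 2}"
    "\<And>\<epsilon> v. \<epsilon> \<in> signs \<Longrightarrow> X (flip \<epsilon> v) = X v"
    "\<And>v i. i \<in> {1..n div 2} \<Longrightarrow> (c i + v i) ^ n + (\<Sum>j=1..n. X v j * (c i + v i) ^ (n - j)) = 0"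
proof -
  define k where "k = n div 2"
  define p0 where "p0 = monom 1 n + (\<Sum>i=1..n. monom (x0 i) (n - i))"
  have p0_n: "coeff p0 n = 1" by (auto simp: p0_def coeff_sum intro!: sum.neutral)
  have "degree (monom (x0 i) (n - i)) \<le> n" for i by (rule order.trans[OF degree_monom_le]) simp
  then have "degree p0 \<le> n" unfolding p0_def
    by (intro degree_add_le degree_monom_le degree_sum_le) auto
  then have p0_deg: "degree p0 = n" using p0_n le_degree[of p0 n] by simp
  have p0_coeff: "coeff p0 (n - i) = x0 i" if i: "i \<in> {1..n}" for i
  proof -
    have "n \<noteq> n - i" using i by auto
    have "coeff p0 (n - i) = (\<Sum>j=1..n. if n - j = n - i then x0 j else 0)"
      unfolding p0_def coeff_add coeff_sum coeff_monom if_not_P[OF \<open>n \<noteq> n - i\<close>] by (rule add_0)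
    also have "\<dots> = (\<Sum>j=1..n. if j = i then x0 j else 0)"
      by (rule sum.cong) (use i in auto)
    finally show ?thesis using i by simp
  qed
  obtain s where s: "p0 = (\<Prod>i<n. [:- s i, 1:])" using monic_splits[of p0] p0_deg p0_n by auto
  define c where "c i = (s (2 * i - 2) + s (2 * i - 1)) / 2" for i
  define v0 where "v0 i = (s (2 * i - 2) - s (2 * i - 1)) / 2" for i
  define L where "L = (if odd n then [:- s (n - 1), 1:] else 1)"
  define P where "P v = (\<Prod>i=1..k. [:- (c i + v i), 1:] * [:- (c i - v i), 1:]) * L" for v
  have v0: "P v0 = p0"
  proof -
    have "c i + v0 i = s (2 * i - 2)" "c i - v0 i = s (2 * i - 1)" for i
      by (simp_all add: c_def v0_def field_simps)
    then have "P v0 = (\<Prod>j<2 * k. [:- s j, 1:]) * L"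
      unfolding P_def by (simp only: prod_pairs[of "\<lambda>j. [:- s j, 1:]"])
    also have "\<dots> = p0"
    proof (cases "odd n")
      case True
      then have "n = Suc (2 * k)" by (simp add: k_def)
      then show ?thesis using True by (simp add: s L_def mult.commute del: mult_pCons_left mult_pCons_right)
    next
      case False
      then have "n = 2 * k" by (simp add: k_def)
      then show ?thesis using False by (simp add: s L_def)
    qed
    finally show ?thesis .
  qed
  have P_flip: "P (flip \<epsilon> v) = P v" if "\<epsilon> \<in> signs" for \<epsilon> v
  proof -
    have "[:- (c i + flip \<epsilon> v i), 1:] * [:- (c i - flip \<epsilon> v i), 1:] = [:- (c i + v i), 1:] * [:- (c i - v i), 1:]" for i
    proof -
      have "\<epsilon> i = 1 \<or> \<epsilon> i = - 1" using that by (simp add: signs_def)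
      then show ?thesis by (auto simp: flip_def)
    qed
    then show ?thesis by (simp only: P_def)
  qed
  have "n - 2 * k = (if odd n then 1 else 0)" unfolding k_def by presburger
  then have L: "lead_coeff L = 1" "degree L = n - 2 * k" 
    by (cases "odd n"; simp add: L_def)+
  have P_lead: "lead_coeff (P v) = 1" for v
    unfolding P_def lead_coeff_mult lead_coeff_prod L(1) by simp
  have P_deg: "degree (P v) = n" for v
  proof -
    have deg2: "degree ([:- (c i + v i), 1:] * [:- (c i - v i), 1:]) = 2" for i
      by (subst degree_mult_eq) auto
    have "degree (\<Prod>i=1..k. [:- (c i + v i), 1:] * [:- (c i - v i), 1:]) = 2 * k"
      by (subst degree_prod_sum_eq) (simp_all only: deg2, auto)
    moreover have "(\<Prod>i=1..k. [:- (c i + v i), 1:] * [:- (c i - v i), 1:]) \<noteq> 0" by simp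
    moreover have "L \<noteq> 0" by (auto simp: L_def)
    ultimately have "degree (P v) = 2 * k + (n - 2 * k)" unfolding P_def by (subst degree_mult_eq) (auto simp: L)
    then show ?thesis by (simp add: k_def)
  qed
  have P_fam: "pf.poly_family {1..k} P" unfolding P_def[abs_def]
    by (intro pf.poly_family_mult pf.poly_family_prod pf.poly_family_const
      pf.poly_family_linear pf.add pf.diff pf.const
      polynomial_functions.coord)
  define X where "X v = (\<lambda>i\<in>{1..n}. coeff (P v) (n - i))" for v
  have P_eq: "poly (P v) t = t ^ n + (\<Sum>j=1..n. X v j * t ^ (n - j))" for v t
  proof -
    have "poly (P v) t = (\<Sum>j\<le>n. coeff (P v) j * t ^ j)" by (simp add: poly_altdef P_deg)
    also have "\<dots> = (\<Sum>j<n. coeff (P v) j * t ^ j) + t ^ n"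
      using P_lead[of v] by (simp add: P_deg flip: lessThan_Suc_atMost)
    also have "(\<Sum>j<n. coeff (P v) j * t ^ j) = (\<Sum>j=1..n. X v j * t ^ (n - j))"
      by (rule sum.reindex_bij_witness[of _ "\<lambda>j. n - j" "\<lambda>j. n - j"]) (auto simp: X_def)
    finally show ?thesis by simp
  qed
  show thesis
  proof
    show "X v \<in> points (affine_space n)" for v by (simp add: X_def affine_points)
    show "X v0 = x0"
    proof (rule PiE_ext[of _ "{1..n}" "\<lambda>_. UNIV"])
      show "X v0 \<in> {1..n} \<rightarrow>\<^sub>E UNIV" "x0 \<in> {1..n} \<rightarrow>\<^sub>E UNIV" using x0 by (simp_all add: X_def affine_points)
      show "X v0 i = x0 i" if "i \<in> {1..n}" for i using p0_coeff that by (simp add: X_def v0)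
    qed
    show "(\<lambda>v. X v i) \<in> polynomial_functions {1..n div 2}" if "i \<in> {1..n}" for i
      using pf.poly_family_coeff[OF P_fam, of "n - i"] that by (simp add: X_def k_def)
    show "X (flip \<epsilon> v) = X v" if "\<epsilon> \<in> signs" for \<epsilon> v by (simp add: X_def P_flip[OF that])
    show "(c i + v i) ^ n + (\<Sum>j=1..n. X v j * (c i + v i) ^ (n - j)) = 0" if i: "i \<in> {1..n div 2}" for v i
    proof -
      have "poly (P v) (c i + v i) = 0"
        unfolding P_def poly_mult poly_prod using i by (auto simp: k_def intro!: prod_zero bexI[of _ i])
      then show ?thesis by (simp add: P_eq)
    qed
  qed
qed

section \<open>Zero sets of primes and the dimension of the target\<close>

lemma irreducible_closure_of_image:
  assumes C: "irreducible_set T C" and f: "continuous_map T T' f"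
  shows "irreducible_set T' (Abstract_Topology.closure_of T' (f ` C))"
  unfolding irreducible_set_def
proof (intro conjI allI impI)
  have fC: "f ` C \<subseteq> topspace T'" using C f by (auto simp: irreducible_set_def continuous_map_def)
  then have sub: "f ` C \<subseteq> Abstract_Topology.closure_of T' (f ` C)" by (rule closure_of_subset)
  then show "Abstract_Topology.closure_of T' (f ` C) \<noteq> {}" using C by (auto simp: irreducible_set_def)
  show "Abstract_Topology.closure_of T' (f ` C) \<subseteq> topspace T'" by (rule closure_of_subset_topspace)
  fix A B assume AB: "closedin T' A \<and> closedin T' B \<and> Abstract_Topology.closure_of T' (f ` C) \<subseteq> A \<union> B"
  define pre where "pre A = {x \<in> topspace T. f x \<in> A}" for A
  have "closedin T (pre A)" "closedin T (pre B)"
    unfolding pre_def using AB closedin_continuous_map_preimage[OF f] by simp_all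
  moreover have "C \<subseteq> pre A \<union> pre B" using AB sub C by (force simp: pre_def irreducible_set_def)
  ultimately have "C \<subseteq> pre A \<or> C \<subseteq> pre B" using C by (simp add: irreducible_set_def)
  then have "f ` C \<subseteq> A \<or> f ` C \<subseteq> B" by (auto simp: pre_def)
  then show "Abstract_Topology.closure_of T' (f ` C) \<subseteq> A \<or> Abstract_Topology.closure_of T' (f ` C) \<subseteq> B"
    using AB by (auto dest: closure_of_minimal)
qed

definition zero_set :: "nat \<Rightarrow> ((nat \<Rightarrow> complex) \<Rightarrow> complex) set \<Rightarrow> (nat \<Rightarrow> complex) set"
  where "zero_set N J = {z \<in> points (affine_space N). \<forall>f\<in>J. f z = 0}"

lemma closedin_zero_set:
  assumes "J \<subseteq> polynomial_functions {1..N}"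
  shows "closedin (zariski (affine_space N)) (zero_set N J)"
proof -
  have "points (affine_space N) - zero_set N J = (\<Union>f\<in>J. {z \<in> {1..N} \<rightarrow>\<^sub>E UNIV. f z \<noteq> 0})"
    by (auto simp: zero_set_def affine_points)
  also have "openin (zariski (affine_space N)) \<dots>"
    unfolding affine_space_def using assms by (intro openin_Union) (auto intro!: openin_nonzero_locus)
  finally show ?thesis by (auto simp: closedin_def zero_set_def)
qed

lemma closedin_affineE:
  assumes Z: "closedin (zariski (affine_space N)) Z" and z: "z \<in> points (affine_space N)" "z \<notin> Z"
  obtains f where "f \<in> polynomial_functions {1..N}" "f z \<noteq> 0" "\<And>x. x \<in> Z \<Longrightarrow> f x = 0"
proof -
  have op: "openin (zariski (affine_space N)) (points (affine_space N) - Z)" using Z by blast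
  have zP: "z \<in> points (affine_space N) - Z" using z by simp
  obtain f where f: "f \<in> polynomial_functions {1..N}" "f z \<noteq> 0"
    "{x \<in> points (affine_space N). f x \<noteq> 0} \<subseteq> points (affine_space N) - Z"
    by (rule openin_affineE[OF op zP]) (rule that)
  show thesis
  proof (rule that[OF f(1,2)])
    fix x assume "x \<in> Z"
    then show "f x = 0" using f(3) closedin_subset[OF Z] by blast
  qed
qed

lemma zero_set_witness:
  assumes p: "pf.prime_ideal {1..N} p" and g: "g \<in> polynomial_functions {1..N}" "g \<notin> p"
  shows "\<exists>x\<in>zero_set N p. g x \<noteq> 0"
proof -
  obtain x where "x \<in> {1..N} \<rightarrow>\<^sub>E UNIV" "\<And>f. f \<in> p \<Longrightarrow> f x = 0" "g x \<noteq> 0"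
    by (rule nullstellensatz_prime[of "{1..N}" p g]) (simp, rule p, rule g(1), rule g(2), rule that)
  then show ?thesis by (intro bexI[of _ x]) (simp_all add: zero_set_def affine_points)
qed

text \<open>By the Nullstellensatz a polynomial function vanishing on the zero set lies in
  \<open>p\<close>; this is applied to the product of an equation of \<open>A\<close> and an
  equation of \<open>B\<close>.\<close>

lemma irreducible_zero_set:
  assumes p: "pf.prime_ideal {1..N} p"
  shows "irreducible_set (zariski (affine_space N)) (zero_set N p)"
  unfolding irreducible_set_def
proof (intro conjI allI impI)
  note nss = zero_set_witness[OF p]
  show "zero_set N p \<noteq> {}"
    using nss[OF pf.const pf.prime_idealD(2)[OF p]] by blast
  show "zero_set N p \<subseteq> points (affine_space N)" by (auto simp: zero_set_def)
  fix A B assume AB: "closedin (zariski (affine_space N)) A \<and> closedin (zariski (affine_space N)) B \<and> zero_set N p \<subseteq> A \<union> B"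
  show "zero_set N p \<subseteq> A \<or> zero_set N p \<subseteq> B"
  proof (rule ccontr)
    assume "\<not> ?thesis"
    then obtain x y where x: "x \<in> zero_set N p" "x \<notin> A" and y: "y \<in> zero_set N p" "y \<notin> B" by blast
    obtain f where f: "f \<in> polynomial_functions {1..N}" "f x \<noteq> 0" "\<And>z. z \<in> A \<Longrightarrow> f z = 0"
      using closedin_affineE[of N A x] AB x by (auto simp: zero_set_def)
    obtain g where g: "g \<in> polynomial_functions {1..N}" "g y \<noteq> 0" "\<And>z. z \<in> B \<Longrightarrow> g z = 0"
      using closedin_affineE[of N B y] AB y by (auto simp: zero_set_def)
    have "(\<lambda>z. f z * g z) \<in> p"
    proof (rule ccontr)
      assume "(\<lambda>z. f z * g z) \<notin> p"
      from nss[OF pf.mult[OF f(1) g(1)] this]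
      obtain z where "z \<in> zero_set N p" "f z * g z \<noteq> 0" by blast
      then show False using AB f(3) g(3) by (metis UnE mult_eq_0_iff subsetD)
    qed
    then have "f \<in> p \<or> g \<in> p" using pf.prime_idealD(3)[OF p f(1) g(1)] by blast
    then show False using f(2) g(2) x(1) y(1) by (auto simp: zero_set_def)
  qed
qed

lemma zero_set_strict:
  assumes p: "pf.prime_ideal {1..N} p" and q: "pf.prime_ideal {1..N} q" and "p \<subset> q"
  shows "zero_set N q \<subset> zero_set N p"
proof -
  from psubset_imp_ex_mem[OF \<open>p \<subset> q\<close>] obtain g where g: "g \<in> q" "g \<notin> p" by (elim exE DiffE)
  have "g \<in> polynomial_functions {1..N}"
    by (rule subsetD[OF pf.idealD(1)[OF pf.prime_idealD(1)[OF q]] g(1)])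
  from zero_set_witness[OF p this g(2)] obtain x where x: "x \<in> zero_set N p" "g x \<noteq> 0" by blast
  then have "x \<notin> zero_set N q" using g(1) by (auto simp: zero_set_def)
  moreover have "zero_set N q \<subseteq> zero_set N p" using \<open>p \<subset> q\<close> unfolding zero_set_def by blast
  ultimately show ?thesis using x(1) by blast
qed

lemma polynomial_family_compose:
  assumes F: "polynomial_family I F" and X: "\<And>i. i \<in> I \<Longrightarrow> (\<lambda>v. X v i) \<in> polynomial_functions J"
  shows "polynomial_family J (\<lambda>v. F (X v))"
proof -
  have "(\<lambda>v. coeff (F (X v)) l) \<in> polynomial_functions J" for l
    by (rule pf.polynomial_functions_compose[where f = "\<lambda>x. coeff (F x) l" and y = X])
       (use F X in \<open>auto simp: polynomial_family_def intro: pf.poly_family_coeff\<close>)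
  then show ?thesis using F by (auto simp: polynomial_family_def pf.poly_family_def)
qed

lemma monic_poly_expand:
  fixes P :: "complex poly"
  assumes "lead_coeff P = 1"
  shows "poly P s = s ^ degree P + (\<Sum>j<degree P. coeff P j * s ^ j)"
  using assms by (simp add: poly_altdef flip: lessThan_Suc_atMost)

lemma local_quotients_triple:
  assumes "f \<in> local_quotients S A x"
  shows "\<exists>t. fst t \<in> A \<and> fst (snd t) \<in> A \<and> snd (snd t) \<in> A \<and> fst t x \<noteq> 0 \<and>
    (\<forall>s\<in>S. fst t s \<noteq> 0 \<longrightarrow> snd (snd t) s \<noteq> 0 \<and> f s = fst (snd t) s / snd (snd t) s)"
proof -
  obtain g a b where g: "g \<in> A" "a \<in> A" "b \<in> A" "g x \<noteq> 0"
    and eq: "\<forall>s\<in>S. g s \<noteq> 0 \<longrightarrow> b s \<noteq> 0 \<and> f s = a s / b s"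
    using assms unfolding local_quotients_def by blast
  show ?thesis
    by (rule exI[of _ "(g, a, b)"], unfold fst_conv snd_conv, intro conjI) (rule g eq)+
qed

text \<open>By \<open>top\<close> the zero sets of the \<open>P i\<close> lie in \<open>Z\<close>;
  they are mapped into \<open>Y\<close> and closed up there. Intersecting with \<open>V\<close>
  recovers the images, so the inclusions of the closures remain strict. Primes decrease with the
  index, so zero sets increase, as \<open>variety_dim\<close> expects.\<close>

lemma dimension_bound:
  assumes Y: "space_with_functions Y" and V: "openin (zariski Y) V"
    and Z: "closedin (zariski (affine_space N)) Z"
    and \<phi>: "morphism (subspace_of Y V) (subspace_of (affine_space N) Z) \<phi>"
    and \<psi>: "morphism (subspace_of (affine_space N) Z) (subspace_of Y V) \<psi>"
    and inv: "\<And>y. y \<in> V \<Longrightarrow> \<phi> y \<in> Z \<and> \<psi> (\<phi> y) = y" "\<And>z. z \<in> Z \<Longrightarrow> \<psi> z \<in> V \<and> \<phi> (\<psi> z) = z"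
    and P: "\<And>i. i \<le> k \<Longrightarrow> pf.prime_ideal {1..N} (P i)" "\<And>i. i < k \<Longrightarrow> P (Suc i) \<subset> P i"
    and top: "\<And>f. f \<in> polynomial_functions {1..N} \<Longrightarrow> (\<And>z. z \<in> Z \<Longrightarrow> f z = 0) \<Longrightarrow> f \<in> P k"
  shows "enat k \<le> variety_dim Y"
proof -
  let ?A = "zariski (affine_space N)"
  define C where "C i = zero_set N (P i)" for i
  have Z_pts: "Z \<subseteq> points (affine_space N)" using closedin_subset[OF Z] .
  have P_mono: "P k \<subseteq> P i" if "i \<le> k" for i
    using that by (induction rule: inc_induct) (use P(2) in auto)
  have C_Z: "C i \<subseteq> Z" if i: "i \<le> k" for i
  proof
    fix z assume z: "z \<in> C i"
    show "z \<in> Z"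
    proof (rule ccontr)
      assume "z \<notin> Z"
      then obtain f where f: "f \<in> polynomial_functions {1..N}" "f z \<noteq> 0" "\<And>x. x \<in> Z \<Longrightarrow> f x = 0"
        using closedin_affineE[OF Z, of z] z by (auto simp: C_def zero_set_def)
      then have "f \<in> P i" using top[OF f(1,3)] P_mono[OF i] by blast
      then show False using z f(2) by (simp add: C_def zero_set_def)
    qed
  qed
  have C_irr: "irreducible_set ?A (C i)" if "i \<le> k" for i
    unfolding C_def by (rule irreducible_zero_set[OF P(1)[OF that]])
  have C_closed: "closedin ?A (C i)" if "i \<le> k" for i unfolding C_def
    by (rule closedin_zero_set)
       (rule pf.idealD(1)[OF pf.prime_idealD(1)[OF P(1)[OF that]]])
  have C_strict: "C i \<subset> C (Suc i)" if "i < k" for i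
    unfolding C_def by (rule zero_set_strict[OF P(1) P(1) P(2)]) (use that in auto)
  have zar: "zariski (subspace_of Y V) = subtopology (zariski Y) V"
    "zariski (subspace_of (affine_space N) Z) = subtopology ?A Z" by (simp_all add: subspace_of_def)
  have \<psi>_cont: "continuous_map (subtopology ?A Z) (zariski Y) \<psi>"
    using \<psi> continuous_map_into_fulltopology unfolding morphism_def zar by blast
  have \<phi>_cont: "continuous_map (subtopology (zariski Y) V) ?A \<phi>"
    using \<phi> continuous_map_into_fulltopology unfolding morphism_def zar by blast
  have C_irr': "irreducible_set (subtopology ?A Z) (C i)" if i: "i \<le> k" for i
    unfolding irreducible_set_def
  proof (intro conjI allI impI)
    show "C i \<noteq> {}" using C_irr[OF i] by (simp add: irreducible_set_def)
    show "C i \<subseteq> topspace (subtopology ?A Z)" using C_Z[OF i] Z_pts by auto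
    fix A B assume "closedin (subtopology ?A Z) A \<and> closedin (subtopology ?A Z) B \<and> C i \<subseteq> A \<union> B"
    then have "closedin ?A A \<and> closedin ?A B \<and> C i \<subseteq> A \<union> B" using Z closedin_closed_subtopology by blast
    then show "C i \<subseteq> A \<or> C i \<subseteq> B" using C_irr[OF i] by (simp add: irreducible_set_def)
  qed
  define K where "K i = Abstract_Topology.closure_of (zariski Y) (\<psi> ` C i)" for i
  have K_V: "K i \<inter> V = \<psi> ` C i" if i: "i \<le> k" for i
  proof
    have sub: "\<psi> ` C i \<subseteq> V" using inv(2) C_Z[OF i] by blast
    then show "\<psi> ` C i \<subseteq> K i \<inter> V" unfolding K_def
      using closure_of_subset[of "\<psi> ` C i" "zariski Y"] openin_subset[OF V] by blast
    \<comment> \<open>The preimage of \<open>C i\<close> under \<phi> is closed in \<open>V\<close>,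
      so the closure adds points outside \<open>V\<close> only.\<close>
    have "closedin (subtopology (zariski Y) V) {y \<in> topspace (subtopology (zariski Y) V). \<phi> y \<in> C i}"
      by (rule closedin_continuous_map_preimage[OF \<phi>_cont C_closed[OF i]])
    then obtain Q where Q: "closedin (zariski Y) Q" "{y \<in> topspace (subtopology (zariski Y) V). \<phi> y \<in> C i} = Q \<inter> V"
      by (auto simp: closedin_subtopology)
    have "\<psi> ` C i \<subseteq> Q"
    proof (rule image_subsetI)
      fix z assume z: "z \<in> C i"
      then have "z \<in> Z" using C_Z[OF i] by blast
      then have "\<psi> z \<in> V" "\<phi> (\<psi> z) \<in> C i" using inv(2) z by auto
      then have "\<psi> z \<in> {y \<in> topspace (subtopology (zariski Y) V). \<phi> y \<in> C i}"
        using openin_subset[OF V] by auto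
      then show "\<psi> z \<in> Q" unfolding Q(2) by blast
    qed
    then have "K i \<subseteq> Q" unfolding K_def using Q(1) by (rule closure_of_minimal)
    show "K i \<inter> V \<subseteq> \<psi> ` C i"
    proof
      fix y assume y: "y \<in> K i \<inter> V"
      then have "y \<in> Q \<inter> V" using \<open>K i \<subseteq> Q\<close> by blast
      then have "\<phi> y \<in> C i" unfolding Q(2)[symmetric] by blast
      then show "y \<in> \<psi> ` C i" using inv(1)[of y] y by (intro image_eqI[of _ _ "\<phi> y"]) auto
    qed
  qed
  have K: "closedin (zariski Y) (K i) \<and> irreducible_set (zariski Y) (K i)" if "i \<le> k" for i
    unfolding K_def using irreducible_closure_of_image[OF C_irr'[OF that] \<psi>_cont] by simp
  have K_strict: "K i \<subset> K (Suc i)" if i: "i < k" for i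
  proof -
    have "K i \<subseteq> K (Suc i)" unfolding K_def by (rule closure_of_mono) (use C_strict[OF i] in blast)
    moreover have "K i \<noteq> K (Suc i)"
    proof
      assume "K i = K (Suc i)"
      then have eq: "\<psi> ` C i = \<psi> ` C (Suc i)" using K_V[of i] K_V[of "Suc i"] i by simp
      have "\<phi> ` \<psi> ` C j = C j" if "j \<le> k" for j
      proof -
        have "\<phi> ` \<psi> ` C j = (\<lambda>z. z) ` C j"
          unfolding image_image by (rule image_cong) (use inv(2) C_Z[OF that] in auto)
        then show ?thesis by simp
      qed
      then have "C i = C (Suc i)" using eq i by (metis Suc_leI less_imp_le)
      then show False using C_strict[OF i] by simp
    qed
    ultimately show ?thesis by blast
  qed
  show ?thesis unfolding variety_dim_def
    by (rule Sup_upper, rule CollectI, rule exI[of _ k], rule conjI[OF refl], rule exI[of _ K])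
       (use K K_strict in simp)
qed

section \<open>The universal function restricted to an even family through a generic point\<close>

theorem theorem17:
  fixes n :: nat and Y :: "'b fun_space" and T :: "'b set" and w :: "('b, 'd) algfun"
  assumes "n \<ge> 1"
    and "irreducible_variety Y"
    and "variety_dim Y < enat (n div 2)"
    and "algebraic_function_over Y T w"
  shows "\<not> rationally_induced (affine_space n) (points (affine_space n)) (universal_algfun n) Y T w"
proof
  assume "rationally_induced (affine_space n) (points (affine_space n)) (universal_algfun n) Y T w"
  then obtain U D \<rho> E R where U: "openin (zariski (affine_space n)) U" "U \<noteq> {}"
    and \<rho>: "rational_map (affine_space n) Y D \<rho>"
    and R: "rational_function (product_space (affine_space n) affine_line) E R"
    and UD: "U \<subseteq> D" "\<rho> ` U \<subseteq> T" and inE: "\<forall>x\<in>U. \<forall>t\<in>values_at w (\<rho> x). (x, t) \<in> E"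
    and ind: "\<forall>x\<in>U. values_at (universal_algfun n) x \<subseteq> {R (x, t) | t. t \<in> values_at w (\<rho> x)}"
    unfolding rationally_induced_def by blast
  interpret Y: irreducible_variety Y by fact
  have Y: "space_with_functions Y" "variety Y" by unfold_locales
  let ?pts = "points (affine_space n)"
  obtain a b d x1 where ab: "polynomial_family {1..n} a" "polynomial_family {1..n} b"
    and d: "d \<in> polynomial_functions {1..n}" "d x1 \<noteq> 0"
    and coprime: "\<And>x t. d x \<noteq> 0 \<Longrightarrow> poly (a x) t \<noteq> 0 \<or> poly (b x) t \<noteq> 0"
    and abR: "\<And>x t. d x \<noteq> 0 \<Longrightarrow> (x, t) \<in> E \<Longrightarrow> poly (a x) t = R (x, t) * poly (b x) t"
    by (rule rational_function_reduced[OF R]) (rule that)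
  obtain u where u: "u \<in> U" using U(2) by blast
  obtain gU where gU: "gU \<in> polynomial_functions {1..n}" "gU u \<noteq> 0" "{x \<in> ?pts. gU x \<noteq> 0} \<subseteq> U"
    by (rule openin_affineE[OF U(1) u]) (rule that)
  \<comment> \<open>The base point is to lie in \<open>U\<close> and in the locus where
    \<open>a\<close> and \<open>b\<close> are coprime; all further denominators are chosen nonzero
    at it. Restriction to \<open>{1..n}\<close> makes it a point of affine space.\<close>
  obtain x2 where x2: "gU x2 * d x2 \<noteq> 0"
    using polynomial_functions_nonzero_mult[OF gU(1) d(1)] gU(2) d(2) by blast
  define x0 where "x0 = restrict x2 {1..n}"
  have x0: "x0 \<in> ?pts" by (simp add: x0_def affine_points PiE_iff)
  have "gU x0 = gU x2" "d x0 = d x2"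
    by (rule polynomial_functions_restrict[OF gU(1)], simp add: x0_def,
        rule polynomial_functions_restrict[OF d(1)], simp add: x0_def)
  then have gx0: "gU x0 \<noteq> 0" "d x0 \<noteq> 0" using x2 by auto
  then have x0U: "x0 \<in> U" using gU(3) x0 by blast
  have D: "openin (zariski (affine_space n)) D" and \<rho>_mor: "morphism (subspace_of (affine_space n) D) Y \<rho>"
    using \<rho> by (auto simp: rational_map_def)
  have \<rho>_cont: "continuous_map (zariski (subspace_of (affine_space n) D)) (zariski Y) \<rho>"
    using \<rho>_mor by (simp add: morphism_def)
  have x0D: "x0 \<in> D" and y0T: "\<rho> x0 \<in> T" using x0U UD by auto
  obtain V1 H m where V1: "openin (zariski Y) V1" "\<rho> x0 \<in> V1"
    and H: "\<And>j. (\<lambda>y. coeff (H y) j) \<in> regular Y V1" "\<And>y. degree (H y) = m" "\<And>y. lead_coeff (H y) = 1"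
    "\<And>y t. y \<in> V1 \<Longrightarrow> t \<in> values_at w y \<Longrightarrow> poly (H y) t = 0"
    by (rule values_integral[OF Y(1) assms(4) y0T]) (rule that)
  have y0: "\<rho> x0 \<in> points Y" using V1 openin_subset by blast
  obtain V2 N Z \<phi> \<psi> where V2: "openin (zariski Y) V2" "\<rho> x0 \<in> V2" and Z: "closedin (zariski (affine_space N)) Z"
    and \<phi>: "morphism (subspace_of Y V2) (subspace_of (affine_space N) Z) \<phi>"
    and \<psi>: "morphism (subspace_of (affine_space N) Z) (subspace_of Y V2) \<psi>"
    and inv: "\<And>y. y \<in> V2 \<Longrightarrow> \<phi> y \<in> Z \<and> \<psi> (\<phi> y) = y" "\<And>z. z \<in> Z \<Longrightarrow> \<psi> z \<in> V2 \<and> \<phi> (\<psi> z) = z"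
    by (rule affine_neighbourhood[OF Y(2) y0]) (rule that)
  have Z_pts: "Z \<subseteq> points (affine_space N)" using closedin_subset[OF Z] .
  have V12: "openin (zariski Y) (V1 \<inter> V2)" using V1 V2 by (simp add: openin_Int)
  obtain g3 where g3: "g3 \<in> polynomial_functions {1..n}" "g3 x0 \<noteq> 0"
    "\<And>x. x \<in> ?pts \<Longrightarrow> g3 x \<noteq> 0 \<Longrightarrow> x \<in> D \<and> \<rho> x \<in> V1 \<inter> V2"
    using pullback_open[OF D \<rho>_cont V12 x0D] V1(2) V2(2) by blast
  let ?L = "local_quotients ?pts (polynomial_functions {1..n}) x0"
  have pull: "(\<lambda>x. f (\<rho> x)) \<in> ?L" if f: "f \<in> regular Y V" and V: "openin (zariski Y) V" "V1 \<inter> V2 \<subseteq> V" for f V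
  proof -
    obtain g n' d' where g: "g \<in> polynomial_functions {1..n}" "n' \<in> polynomial_functions {1..n}"
      "d' \<in> polynomial_functions {1..n}" "g x0 \<noteq> 0"
      "\<And>x. x \<in> ?pts \<Longrightarrow> g x \<noteq> 0 \<Longrightarrow> x \<in> D \<Longrightarrow> \<rho> x \<in> V \<Longrightarrow> d' x \<noteq> 0 \<and> f (\<rho> x) = n' x / d' x"
      by (rule pullback_quotient[OF \<rho>_mor V(1) f x0D x0]) (use V(2) V1(2) V2(2) that in blast)+
    show ?thesis
      by (rule local_quotientsI[of "\<lambda>x. g x * g3 x" _ n' d'])
         (use g g3 V(2) in \<open>auto intro: pf.mult\<close>)
  qed
  have y_loc: "(\<lambda>x. \<phi> (\<rho> x) i) \<in> ?L" if i: "i \<in> {1..N}" for i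
  proof -
    have "(\<lambda>z. z i) \<circ> \<phi> \<in> regular (subspace_of Y V2) {x \<in> points (subspace_of Y V2). \<phi> x \<in> Z}"
    proof -
      have "openin (zariski (subspace_of (affine_space N) Z)) Z"
        using openin_topspace[of "zariski (subspace_of (affine_space N) Z)"] Z_pts
        by (simp add: points_subspace_of Int_absorb1)
      then show ?thesis using \<phi> coordinate_regular[OF i Z_pts] unfolding morphism_def by blast
    qed
    moreover have "{x \<in> points (subspace_of Y V2). \<phi> x \<in> Z} = V2"
      using inv(1) openin_subset[OF V2(1)] by (auto simp: points_subspace_of)
    ultimately have "(\<lambda>z. z i) \<circ> \<phi> \<in> regular Y V2" using Y.regular_open_subspace[OF V2(1)] by simp
    from pull[OF this V2(1)] show ?thesis by simp
  qed
  have r_loc: "(\<lambda>x. coeff (H (\<rho> x)) j) \<in> ?L" for j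
    by (rule pull[OF H(1) V1(1)]) simp
  \<comment> \<open>Near the image of the base point the coefficients of the equation are fractions
    of polynomial functions in the chart coordinates.\<close>
  have "\<exists>gpq. fst gpq \<in> polynomial_functions {1..N} \<and> fst (snd gpq) \<in> polynomial_functions {1..N} \<and>
      snd (snd gpq) \<in> polynomial_functions {1..N} \<and> fst gpq (\<phi> (\<rho> x0)) \<noteq> 0 \<and>
      (\<forall>z\<in>Z. fst gpq z \<noteq> 0 \<longrightarrow> \<psi> z \<in> V1 \<inter> V2 \<longrightarrow>
        snd (snd gpq) z \<noteq> 0 \<and> coeff (H (\<psi> z)) j = fst (snd gpq) z / snd (snd gpq) z)" for j
  proof -
    have f: "(\<lambda>y. coeff (H y) j) \<in> regular (subspace_of Y V2) (V1 \<inter> V2)"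
      using Y.regular_restrict[OF V1(1) V12 _ H(1)] V12 unfolding subspace_of_def by auto
    have op: "openin (zariski (subspace_of Y V2)) (V1 \<inter> V2)" using V12 V2(1) by (simp add: openin_open_subspace)
    have z0: "\<phi> (\<rho> x0) \<in> Z" "\<phi> (\<rho> x0) \<in> points (affine_space N)" "\<psi> (\<phi> (\<rho> x0)) \<in> V1 \<inter> V2"
      using inv(1)[OF V2(2)] Z_pts V1(2) V2(2) by auto
    obtain g p q where "g \<in> polynomial_functions {1..N}" "p \<in> polynomial_functions {1..N}"
      "q \<in> polynomial_functions {1..N}" "g (\<phi> (\<rho> x0)) \<noteq> 0"
      "\<And>z. z \<in> points (affine_space N) \<Longrightarrow> g z \<noteq> 0 \<Longrightarrow> z \<in> Z \<Longrightarrow> \<psi> z \<in> V1 \<inter> V2 \<Longrightarrow>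
        q z \<noteq> 0 \<and> coeff (H (\<psi> z)) j = p z / q z"
      by (rule pullback_quotient[OF \<psi> op f z0]) (rule that)
    then show ?thesis using Z_pts by (intro exI[of _ "(g, p, q)"]) auto
  qed
  then have "\<forall>j. \<exists>gpq. fst gpq \<in> polynomial_functions {1..N} \<and> fst (snd gpq) \<in> polynomial_functions {1..N} \<and>
      snd (snd gpq) \<in> polynomial_functions {1..N} \<and> fst gpq (\<phi> (\<rho> x0)) \<noteq> 0 \<and>
      (\<forall>z\<in>Z. fst gpq z \<noteq> 0 \<longrightarrow> \<psi> z \<in> V1 \<inter> V2 \<longrightarrow>
        snd (snd gpq) z \<noteq> 0 \<and> coeff (H (\<psi> z)) j = fst (snd gpq) z / snd (snd gpq) z)" ..
  from choice[OF this] obtain gpq where gpq: "\<forall>j. fst (gpq j) \<in> polynomial_functions {1..N} \<and>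
      fst (snd (gpq j)) \<in> polynomial_functions {1..N} \<and>
      snd (snd (gpq j)) \<in> polynomial_functions {1..N} \<and> fst (gpq j) (\<phi> (\<rho> x0)) \<noteq> 0 \<and>
      (\<forall>z\<in>Z. fst (gpq j) z \<noteq> 0 \<longrightarrow> \<psi> z \<in> V1 \<inter> V2 \<longrightarrow>
        snd (snd (gpq j)) z \<noteq> 0 \<and> coeff (H (\<psi> z)) j = fst (snd (gpq j)) z / snd (snd (gpq j)) z)" ..
  define g where "g j = fst (gpq j)" for j
  define p where "p j = fst (snd (gpq j))" for j
  define q where "q j = snd (snd (gpq j))" for j
  have pq: "p j \<in> polynomial_functions {1..N}" "q j \<in> polynomial_functions {1..N}"
    "g j \<in> polynomial_functions {1..N}" "g j (\<phi> (\<rho> x0)) \<noteq> 0" for j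
    using gpq by (auto simp: g_def p_def q_def)
  have rpq: "q j z \<noteq> 0 \<and> coeff (H (\<psi> z)) j = p j z / q j z" if "z \<in> Z" "g j z \<noteq> 0" "\<psi> z \<in> V1 \<inter> V2" for j z
    using gpq that by (simp add: g_def p_def q_def)
  interpret L: function_algebra ?L by (rule pf.local_quotients_algebra)
  \<comment> \<open>Where \<open>gs\<close> does not vanish, the fractions in the chart coordinates
    are valid for all \<open>j < m\<close>.\<close>
  define gs where "gs x = (\<Prod>j<m. g j (\<phi> (\<rho> x)))" for x
  have prod_in: "gs \<in> ?L" unfolding gs_def[abs_def]
  proof (rule L.prod)
    fix j
    show "(\<lambda>x. g j (\<phi> (\<rho> x))) \<in> ?L"
      by (rule L.polynomial_functions_compose[where f = "g j" and y = "\<lambda>x. \<phi> (\<rho> x)"]) (rule pq(3), rule y_loc)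
  qed
  have prod_nz: "gs x0 \<noteq> 0" using pq(4) by (simp add: gs_def)
  obtain g4 where g4: "g4 \<in> polynomial_functions {1..n}" "g4 x0 \<noteq> 0"
    "\<And>x. x \<in> ?pts \<Longrightarrow> g4 x \<noteq> 0 \<Longrightarrow> gs x \<noteq> 0"
    using pf.local_quotients_nonzero[OF prod_in x0 prod_nz] by blast
  note quot = local_quotients_triple[of _ ?pts "polynomial_functions {1..n}" x0]
  from bchoice[OF ballI[OF quot[OF y_loc]]] obtain ty where ty: "\<forall>i\<in>{1..N}. fst (ty i) \<in> polynomial_functions {1..n} \<and>
      fst (snd (ty i)) \<in> polynomial_functions {1..n} \<and> snd (snd (ty i)) \<in> polynomial_functions {1..n} \<and> fst (ty i) x0 \<noteq> 0 \<and>
      (\<forall>x\<in>?pts. fst (ty i) x \<noteq> 0 \<longrightarrow> snd (snd (ty i)) x \<noteq> 0 \<and> \<phi> (\<rho> x) i = fst (snd (ty i)) x / snd (snd (ty i)) x)" ..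
  from choice[OF allI[OF quot[OF r_loc]]] obtain tr where tr: "\<forall>j. fst (tr j) \<in> polynomial_functions {1..n} \<and>
      fst (snd (tr j)) \<in> polynomial_functions {1..n} \<and> snd (snd (tr j)) \<in> polynomial_functions {1..n} \<and> fst (tr j) x0 \<noteq> 0 \<and>
      (\<forall>x\<in>?pts. fst (tr j) x \<noteq> 0 \<longrightarrow> snd (snd (tr j)) x \<noteq> 0 \<and> coeff (H (\<rho> x)) j = fst (snd (tr j)) x / snd (snd (tr j)) x)" ..
  \<comment> \<open>The product of all functions whose nonvanishing the data of
    \<open>even_family\<close> require; composed with the family it becomes \<open>G\<close>
    there.\<close>
  define h where "h x = gU x * d x * g3 x * g4 x * (\<Prod>i=1..N. fst (ty i) x) * (\<Prod>j<m. fst (tr j) x)" for x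
  have h: "h \<in> polynomial_functions {1..n}" unfolding h_def[abs_def]
    by (intro pf.mult pf.prod gU d g3 g4) (use ty tr in auto)
  have hx0: "h x0 \<noteq> 0" using gx0 g3(2) g4(2) ty tr by (simp add: h_def)
  have h_nz: "gU x \<noteq> 0" "d x \<noteq> 0" "g3 x \<noteq> 0" "g4 x \<noteq> 0" "\<And>i. i \<in> {1..N} \<Longrightarrow> fst (ty i) x \<noteq> 0"
    "\<And>j. j < m \<Longrightarrow> fst (tr j) x \<noteq> 0" if "h x \<noteq> 0" for x
    using that by (auto simp: h_def)
  define k where "k = n div 2"
  \<comment> \<open>As the family passes through \<open>x0\<close>, it is not contained in the zero
    set of \<open>h\<close>.\<close>
  obtain X c v0 where X': "\<And>v. X v \<in> ?pts" "X v0 = x0"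
    "\<And>i. i \<in> {1..n} \<Longrightarrow> (\<lambda>v. X v i) \<in> polynomial_functions {1..n div 2}"
    "\<And>\<epsilon> v. \<epsilon> \<in> signs \<Longrightarrow> X (flip \<epsilon> v) = X v"
    "\<And>v i. i \<in> {1..n div 2} \<Longrightarrow> (c i + v i) ^ n + (\<Sum>j=1..n. X v j * (c i + v i) ^ (n - j)) = 0"
    by (rule even_root_family[OF x0]) (rule that)
  note X = X'[folded k_def]
  have comp: "(\<lambda>v. f (X v)) \<in> polynomial_functions {1..k}" if "f \<in> polynomial_functions {1..n}" for f
    using that by (rule pf.polynomial_functions_compose) (rule X(3))
  have inV: "\<rho> (X v) \<in> V1" "\<rho> (X v) \<in> V2" if "h (X v) \<noteq> 0" for v
    using g3(3)[OF X(1) h_nz(3)[OF that]] by auto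
  have rat: "rational_on k (\<lambda>v. h (X v)) (\<lambda>v. f (X v))"
    if n': "n' \<in> polynomial_functions {1..n}" and d': "d' \<in> polynomial_functions {1..n}"
      and eq: "\<forall>x\<in>?pts. h x \<noteq> 0 \<longrightarrow> d' x \<noteq> 0 \<and> f x = n' x / d' x" for f n' d'
    unfolding rational_on_def
    by (rule bexI[OF bexI[OF _ comp[OF d']] comp[OF n']]) (use eq X(1) in blast)
  interpret F: even_family k N m "\<lambda>v. h (X v)" "\<lambda>v. \<phi> (\<rho> (X v))" "\<lambda>j v. coeff (H (\<rho> (X v))) j" p q
    "\<lambda>v. a (X v)" "\<lambda>v. b (X v)" c v0
  proof
    show "(\<lambda>v. h (X v)) \<in> polynomial_functions {1..k}" by (rule comp[OF h])
    show "h (X v0) \<noteq> 0" using hx0 X(2) by simp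
    show "rational_on k (\<lambda>v. h (X v)) (\<lambda>v. \<phi> (\<rho> (X v)) i)" if i: "i \<in> {1..N}" for i
      by (rule rat[of "fst (snd (ty i))" "snd (snd (ty i))"]) (use ty i h_nz(5)[OF _ i] in blast)+
    show "rational_on k (\<lambda>v. h (X v)) (\<lambda>v. coeff (H (\<rho> (X v))) j)" if j: "j < m" for j
      by (rule rat[of "fst (snd (tr j))" "snd (snd (tr j))"]) (use tr h_nz(6)[OF _ j] in blast)+
    show "p j \<in> polynomial_functions {1..N}" "q j \<in> polynomial_functions {1..N}" for j by (rule pq)+
    show "q j (\<phi> (\<rho> (X v))) \<noteq> 0 \<and> coeff (H (\<rho> (X v))) j = p j (\<phi> (\<rho> (X v))) / q j (\<phi> (\<rho> (X v)))"
      if "j < m" "h (X v) \<noteq> 0" for j v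
    proof -
      have "g j (\<phi> (\<rho> (X v))) \<noteq> 0" using g4(3)[OF X(1) h_nz(4)[OF that(2)]] that(1) by (simp add: gs_def)
      then show ?thesis
        using rpq[of "\<phi> (\<rho> (X v))" j] inv(1)[OF inV(2)[OF that(2)]] inV[OF that(2)] by simp
    qed
    show "polynomial_family {1..k} (\<lambda>v. a (X v))" "polynomial_family {1..k} (\<lambda>v. b (X v))"
      by (rule polynomial_family_compose[OF ab(1) X(3)], assumption, rule polynomial_family_compose[OF ab(2) X(3)])
    show "poly (a (X v)) s \<noteq> 0 \<or> poly (b (X v)) s \<noteq> 0" if "h (X v) \<noteq> 0" for v s
      by (rule coprime[OF h_nz(2)[OF that]])
    show "\<exists>s. s ^ m + (\<Sum>j<m. coeff (H (\<rho> (X v))) j * s ^ j) = 0 \<and>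
        poly (a (X v)) s = (c i + v i) * poly (b (X v)) s" if hv: "h (X v) \<noteq> 0" and i: "i \<in> {1..k}" for v i
    proof -
      \<comment> \<open>The root \<open>c i + v i\<close> is a value of the universal function,
        hence equals \<open>R (X v, t)\<close> for some value \<open>t\<close> of \<open>w\<close>;
        this \<open>t\<close> is the required number \<open>s\<close>.\<close>
      have XU: "X v \<in> U" using gU(3) X(1) h_nz(1)[OF hv] by blast
      have "c i + v i \<in> values_at (universal_algfun n) (X v)" by (rule universal_values[OF X(1) X(5)[OF i]])
      then obtain t where t: "c i + v i = R (X v, t)" "t \<in> values_at w (\<rho> (X v))" using ind XU by blast
      have "(X v, t) \<in> E" using inE XU t(2) by blast
      then have "poly (a (X v)) t = (c i + v i) * poly (b (X v)) t" using abR[OF h_nz(2)[OF hv]] t(1) by simp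
      moreover have "poly (H (\<rho> (X v))) t = 0" by (rule H(4)[OF inV(1)[OF hv] t(2)])
      then have "t ^ m + (\<Sum>j<m. coeff (H (\<rho> (X v))) j * t ^ j) = 0"
        using monic_poly_expand[OF H(3)] by (simp add: H(2))
      ultimately show ?thesis by blast
    qed
  qed (simp_all add: X(4))
  obtain P where P: "P k = F.relations" "\<forall>i\<le>k. pf.prime_ideal {1..N} (P i)" "\<forall>i<k. P (Suc i) \<subset> P i"
    using F.relations_chain by blast
  have "enat k \<le> variety_dim Y"
  proof (rule dimension_bound[OF Y(1) V2(1) Z \<phi> \<psi> inv, where P = P])
    \<comment> \<open>Where \<open>h\<close> does not vanish on the family,
      \<open>\<phi> (\<rho> (X v))\<close> lies in \<open>Z\<close>, so equations of
      \<open>Z\<close> are relations.\<close>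
    show "f \<in> P k" if "f \<in> polynomial_functions {1..N}" "\<And>z. z \<in> Z \<Longrightarrow> f z = 0" for f
      unfolding P(1) F.relations_def using that inV(2) inv(1) by blast
  qed (use P in auto)
  then show False using assms(3) by (simp add: k_def)
qed

end
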